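(* Let $A=(a_{ij})\in\Sigma_{n\times r}(\mathbb{R}_{\geq0})$ with columns $C_1,\dots,C_r\in\mathbb{R}^n$, and for $J\subset[r]$ write $C_J(\boldsymbol\epsilon)=\prod_{j\in J}\langle C_j,\boldsymbol\epsilon\rangle$. The Shintani zeta function $$\zeta_A(\boldsymbol s)=\sum_{m_1\geq1}\cdots\sum_{m_r\geq1}(a_{11}m_1+\dots+a_{1r}m_r)^{-s_1}\times\cdots\times(a_{n1}m_1+\dots+a_{nr}m_r)^{-s_n}$$ admits a meromorphic continuation to $\mathbb{C}^n$ with possible simple poles located on the hyperplanes $$\langle\boldsymbol\mu_k^J,\boldsymbol s\rangle=\nu_k^J-l,\qquad J\subset[r],\ k,\ l\in\mathbb{Z}_{\geq0},$$ where, for each $J\subset[r]$, the $\boldsymbol\mu_k^J\in\mathbb{Z}^n$ ($k=1,\dots,N_J$) are the vectors in the inward normal direction of the facets of the polyhedron $\Delta_{C_J}+\mathbb{R}^n_+$ with mutually coprime coordinates, and the $\nu_k^J$ are the integers such that $\Delta_{C_J}+\mathbb{R}^n_+=\bigcap_{k=1}^{N_J}\{\boldsymbol\sigma\in\mathbb{R}^n:\langle\boldsymbol\mu_k^J,\boldsymbol\sigma\rangle\geq\nu_k^J\}$. Moreover, if $\boldsymbol\mu_k^J=e_i$ for some vector $e_i$ of the canonical basis of $\mathbb{R}^n$, then only the hyperplanes $\langle\boldsymbol\mu_k^J,\boldsymbol s\rangle=\nu_k^J-l$ with $0\leq l\leq\nu_k^J-1$ carry poles.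
   Context: $\Sigma_{n\times r}(\mathbb{R}_{\geq0})$ is the set of $n\times r$ real matrices with non-negative entries having at least one positive entry in each row and in each column. $[r]=\{1,\dots,r\}$. For a (Laurent) polynomial $p(\boldsymbol\epsilon)=\sum_{\alpha\in\mathcal A}a_\alpha\boldsymbol\epsilon^\alpha$ ($\mathcal A\subset\mathbb{Z}^n$ finite, $a_\alpha\neq0$), its Newton polytope $\Delta_p$ is the convex hull of $\mathcal A$. $\mathbb{R}^n_+=(0,\infty)^n$, and $\Delta+\mathbb{R}^n_+$ is the Minkowski sum. $\{e_i\}$ is the canonical basis.
   Formalization: With R^n_+ = (0,∞)^n the sum Δ_{C_J} + R^n_+ is open, so it has no facets and is not an intersection of closed half-spaces; the polyhedron is taken to be its closure, Δ_{C_J} + [0,∞)^n. *)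

theory Defs
  imports "HOL-Analysis.Analysis" "HOL-Library.Poly_Mapping"
begin

section \<open>The Shintani zeta function\<close>

definition Sigma_mat :: "(real ^ 'r ^ 'n) set" where
  "Sigma_mat = {A. (\<forall>i j. 0 \<le> A $ i $ j) \<and> (\<forall>i. \<exists>j. 0 < A $ i $ j) \<and> (\<forall>j. \<exists>i. 0 < A $ i $ j)}"

definition shintani_term :: "real ^ 'r ^ 'n \<Rightarrow> complex ^ 'n \<Rightarrow> ('r \<Rightarrow> nat) \<Rightarrow> complex" where
  "shintani_term A s m =
     (\<Prod>i\<in>UNIV. complex_of_real (\<Sum>j\<in>UNIV. A $ i $ j * real (m j)) powr (- (s $ i)))"

definition shintani_domain :: "real ^ 'r ^ 'n \<Rightarrow> (complex ^ 'n) set" where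
  "shintani_domain A = {s. (\<lambda>m. norm (shintani_term A s m)) summable_on {m. \<forall>j. 1 \<le> m j}}"

definition shintani_zeta :: "real ^ 'r ^ 'n \<Rightarrow> complex ^ 'n \<Rightarrow> complex" where
  "shintani_zeta A s = (\<Sum>\<^sub>\<infinity>m\<in>{m. \<forall>j. 1 \<le> m j}. shintani_term A s m)"


section \<open>Newton polytopes and their facets\<close>

text \<open>A Laurent polynomial in the variables \<open>\<epsilon>\<^sub>i\<close>, \<open>i :: 'n\<close>, is an element of the convolution
  ring \<open>('n \<Rightarrow>\<^sub>0 int) \<Rightarrow>\<^sub>0 real\<close>: it maps an exponent vector to its coefficient, and
  \<open>keys\<close> is the finite set of exponents with nonzero coefficient.\<close>

definition newton_polytope :: "(('n::finite \<Rightarrow>\<^sub>0 int) \<Rightarrow>\<^sub>0 real) \<Rightarrow> (real ^ 'n) set" where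
  "newton_polytope p =
     convex hull ((\<lambda>\<alpha>. \<chi> i. real_of_int (Poly_Mapping.lookup \<alpha> i)) ` Poly_Mapping.keys p)"

definition linear_form_poly :: "real ^ 'n \<Rightarrow> ('n::finite \<Rightarrow>\<^sub>0 int) \<Rightarrow>\<^sub>0 real" where
  "linear_form_poly c = (\<Sum>i\<in>UNIV. Poly_Mapping.single (Poly_Mapping.single i 1) (c $ i))"

definition column_poly :: "real ^ 'r ^ 'n \<Rightarrow> 'r set \<Rightarrow> ('n::finite \<Rightarrow>\<^sub>0 int) \<Rightarrow>\<^sub>0 real" where
  "column_poly A J = (\<Prod>j\<in>J. linear_form_poly (column j A))"

text \<open>Adding the open orthant \<open>(0,\<infinity>)\<^sup>n\<close> to a polytope gives an open set, which is not
  a polyhedron and has no facets. The polyhedron meant is the closure, that is, the sum of the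
  polytope and the closed orthant.\<close>

definition newton_polyhedron :: "(('n::finite \<Rightarrow>\<^sub>0 int) \<Rightarrow>\<^sub>0 real) \<Rightarrow> (real ^ 'n) set" where
  "newton_polyhedron p = closure {x + y |x y. x \<in> newton_polytope p \<and> (\<forall>i. 0 < y $ i)}"

text \<open>The bilinear pairing \<open>\<langle>\<mu>, s\<rangle>\<close>, used for real and for complex \<open>s\<close>.\<close>

definition int_pairing :: "int ^ 'n \<Rightarrow> 'a::comm_ring_1 ^ 'n \<Rightarrow> 'a" where
  "int_pairing \<mu> s = (\<Sum>i\<in>UNIV. of_int (\<mu> $ i) * s $ i)"

text \<open>Primitive vectors in the inward normal direction of the facets. Coprimality is that of all
  coordinates together. The inequality makes \<open>\<mu>\<close> constant on the facet \<open>F\<close> (take both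
  points in \<open>F\<close>), so \<open>\<mu>\<close> is normal to \<open>F\<close>, and makes it point into \<open>P\<close>.\<close>

definition facet_normals :: "(real ^ 'n) set \<Rightarrow> (int ^ 'n) set" where
  "facet_normals P =
     {\<mu>. Gcd (range (($) \<mu>)) = 1 \<and>
         (\<exists>F. F facet_of P \<and> (\<forall>y\<in>F. \<forall>x\<in>P. int_pairing \<mu> y \<le> int_pairing \<mu> x))}"

text \<open>\<open>\<nu>\<close> gives the integers \<open>\<nu>\<^sub>k\<close> in the facet description of \<open>P\<close>. It is indexed by the
  normals, since distinct facets of a full-dimensional polyhedron have distinct inward primitive
  normals. Only its values on \<open>facet_normals P\<close> matter.\<close>

definition facet_levels :: "(real ^ 'n) set \<Rightarrow> (int ^ 'n \<Rightarrow> int) \<Rightarrow> bool" where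
  "facet_levels P \<nu> \<longleftrightarrow>
     P = (\<Inter>\<mu>\<in>facet_normals P. {\<sigma>. int_pairing \<mu> \<sigma> \<ge> real_of_int (\<nu> \<mu>)})"


section \<open>Meromorphic functions of several variables with simple poles on hyperplanes\<close>

definition holomorphic_Cn :: "(complex ^ 'n \<Rightarrow> complex) \<Rightarrow> (complex ^ 'n) set \<Rightarrow> bool" where
  "holomorphic_Cn f U \<longleftrightarrow> open U \<and>
     (\<forall>s\<in>U. \<exists>D. (f has_derivative D) (at s) \<and> Vector_Spaces.linear (*s) (*) D)"

text \<open>A pair \<open>(\<mu>, c)\<close> stands for the hyperplane \<open>\<langle>\<mu>, s\<rangle> = c\<close>.\<close>

definition hyperplane_Cn :: "(int ^ 'n) \<times> int \<Rightarrow> (complex ^ 'n) set" where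
  "hyperplane_Cn h = {s. int_pairing (fst h) s = of_int (snd h)}"

text \<open>\<open>f\<close> is holomorphic off the hyperplanes in \<open>H\<close>, and near every point it becomes
  holomorphic after multiplication by finitely many of the affine forms, each taken once. In
  particular \<open>f\<close> is meromorphic on the whole space. The values of \<open>f\<close> on the hyperplanes are
  irrelevant. For the poles to be simple, distinct pairs in \<open>H\<close> must give distinct hyperplanes;
  this holds for primitive \<open>\<mu>\<close> with nonnegative coordinates, such as the facet normals of the
  polyhedra above.\<close>

definition meromorphic_simple_poles ::
    "(complex ^ 'n \<Rightarrow> complex) \<Rightarrow> ((int ^ 'n) \<times> int) set \<Rightarrow> bool" where
  "meromorphic_simple_poles f H \<longleftrightarrow>
     holomorphic_Cn f (- (\<Union>h\<in>H. hyperplane_Cn h)) \<and>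
     (\<forall>s\<^sub>0. \<exists>U K g. s\<^sub>0 \<in> U \<and> finite K \<and> K \<subseteq> H \<and> holomorphic_Cn g U \<and>
        (\<forall>s \<in> U - (\<Union>h\<in>H. hyperplane_Cn h).
           f s * (\<Prod>(\<mu>, c)\<in>K. int_pairing \<mu> s - of_int c) = g s))"

text \<open>The hyperplanes \<open>\<langle>\<mu>, s\<rangle> = \<nu> - l\<close>, where \<open>l\<close> is restricted to \<open>l \<le> \<nu> - 1\<close>
  if \<open>\<mu>\<close> is a vector of the canonical basis.\<close>

definition shintani_hyperplanes ::
    "real ^ 'r ^ 'n \<Rightarrow> ('r set \<Rightarrow> int ^ 'n \<Rightarrow> int) \<Rightarrow> ((int ^ 'n) \<times> int) set" where
  "shintani_hyperplanes A \<nu> =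
     {(\<mu>, \<nu> J \<mu> - int l) |J \<mu> l.
        \<mu> \<in> facet_normals (newton_polyhedron (column_poly A J)) \<and>
        ((\<exists>i. \<mu> = axis i 1) \<longrightarrow> int l \<le> \<nu> J \<mu> - 1)}"

end

theory Submission
  imports Defs "HOL-Complex_Analysis.Conformal_Mappings"
begin

text \<open>
  Write \<open>S j\<close> for the support of column \<open>j\<close> of \<open>A\<close>. The facets of the polyhedron of \<open>C\<^sub>J\<close> have the indicator
  vectors of the vertex sets \<open>T\<close> that are connected by the edges \<open>S j \<subseteq> T\<close>, \<open>j \<in> J\<close>, as normals, and the number
  of these edges as level. Up to the factor \<open>\<Gamma>(s\<^sub>1) \<cdots> \<Gamma>(s\<^sub>n)\<close> the zeta function is the
  Mellin transform of \<open>\<Prod>\<^sub>j 1 / (exp \<langle>C\<^sub>j, \<epsilon>\<rangle> - 1)\<close>, which is a product of Todd functions over a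
  product of linear forms. It converges absolutely where the pairing of \<open>Re s\<close> with every connected \<open>T\<close>
  exceeds the level of \<open>T\<close>. Integration by parts along the direction of \<open>T\<close> writes the product of one affine form
  with such an integral as a combination of integrals of the same shape that converge one step
  further in the direction of \<open>T\<close>. Iterating this gives the continuation, where each affine form is used
  at most once. Only the hyperplanes for \<open>J = [r]\<close> are needed; the other sets \<open>J\<close> merely enlarge
  the set of allowed poles.
\<close>

section \<open>Connected vertex sets and the Newton polyhedron\<close>

text \<open>The delicate point of the integration by parts is an edge \<open>S j\<close> that meets
  \<open>T\<close> without lying in it: its form is not homogeneous along \<open>T\<close>, so its
  power in the denominator goes up, which by itself would shrink the domain of convergence. The
  accompanying \<open>\<epsilon>\<^sub>i\<close> has \<open>i\<close> in \<open>T\<close> and in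
  \<open>S j\<close>, and every set whose level rises contains \<open>S j\<close>, hence
  \<open>i\<close>, so the loss is compensated. The balance "level for \<open>k\<close> plus
  \<open>d T\<close> equals level for 1 plus the accumulated shift" keeps the account:
  \<open>d T\<close> is the distance by which the integral converges beyond the original barrier of
  \<open>T\<close>. A step along \<open>T\<close> uses the form with \<open>l = d T\<close> and
  raises \<open>d T\<close>, which never falls again; hence no form occurs twice. The Todd functions
  are split off because their derivatives decay exponentially and stay bounded near 0, so near the
  boundary of the orthant only powers of linear forms matter. A second obstacle is that the series
  may converge absolutely outside the first tube; agreement there comes from lines in the direction
  (1, ..., 1) and continuation in one variable.\<close>

text \<open>The sets \<open>S j\<close>, \<open>j \<in> J\<close>, are the edges of a hypergraph. A vertex set \<open>T\<close> is linked if it is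
  nonempty and the edges inside \<open>T\<close> connect it. A set that is not linked splits into parts whose
  levels add up, so its inequality is redundant.\<close>

definition linked :: "('r \<Rightarrow> 'n set) \<Rightarrow> 'r set \<Rightarrow> 'n set \<Rightarrow> bool" where
  "linked S J T \<longleftrightarrow> T \<noteq> {} \<and>
     (\<forall>T'. T' \<noteq> {} \<and> T' \<subset> T \<longrightarrow> (\<exists>j\<in>J. S j \<subseteq> T \<and> S j \<inter> T' \<noteq> {} \<and> \<not> S j \<subseteq> T'))"

definition level :: "('r \<Rightarrow> 'n set) \<Rightarrow> ('r \<Rightarrow> 'a::comm_monoid_add) \<Rightarrow> 'r set \<Rightarrow> 'n set \<Rightarrow> 'a" where
  "level S k J T = (\<Sum>j | j \<in> J \<and> S j \<subseteq> T. k j)"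

lemma linked_singleton [simp]: "linked S J {i}"
  by (auto simp: linked_def)

lemma level_alt: "finite J \<Longrightarrow> level S k J T = (\<Sum>j\<in>J. if S j \<subseteq> T then k j else 0)"
  unfolding level_def by (simp add: sum.If_cases Int_def)

text \<open>Subtract from \<open>u\<close> its minimum on a connected component of its support: the minima over the
  edges in that component drop by the same amount, and all others are unchanged.\<close>

lemma linked_cover:
  fixes u \<tau> :: "'n::finite \<Rightarrow> real" and S :: "'r \<Rightarrow> 'n set"
  assumes J: "finite J" and S: "\<And>j. j \<in> J \<Longrightarrow> S j \<noteq> {}"
    and \<tau>: "\<And>T. linked S J T \<Longrightarrow> level S k J T \<le> sum \<tau> T"
    and u: "\<And>i. 0 \<le> u i"
  shows "(\<Sum>j\<in>J. k j * Min (u ` S j)) \<le> (\<Sum>i\<in>UNIV. \<tau> i * u i)"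
  using u
proof (induction "card {i. u i \<noteq> 0}" arbitrary: u rule: less_induct)
  case less
  define W where "W = {i. u i \<noteq> 0}"
  show ?case
  proof (cases "W = {}")
    case True
    then have "u = (\<lambda>_. 0)" by (auto simp: W_def)
    then show ?thesis using S by (simp add: image_constant_conv)
  next
    case False
    \<comment> \<open>\<open>C\<close> consists of the nonempty unions of connected components of
      \<open>W\<close>: subsets closed under every edge inside \<open>W\<close> that meets them. Its
      minimal members are linked. Edges leaving \<open>W\<close> are harmless, since
      \<open>u\<close> has minimum 0 on them.\<close>
    define C where "C = {T. T \<noteq> {} \<and> T \<subseteq> W \<and> (\<forall>j\<in>J. S j \<subseteq> W \<longrightarrow> S j \<inter> T \<noteq> {} \<longrightarrow> S j \<subseteq> T)}"
    have "W \<in> C" using False by (auto simp: C_def)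
    then obtain T where T: "T \<in> C" and Tmin: "\<And>T'. T' \<in> C \<Longrightarrow> T' \<subseteq> T \<Longrightarrow> T = T'"
      using finite_has_minimal[of C] by (metis empty_iff finite)
    have "linked S J T"
      unfolding linked_def
    proof (intro conjI allI impI)
      show "T \<noteq> {}" using T by (simp add: C_def)
      fix T' assume T': "T' \<noteq> {} \<and> T' \<subset> T"
      then have "T' \<notin> C" using Tmin[of T'] by blast
      moreover have "T' \<subseteq> W" using T T' by (simp add: C_def) blast
      ultimately have "\<exists>j\<in>J. S j \<subseteq> W \<and> S j \<inter> T' \<noteq> {} \<and> \<not> S j \<subseteq> T'"
        using T' by (simp add: C_def)
      then obtain j where j: "j \<in> J" "S j \<subseteq> W" "S j \<inter> T' \<noteq> {}" "\<not> S j \<subseteq> T'"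
        by (elim bexE conjE)
      moreover have "S j \<inter> T \<noteq> {}" using j(3) T' by blast
      ultimately have "S j \<subseteq> T" using T by (simp add: C_def)
      then show "\<exists>j\<in>J. S j \<subseteq> T \<and> S j \<inter> T' \<noteq> {} \<and> \<not> S j \<subseteq> T'"
        using j by (intro bexI[of _ j] conjI)
    qed
    note lev = \<tau>[OF this]
    define m where "m = Min (u ` T)"
    have Tne: "T \<noteq> {}" and TW: "T \<subseteq> W" using T by (auto simp: C_def)
    have m_le: "m \<le> u i" if "i \<in> T" for i using that by (simp add: m_def)
    have "m \<in> u ` T" unfolding m_def using Tne by (intro Min_in) auto
    then obtain i0 where i0: "i0 \<in> T" "m = u i0" by blast
    have "m > 0" using i0 TW less.prems[of i0] by (auto simp: W_def order_less_le)
    define u' where "u' = (\<lambda>i. u i - (if i \<in> T then m else 0))"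
    have u'0: "0 \<le> u' i" for i using m_le less.prems by (auto simp: u'_def)
    have "{i. u' i \<noteq> 0} \<subset> {i. u i \<noteq> 0}"
    proof
      show "{i. u' i \<noteq> 0} \<subseteq> {i. u i \<noteq> 0}" using TW by (auto simp: u'_def W_def)
      show "{i. u' i \<noteq> 0} \<noteq> {i. u i \<noteq> 0}" using i0 TW by (auto simp: u'_def W_def)
    qed
    then have IH: "(\<Sum>j\<in>J. k j * Min (u' ` S j)) \<le> (\<Sum>i\<in>UNIV. \<tau> i * u' i)"
      by (intro less.hyps psubset_card_mono u'0) auto
    have Min: "Min (u ` S j) = Min (u' ` S j) + (if S j \<subseteq> T then m else 0)" if "j \<in> J" for j
    proof (cases "S j \<subseteq> T")
      case True
      then have "u ` S j = (\<lambda>i. u' i + m) ` S j" by (intro image_cong) (auto simp: u'_def)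
      then show ?thesis using True S[OF that] Min_add_commute[of "S j" u' m] by simp
    next
      case nT: False
      show ?thesis
      proof (cases "S j \<subseteq> W")
        case True
        then have "S j \<inter> T = {}" using nT T that by (auto simp: C_def)
        then have "u ` S j = u' ` S j" by (intro image_cong) (auto simp: u'_def)
        then show ?thesis using nT by simp
      next
        case False
        then obtain i where i: "i \<in> S j" "u i = 0" by (auto simp: W_def)
        then have "u' i = 0" using TW by (auto simp: u'_def W_def)
        then have "Min (u' ` S j) = 0" using i u'0 by (intro Min_eqI) (auto intro: rev_image_eqI)
        moreover have "Min (u ` S j) = 0" using i less.prems by (intro Min_eqI) (auto intro: rev_image_eqI)
        ultimately show ?thesis using nT by simp
      qed
    qed
    have "(\<Sum>j\<in>J. k j * Min (u ` S j)) = (\<Sum>j\<in>J. k j * Min (u' ` S j)) + level S k J T * m"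
      unfolding level_alt[OF J] sum_distrib_right sum.distrib[symmetric]
      by (intro sum.cong refl) (auto simp: Min algebra_simps)
    also have "\<dots> \<le> (\<Sum>i\<in>UNIV. \<tau> i * u' i) + sum \<tau> T * m"
      using IH lev \<open>m > 0\<close> by (intro add_mono mult_right_mono) auto
    also have "\<dots> = (\<Sum>i\<in>UNIV. \<tau> i * u' i) + (\<Sum>i\<in>UNIV. if i \<in> T then \<tau> i * m else 0)"
      by (simp add: sum.If_cases sum_distrib_right)
    also have "\<dots> = (\<Sum>i\<in>UNIV. \<tau> i * u i)"
      unfolding sum.distrib[symmetric] by (intro sum.cong refl) (auto simp: u'_def algebra_simps)
    finally show ?thesis .
  qed
qed


text \<open>Over an arbitrary type, because the integer vector serves as a facet normal and the real
  vector as a direction of integration by parts.\<close>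

definition ivec :: "'n set \<Rightarrow> 'a::zero_neq_one ^ 'n" where
  "ivec T = (\<chi> i. if i \<in> T then 1 else 0)"

lemma inner_ivec: "(ivec T :: real ^ 'n) \<bullet> x = (\<Sum>i\<in>T. x $ i)"
proof -
  have "(ivec T :: real ^ 'n) \<bullet> x = (\<Sum>i\<in>UNIV. if i \<in> T then x $ i else 0)"
    unfolding inner_vec_def ivec_def by (intro sum.cong) auto
  then show ?thesis by (simp add: sum.If_cases)
qed

lemma int_pairing_ivec: "int_pairing (ivec T) s = (\<Sum>i\<in>T. s $ i)"
proof -
  have "int_pairing (ivec T) s = (\<Sum>i\<in>UNIV. if i \<in> T then s $ i else 0)"
    unfolding int_pairing_def ivec_def by (intro sum.cong) auto
  then show ?thesis by (simp add: sum.If_cases)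
qed

lemma inj_ivec: "inj (ivec :: 'n::finite set \<Rightarrow> 'a::zero_neq_one ^ 'n)"
  by (rule injI) (auto simp: ivec_def vec_eq_iff split: if_splits)

text \<open>Nonnegative coefficients do not cancel, so the exponents of a product are exactly the sums of
  exponents of its factors.\<close>

lemma lookup_linear_form_mult:
  "Poly_Mapping.lookup (linear_form_poly c * p) \<gamma> =
    (\<Sum>i\<in>UNIV. \<Sum>b\<in>Poly_Mapping.keys p.
      (c $ i * Poly_Mapping.lookup p b when Poly_Mapping.single i 1 + b = \<gamma>))"
proof -
  have p: "p = (\<Sum>b\<in>Poly_Mapping.keys p. Poly_Mapping.single b (Poly_Mapping.lookup p b))"
    by (rule poly_mapping_eqI) (auto simp: lookup_sum lookup_single when_def in_keys_iff)
  have "linear_form_poly c * p = (\<Sum>i\<in>UNIV. \<Sum>b\<in>Poly_Mapping.keys p.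
      Poly_Mapping.single (Poly_Mapping.single i 1 + b) (c $ i * Poly_Mapping.lookup p b))"
    by (subst p) (simp add: linear_form_poly_def sum_product mult_single)
  then show ?thesis by (simp add: lookup_sum lookup_single)
qed

lemma keys_linear_form_mult:
  assumes c: "\<And>i. 0 \<le> c $ i" and p: "\<And>b. 0 \<le> Poly_Mapping.lookup p b"
  shows "0 \<le> Poly_Mapping.lookup (linear_form_poly c * p) \<gamma>"
    and "Poly_Mapping.keys (linear_form_poly c * p) =
      {Poly_Mapping.single i 1 + b | i b. 0 < c $ i \<and> b \<in> Poly_Mapping.keys p}"
proof -
  have nonneg: "0 \<le> (c $ i * Poly_Mapping.lookup p b when Poly_Mapping.single i 1 + b = \<gamma>)" for i b \<gamma>
    using c p by (auto simp: when_def)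
  show "0 \<le> Poly_Mapping.lookup (linear_form_poly c * p) \<gamma>"
    unfolding lookup_linear_form_mult by (intro sum_nonneg nonneg)
  have "Poly_Mapping.lookup (linear_form_poly c * p) \<gamma> \<noteq> 0 \<longleftrightarrow>
     (\<exists>i b. 0 < c $ i \<and> b \<in> Poly_Mapping.keys p \<and> \<gamma> = Poly_Mapping.single i 1 + b)" for \<gamma>
  proof -
    have "Poly_Mapping.lookup (linear_form_poly c * p) \<gamma> \<noteq> 0 \<longleftrightarrow>
       (\<exists>i. \<exists>b\<in>Poly_Mapping.keys p. (c $ i * Poly_Mapping.lookup p b when Poly_Mapping.single i 1 + b = \<gamma>) \<noteq> 0)"
      unfolding lookup_linear_form_mult
      by (subst sum_nonneg_eq_0_iff, simp, intro sum_nonneg nonneg, subst sum_nonneg_eq_0_iff)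
         (use nonneg in auto)
    also have "\<dots> \<longleftrightarrow> (\<exists>i. \<exists>b\<in>Poly_Mapping.keys p. 0 < c $ i \<and> \<gamma> = Poly_Mapping.single i 1 + b)"
      using c by (auto simp: when_def in_keys_iff less_le)
    finally show ?thesis by blast
  qed
  then show "Poly_Mapping.keys (linear_form_poly c * p) =
      {Poly_Mapping.single i 1 + b | i b. 0 < c $ i \<and> b \<in> Poly_Mapping.keys p}"
    unfolding set_eq_iff in_keys_iff[of _ "linear_form_poly c * p"] by blast
qed

definition column_support :: "real ^ 'r ^ 'n \<Rightarrow> 'r \<Rightarrow> 'n set" where
  "column_support A j = {i. 0 < A $ i $ j}"

lemma column_support_nonempty: "A \<in> Sigma_mat \<Longrightarrow> column_support A j \<noteq> {}"
  by (auto simp: Sigma_mat_def column_support_def)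

text \<open>Expanding the product selects one variable from each column, so the exponents come from
  choice functions \<open>\<phi>\<close>. Nonnegativity of the coefficients is carried along because
  the induction step needs it to exclude cancellation.\<close>

lemma exponents_column_poly:
  fixes A :: "real ^ 'r ^ 'n::finite"
  assumes A: "A \<in> Sigma_mat"
  shows "(\<forall>b. 0 \<le> Poly_Mapping.lookup (column_poly A J) b) \<and>
    (\<lambda>\<alpha>. \<chi> i. real_of_int (Poly_Mapping.lookup \<alpha> i)) ` Poly_Mapping.keys (column_poly A J) =
      {\<Sum>j\<in>J. axis (\<phi> j) 1 | \<phi>. \<forall>j\<in>J. \<phi> j \<in> column_support A j}"
proof (induction J rule: finite_induct[OF finite])
  case 1
  show ?case by (auto simp: column_poly_def lookup_one when_def vec_eq_iff)
next
  case (2 j J)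
  let ?v = "\<lambda>\<alpha>. (\<chi> i. real_of_int (Poly_Mapping.lookup \<alpha> i)) :: real ^ 'n"
  let ?P = "column_poly A J"
  have eq: "column_poly A (insert j J) = linear_form_poly (column j A) * ?P"
    using 2 by (simp add: column_poly_def)
  have c: "0 \<le> column j A $ i" for i using A by (simp add: Sigma_mat_def column_def)
  have P: "0 \<le> Poly_Mapping.lookup ?P b" for b using 2 by blast
  have v: "?v (Poly_Mapping.single i 1 + b) = axis i 1 + ?v b" for i b
    by (simp add: vec_eq_iff lookup_add lookup_single axis_def when_def)
  have "?v ` Poly_Mapping.keys (column_poly A (insert j J)) =
      {axis i 1 + w | i w. i \<in> column_support A j \<and> w \<in> ?v ` Poly_Mapping.keys ?P}"
  proof -
    have "?v ` Poly_Mapping.keys (column_poly A (insert j J)) =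
      {?v (Poly_Mapping.single i 1 + b) | i b. 0 < column j A $ i \<and> b \<in> Poly_Mapping.keys ?P}"
      unfolding eq keys_linear_form_mult(2)[OF c P] by blast
    also have "\<dots> = {axis i 1 + w | i w. i \<in> column_support A j \<and> w \<in> ?v ` Poly_Mapping.keys ?P}"
      unfolding v by (auto simp: column_support_def column_def)
    finally show ?thesis .
  qed
  also have "\<dots> = {axis i 1 + (\<Sum>j\<in>J. axis (\<phi> j) 1) | i \<phi>.
      i \<in> column_support A j \<and> (\<forall>j\<in>J. \<phi> j \<in> column_support A j)}"
    using 2 by auto
  also have "\<dots> = {\<Sum>j\<in>insert j J. axis (\<phi> j) 1 | \<phi>. \<forall>j\<in>insert j J. \<phi> j \<in> column_support A j}"
  proof (intro equalityI subsetI; clarify)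
    fix i \<phi> assume "i \<in> column_support A j" "\<forall>j\<in>J. \<phi> j \<in> column_support A j"
    then show "\<exists>\<psi>. axis i 1 + (\<Sum>j\<in>J. axis (\<phi> j) 1) = (\<Sum>j\<in>insert j J. axis (\<psi> j) (1::real)) \<and>
        (\<forall>j\<in>insert j J. \<psi> j \<in> column_support A j)"
      using 2 by (intro exI[of _ "\<phi>(j := i)"]) (auto intro!: sum.cong)
  next
    fix \<phi> assume "\<forall>j\<in>insert j J. \<phi> j \<in> column_support A j"
    then show "\<exists>i \<psi>. (\<Sum>j\<in>insert j J. axis (\<phi> j) (1::real)) = axis i 1 + (\<Sum>j\<in>J. axis (\<psi> j) 1) \<and>
        i \<in> column_support A j \<and> (\<forall>j\<in>J. \<psi> j \<in> column_support A j)"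
      using 2 by (intro exI[of _ "\<phi> j"] exI[of _ \<phi>]) auto
  qed
  finally show ?case
    using keys_linear_form_mult(1)[OF c P] by (simp add: eq)
qed

text \<open>The outer description of the Newton polyhedron. Restricting it to linked sets makes the
  system irredundant, so that its half-spaces correspond to the facets.\<close>

definition level_polyhedron :: "('r \<Rightarrow> 'n set) \<Rightarrow> 'r set \<Rightarrow> (real ^ 'n) set" where
  "level_polyhedron S J = {\<sigma>. \<forall>T. linked S J T \<longrightarrow> level S (\<lambda>_. 1) J T \<le> (\<Sum>i\<in>T. \<sigma> $ i)}"

lemma level_polyhedron_halfspaces:
  "level_polyhedron S J = (\<Inter>T\<in>Collect (linked S J). {\<sigma>. level S (\<lambda>_. 1) J T \<le> ivec T \<bullet> \<sigma>})"
  by (auto simp: level_polyhedron_def inner_ivec)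

text \<open>Every vertex satisfies the inequalities because an edge inside \<open>T\<close> places
  its unit of mass in \<open>T\<close>. Conversely, a point outside would be separated by some
  \<open>a\<close>; the orthant forces \<open>a\<close> to be nonnegative, the minimum of
  \<open>a\<close> over the vertices is the sum of its minima over the edges, and
  \<open>linked_cover\<close> bounds that sum by \<open>a \<bullet> \<sigma>\<close>.\<close>

lemma newton_polyhedron_column_poly:
  fixes A :: "real ^ 'r ^ 'n::finite"
  assumes A: "A \<in> Sigma_mat"
  shows "newton_polyhedron (column_poly A J) = level_polyhedron (column_support A) J"
proof -
  let ?S = "column_support A"
  define V where "V = {\<Sum>j\<in>J. axis (\<phi> j) (1::real) | \<phi>. \<forall>j\<in>J. \<phi> j \<in> ?S j}"
  define Q where "Q = {x + y |x y. x \<in> convex hull V \<and> (\<forall>i. 0 < y $ i)}"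
  have N: "newton_polyhedron (column_poly A J) = closure Q"
    using exponents_column_poly[OF A, of J]
    unfolding newton_polyhedron_def newton_polytope_def Q_def V_def by simp
  have V_inner: "a \<bullet> (\<Sum>j\<in>J. axis (\<phi> j) (1::real)) = (\<Sum>j\<in>J. a $ \<phi> j)" for a :: "real ^ 'n" and \<phi>
    by (simp add: inner_sum_right inner_axis)
  have VQ: "v + y \<in> Q" if "v \<in> V" "\<And>i. 0 < y $ i" for v y
    unfolding Q_def using that hull_inc[of v V convex] by blast
  have conv: "convex (level_polyhedron ?S J)" and clos: "closed (level_polyhedron ?S J)"
    unfolding level_polyhedron_halfspaces
    by (auto intro!: convex_INT convex_halfspace_ge closed_INT closed_halfspace_ge)
  have "V \<subseteq> level_polyhedron ?S J"
  proof
    fix v assume "v \<in> V"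
    then obtain \<phi> where \<phi>: "v = (\<Sum>j\<in>J. axis (\<phi> j) (1::real))" "\<forall>j\<in>J. \<phi> j \<in> ?S j"
      by (auto simp: V_def)
    have "level ?S (\<lambda>_. 1) J T \<le> ivec T \<bullet> v" for T
      unfolding \<phi>(1) V_inner level_alt[OF finite] using \<phi>(2)
      by (intro sum_mono) (auto simp: ivec_def)
    then show "v \<in> level_polyhedron ?S J" by (simp add: level_polyhedron_halfspaces)
  qed
  then have hull: "convex hull V \<subseteq> level_polyhedron ?S J" by (rule hull_minimal) (rule conv)
  have "Q \<subseteq> level_polyhedron ?S J"
  proof
    fix z assume "z \<in> Q"
    then obtain x y where xy: "z = x + y" "x \<in> convex hull V" "\<And>i. 0 < y $ i"
      unfolding Q_def by blast
    then have "x \<in> level_polyhedron ?S J" using hull by blast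
    moreover have "0 \<le> (\<Sum>i\<in>T. y $ i)" for T using xy by (simp add: sum_nonneg less_imp_le)
    ultimately show "z \<in> level_polyhedron ?S J"
      unfolding level_polyhedron_def xy(1) by (auto simp: sum.distrib intro: add_increasing2)
  qed
  then have "closure Q \<subseteq> level_polyhedron ?S J" using clos by (rule closure_minimal)
  moreover have "level_polyhedron ?S J \<subseteq> closure Q"
  proof
    fix \<sigma> assume \<sigma>: "\<sigma> \<in> level_polyhedron ?S J"
    show "\<sigma> \<in> closure Q"
    proof (rule ccontr)
      assume "\<sigma> \<notin> closure Q"
      have "convex Q"
      proof -
        have "Q = (\<Union>x\<in>convex hull V. \<Union>y\<in>{y. \<forall>i. 0 < y $ i}. {x + y})" by (auto simp: Q_def)
        moreover have "{y :: real ^ 'n. \<forall>i. 0 < y $ i} = (\<Inter>i. {y. axis i 1 \<bullet> y > 0})"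
          by (auto simp: inner_axis')
        then have "convex {y :: real ^ 'n. \<forall>i. 0 < y $ i}"
          by (auto intro!: convex_INT convex_halfspace_gt)
        ultimately show ?thesis using convex_sums[OF convex_convex_hull[of V]] by simp
      qed
      then obtain a b where ab: "a \<bullet> \<sigma> < b" "\<And>x. x \<in> closure Q \<Longrightarrow> b < a \<bullet> x"
        using separating_hyperplane_closed_point[of "closure Q" \<sigma>] \<open>\<sigma> \<notin> closure Q\<close>
        by (metis closed_closure convex_closure)
      \<comment> \<open>\<open>\<phi>\<close> picks in each edge a coordinate where \<open>a\<close>
        is minimal; the resulting vertex \<open>v\<close> minimizes \<open>a\<close> over
        \<open>V\<close>.\<close>
      define \<phi> where "\<phi> = (\<lambda>j. SOME i. i \<in> ?S j \<and> a $ i = Min (($) a ` ?S j))"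
      have \<phi>: "\<phi> j \<in> ?S j \<and> a $ \<phi> j = Min (($) a ` ?S j)" for j
      proof -
        have "Min (($) a ` ?S j) \<in> ($) a ` ?S j"
          using column_support_nonempty[OF A] by (intro Min_in) auto
        then have "\<exists>i. i \<in> ?S j \<and> a $ i = Min (($) a ` ?S j)" by auto
        then show ?thesis unfolding \<phi>_def by (rule someI_ex)
      qed
      define v where "v = (\<Sum>j\<in>J. axis (\<phi> j) (1::real))"
      have "v \<in> V" unfolding v_def V_def using \<phi> by blast
      have bQ: "b < a \<bullet> v + a \<bullet> y" if "\<And>i. 0 < y $ i" for y
        using ab(2)[of "v + y"] VQ[OF \<open>v \<in> V\<close> that] closure_subset by (auto simp: inner_add_right)
      define s where "s = (\<Sum>i\<in>UNIV. a $ i)"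
      have one: "a \<bullet> vec 1 = s" by (simp add: inner_vec_def s_def)
      have a0: "0 \<le> a $ i" for i
      proof (rule ccontr)
        assume neg: "\<not> 0 \<le> a $ i"
        \<comment> \<open>With this \<open>t\<close> the point
          \<open>v + vec 1 + t *\<^sub>R axis i 1\<close> would lie in \<open>Q\<close> and have the
          value exactly \<open>b\<close>.\<close>
        define t where "t = (a \<bullet> v + s - b) / (- (a $ i))"
        have "0 < t" unfolding t_def using bQ[of "vec 1"] one neg by (intro divide_pos_pos) auto
        then have "b < a \<bullet> v + a \<bullet> (vec 1 + t *\<^sub>R axis i 1)"
          by (intro bQ) (auto simp: axis_def)
        also have "a \<bullet> (vec 1 + t *\<^sub>R axis i 1) = s + t * a $ i"
          unfolding inner_add_right one by (simp add: inner_axis)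
        also have "t * a $ i = b - s - a \<bullet> v" using neg by (simp add: t_def)
        finally show False by simp
      qed
      \<comment> \<open>The orthant is open, so \<open>v\<close> is reached only as a limit of
        points of \<open>Q\<close>; a shift by \<open>e / (s + 1)\<close> in every coordinate costs
        at most \<open>e\<close>.\<close>
      have "b \<le> a \<bullet> v"
      proof (rule field_le_epsilon)
        fix e :: real assume "0 < e"
        have s0: "0 \<le> s" using a0 by (simp add: s_def sum_nonneg)
        have "b < a \<bullet> v + a \<bullet> (vec (e / (s + 1)))"
          using \<open>0 < e\<close> s0 by (intro bQ) auto
        also have "a \<bullet> vec (e / (s + 1)) = s * (e / (s + 1))"
          by (simp add: inner_vec_def s_def sum_distrib_right sum_divide_distrib)
        also have "s * (e / (s + 1)) \<le> e" using \<open>0 < e\<close> s0 by (simp add: field_simps)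
        finally show "b \<le> a \<bullet> v + e" by simp
      qed
      also have "a \<bullet> v = (\<Sum>j\<in>J. 1 * Min (($) a ` ?S j))"
        unfolding v_def V_inner using \<phi> by simp
      also have "\<dots> \<le> (\<Sum>i\<in>UNIV. \<sigma> $ i * a $ i)"
        using \<sigma> a0 column_support_nonempty[OF A]
        by (intro linked_cover) (auto simp: level_polyhedron_def)
      also have "\<dots> = a \<bullet> \<sigma>" by (simp add: inner_vec_def mult.commute)
      finally show False using ab(1) by simp
    qed
  qed
  ultimately show ?thesis using N by simp
qed

section \<open>Facets, their primitive normals and their levels\<close>

lemma linked_nonempty: "linked S J T \<Longrightarrow> T \<noteq> {}"
  by (simp add: linked_def)

text \<open>The point is a sum of barycentres, of \<open>S j\<close> if \<open>S j \<subseteq> T\<close> and of \<open>S j - T\<close> otherwise, plus the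
  indicator vector of the complement of \<open>T\<close>.\<close>

lemma touching_point:
  fixes S :: "'r::finite \<Rightarrow> 'n::finite set"
  assumes S: "\<And>j. j \<in> J \<Longrightarrow> S j \<noteq> {}" and T: "linked S J T"
  obtains p :: "real ^ 'n" where "(\<Sum>i\<in>T. p $ i) = level S (\<lambda>_. 1) J T"
    "\<And>T'. T' \<noteq> {} \<Longrightarrow> T' \<noteq> T \<Longrightarrow> level S (\<lambda>_. 1) J T' + 1 / CARD('n) \<le> (\<Sum>i\<in>T'. p $ i)"
proof -
  define B where "B = (\<lambda>j. if S j \<subseteq> T then S j else S j - T)"
  define w where "w = (\<lambda>T' j. real (card (B j \<inter> T')) / real (card (B j)))"
  define p :: "real ^ 'n" where
    "p = (\<chi> i. (\<Sum>j\<in>J. if i \<in> B j then 1 / real (card (B j)) else 0) + (if i \<in> T then 0 else 1))"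
  have sum: "(\<Sum>i\<in>T'. p $ i) = (\<Sum>j\<in>J. w T' j) + real (card (T' - T))" for T'
  proof -
    have "(\<Sum>i\<in>T'. \<Sum>j\<in>J. if i \<in> B j then 1 / real (card (B j)) else 0) = (\<Sum>j\<in>J. w T' j)"
      by (subst sum.swap) (simp add: sum.If_cases w_def Int_commute)
    moreover have "(\<Sum>i\<in>T'. if i \<in> T then 0 else (1::real)) = real (card (T' - T))"
      by (simp add: sum.If_cases Diff_eq)
    ultimately show ?thesis by (simp add: p_def sum.distrib)
  qed
  have B: "B j \<noteq> {}" "B j \<subseteq> S j" if "j \<in> J" for j
    using S[OF that] by (auto simp: B_def)
  have w_full: "w T' j = 1" if "j \<in> J" "B j \<subseteq> T'" for T' j
    using that B[OF that(1)] by (simp add: w_def Int_absorb2)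
  have w_ge: "(if S j \<subseteq> T' then 1 else 0) \<le> w T' j" if "j \<in> J" for T' j
  proof (cases "S j \<subseteq> T'")
    case True
    then show ?thesis using w_full[OF that, of T'] B[OF that] by auto
  qed (simp add: w_def)
  have ge: "level S (\<lambda>_. 1) J T' \<le> (\<Sum>j\<in>J. w T' j)" for T'
    unfolding level_alt[OF finite] by (intro sum_mono w_ge)
  have "(\<Sum>j\<in>J. w T j) = (\<Sum>j\<in>J. if S j \<subseteq> T then 1 else 0)"
  proof (intro sum.cong refl)
    fix j assume "j \<in> J"
    show "w T j = (if S j \<subseteq> T then 1 else 0)"
    proof (cases "S j \<subseteq> T")
      case True
      then show ?thesis using w_full[OF \<open>j \<in> J\<close>, of T] by (simp add: B_def)
    next
      case False
      then have "B j \<inter> T = {}" by (auto simp: B_def)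
      then show ?thesis using False by (simp add: w_def)
    qed
  qed
  then have eqT: "(\<Sum>i\<in>T. p $ i) = level S (\<lambda>_. 1) J T"
    unfolding sum level_alt[OF finite] by simp
  \<comment> \<open>Two sources of slack: a vertex of \<open>T'\<close> outside \<open>T\<close>
    contributes 1; if \<open>T'\<close> is inside \<open>T\<close>, linkedness gives an edge that
    the level of \<open>T'\<close> does not count, although at least one of its at most
    \<open>CARD('n)\<close> vertices lies in \<open>T'\<close>.\<close>
  have "level S (\<lambda>_. 1) J T' + 1 / CARD('n) \<le> (\<Sum>i\<in>T'. p $ i)" if T': "T' \<noteq> {}" "T' \<noteq> T" for T'
  proof (cases "T' \<subseteq> T")
    case False
    then have "card (T' - T) > 0" by (simp add: card_gt_0_iff)
    then have "1 \<le> real (card (T' - T))" by linarith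
    moreover have "1 / real CARD('n) \<le> 1" by (simp add: Suc_leI)
    ultimately show ?thesis using ge[of T'] unfolding sum by linarith
  next
    case True
    then obtain j where j: "j \<in> J" "S j \<subseteq> T" "S j \<inter> T' \<noteq> {}" "\<not> S j \<subseteq> T'"
      using T T' unfolding linked_def by blast
    have "1 / real CARD('n) \<le> w T' j"
    proof -
      have "card (S j \<inter> T') > 0" using j by (simp add: card_gt_0_iff)
      then have "1 \<le> real (card (S j \<inter> T'))" by linarith
      moreover have "card (S j) > 0" using S[OF j(1)] by (simp add: card_gt_0_iff)
      moreover have "card (S j) \<le> CARD('n)" by (intro card_mono) auto
      ultimately show ?thesis using j by (auto simp: w_def B_def intro!: frac_le)
    qed
    then have "(\<Sum>i\<in>J. (if S i \<subseteq> T' then 1 else 0) + (if i = j then 1 / real CARD('n) else 0)) \<le> (\<Sum>j\<in>J. w T' j)"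
      using w_ge[of _ T'] j by (intro sum_mono) auto
    then show ?thesis
      using j(1) unfolding sum level_alt[OF finite] by (simp add: sum.distrib)
  qed
  then show ?thesis using that eqT by blast
qed

text \<open>Moving the touching point by \<open>1 / n\<^sup>2\<close> against the indicator of
  \<open>T\<close> costs each other sum at most \<open>n / n\<^sup>2 = 1 / n\<close>, exactly its
  slack. Violating one inequality alone gives irredundancy; the violation by at most 1 serves the
  comparison of integer levels.\<close>

lemma violating_point:
  fixes S :: "'r::finite \<Rightarrow> 'n::finite set"
  assumes S: "\<And>j. j \<in> J \<Longrightarrow> S j \<noteq> {}" and T: "linked S J T"
  obtains q :: "real ^ 'n" where "(\<Sum>i\<in>T. q $ i) < level S (\<lambda>_. 1) J T"
    "level S (\<lambda>_. 1) J T - 1 \<le> (\<Sum>i\<in>T. q $ i)"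
    "\<And>T'. linked S J T' \<Longrightarrow> T' \<noteq> T \<Longrightarrow> level S (\<lambda>_. 1) J T' \<le> (\<Sum>i\<in>T'. q $ i)"
proof -
  obtain p :: "real ^ 'n" where p: "(\<Sum>i\<in>T. p $ i) = level S (\<lambda>_. 1) J T"
    "\<And>T'. T' \<noteq> {} \<Longrightarrow> T' \<noteq> T \<Longrightarrow> level S (\<lambda>_. 1) J T' + 1 / CARD('n) \<le> (\<Sum>i\<in>T'. p $ i)"
    using touching_point[OF S T] by blast
  define n where "n = real CARD('n)"
  have n: "1 \<le> n" by (simp add: n_def Suc_leI)
  define q where "q = p - (1 / n\<^sup>2) *\<^sub>R ivec T"
  have q: "(\<Sum>i\<in>T'. q $ i) = (\<Sum>i\<in>T'. p $ i) - real (card (T' \<inter> T)) / n\<^sup>2" for T'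
  proof -
    have "(\<Sum>i\<in>T'. q $ i) = (\<Sum>i\<in>T'. p $ i - (if i \<in> T then 1 / n\<^sup>2 else 0))"
      by (intro sum.cong) (auto simp: q_def ivec_def)
    then show ?thesis by (simp add: sum_subtractf sum.If_cases)
  qed
  have cn: "real (card (T' \<inter> T)) \<le> n" for T'
    unfolding n_def of_nat_le_iff by (intro card_mono) auto
  have c1: "real (card (T' \<inter> T)) / n\<^sup>2 \<le> 1 / n" for T'
    using cn[of T'] n by (simp add: power2_eq_square field_simps)
  have "1 / n \<le> 1" using n by simp
  show ?thesis
  proof (rule that[of q])
    have "card T > 0" using T by (simp add: card_gt_0_iff linked_def)
    then have "0 < real (card (T \<inter> T)) / n\<^sup>2" using n by simp
    then show "(\<Sum>i\<in>T. q $ i) < level S (\<lambda>_. 1) J T" unfolding q p by linarith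
    show "level S (\<lambda>_. 1) J T - 1 \<le> (\<Sum>i\<in>T. q $ i)"
      unfolding q p using c1[of T] \<open>1 / n \<le> 1\<close> by linarith
    show "level S (\<lambda>_. 1) J T' \<le> (\<Sum>i\<in>T'. q $ i)" if "linked S J T'" "T' \<noteq> T" for T'
    proof -
      have "T' \<noteq> {}" using that by (simp add: linked_def)
      then show ?thesis using p(2)[OF _ that(2)] c1[of T'] unfolding q n_def by linarith
    qed
  qed
qed

text \<open>The facets of an irredundant system are cut out by its single inequalities, and
  \<open>violating_point\<close> supplies the irredundancy.\<close>

lemma facet_of_level_polyhedron:
  fixes S :: "'r::finite \<Rightarrow> 'n::finite set"
  assumes S: "\<And>j. j \<in> J \<Longrightarrow> S j \<noteq> {}"
  shows "C facet_of level_polyhedron S J \<longleftrightarrow>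
    (\<exists>T. linked S J T \<and> C = level_polyhedron S J \<inter> {x. (\<Sum>i\<in>T. x $ i) = level S (\<lambda>_. 1) J T})"
proof -
  let ?P = "level_polyhedron S J" and ?L = "level S (\<lambda>_. 1 :: real) J"
  define h where "h = (\<lambda>T. {x :: real ^ 'n. - ivec T \<bullet> x \<le> - ?L T})"
  have h: "x \<in> h T \<longleftrightarrow> ?L T \<le> (\<Sum>i\<in>T. x $ i)" for x T
    by (simp add: h_def inner_ivec inner_minus_left)
  have viol: "\<exists>q. q \<notin> h T \<and> (\<forall>T'. linked S J T' \<longrightarrow> T' \<noteq> T \<longrightarrow> q \<in> h T')" if "linked S J T" for T
    using violating_point[OF S that] unfolding h by (metis not_le)
  have inj: "inj_on h (Collect (linked S J))"
    by (rule inj_onI) (metis mem_Collect_eq viol)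
  \<comment> \<open>The criterion applied below wants normal and bound as functions of the
    half-space, so \<open>T\<close> has to be recovered from \<open>h T\<close>.\<close>
  define g where "g = the_inv_into (Collect (linked S J)) h"
  have g: "g (h T) = T" if "linked S J T" for T
    unfolding g_def using that inj by (intro the_inv_into_f_f) auto
  let ?F = "h ` Collect (linked S J)"
  have P: "?P = \<Inter>?F" by (auto simp: level_polyhedron_def h)
  have aff: "affine hull ?P = UNIV"
  proof -
    \<comment> \<open>No level exceeds the number \<open>CARD('r)\<close> of columns, so this open
      set lies in the polyhedron and makes it full-dimensional.\<close>
    let ?O = "{x :: real ^ 'n. \<forall>i. real CARD('r) < x $ i}"
    have "open ?O"
    proof -
      have "?O = (\<Inter>i. {x. real CARD('r) < x $ i})" by auto
      then show ?thesis by (auto intro!: open_INT open_Collect_less continuous_intros)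
    qed
    moreover have "vec (real CARD('r) + 1) \<in> ?O" by simp
    then have "?O \<noteq> {}" by blast
    ultimately have "affine hull ?O = UNIV" by (rule affine_hull_open)
    moreover have "?O \<subseteq> ?P"
      unfolding level_polyhedron_def
    proof clarify
      fix x :: "real ^ 'n" and T assume x: "\<forall>i. real CARD('r) < x $ i" and T: "linked S J T"
      obtain i where "i \<in> T" using linked_nonempty[OF T] by blast
      have "?L T \<le> real CARD('r)" unfolding level_def by (simp add: card_mono)
      also have "\<dots> \<le> x $ i" using x by (simp add: less_imp_le)
      also have "\<dots> \<le> (\<Sum>i\<in>T. x $ i)"
      proof (rule member_le_sum[OF \<open>i \<in> T\<close>])
        show "0 \<le> x $ k" for k using x[rule_format, of k] by (meson of_nat_0_le_iff less_imp_le order_trans)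
      qed simp
      finally show "?L T \<le> (\<Sum>i\<in>T. x $ i)" .
    qed
    ultimately show ?thesis using hull_mono[of ?O ?P affine] by blast
  qed
  have "C facet_of ?P \<longleftrightarrow> (\<exists>H. H \<in> ?F \<and> C = ?P \<inter> {x. (- ivec (g H)) \<bullet> x = - ?L (g H)})"
  proof (rule facet_of_polyhedron_explicit)
    show "?P = affine hull ?P \<inter> \<Inter>?F" using aff P by simp
    show "- ivec (g H) \<noteq> (0 :: real ^ 'n) \<and> H = {x. - ivec (g H) \<bullet> x \<le> - ?L (g H)}" if H: "H \<in> ?F" for H
    proof -
      obtain T where T: "linked S J T" "H = h T" using H by blast
      then obtain i where "i \<in> T" using linked_nonempty by blast
      then have "ivec T \<noteq> (0 :: real ^ 'n)" by (auto simp: ivec_def vec_eq_iff)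
      then show ?thesis using g[OF T(1)] unfolding T(2) by (simp add: h_def)
    qed
    show "?P \<subset> affine hull ?P \<inter> \<Inter>F'" if F': "F' \<subset> ?F" for F'
    proof -
      obtain T where T: "linked S J T" "h T \<notin> F'" using F' by blast
      then obtain q where q: "q \<notin> h T" "\<And>T'. linked S J T' \<Longrightarrow> T' \<noteq> T \<Longrightarrow> q \<in> h T'"
        using viol by blast
      have "q \<in> \<Inter>F'"
      proof
        fix H assume "H \<in> F'"
        then obtain T' where "linked S J T'" "H = h T'" using F' by blast
        then show "q \<in> H" using q T \<open>H \<in> F'\<close> by blast
      qed
      moreover have "q \<notin> ?P" unfolding P using q(1) T(1) by blast
      moreover have "?P \<subseteq> \<Inter>F'" unfolding P using F' by blast
      ultimately show ?thesis unfolding aff by blast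
    qed
  qed simp
  also have "\<dots> \<longleftrightarrow> (\<exists>T. linked S J T \<and> C = ?P \<inter> {x. (\<Sum>i\<in>T. x $ i) = ?L T})"
  proof -
    have "(- ivec (g (h T))) \<bullet> x = - ?L (g (h T)) \<longleftrightarrow> (\<Sum>i\<in>T. x $ i) = ?L T" if "linked S J T" for T and x :: "real ^ 'n"
      unfolding g[OF that] inner_minus_left inner_ivec by simp
    then show ?thesis by (auto simp: image_iff)
  qed
  finally show ?thesis .
qed

text \<open>The touching point lies on the facet of \<open>T\<close> and can be moved slightly in
  every direction that does not decrease the sum over \<open>T\<close>. Testing \<open>\<mu>\<close>
  on \<open>axis a 1\<close>, on its negative for \<open>a\<close> outside \<open>T\<close>, and on
  differences inside \<open>T\<close> shows that it is nonnegative, zero outside \<open>T\<close>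
  and constant on \<open>T\<close>; coprimality makes the constant 1.\<close>

lemma facet_normals_level_polyhedron:
  fixes S :: "'r::finite \<Rightarrow> 'n::finite set"
  assumes S: "\<And>j. j \<in> J \<Longrightarrow> S j \<noteq> {}"
  shows "facet_normals (level_polyhedron S J) = ivec ` Collect (linked S J)"
proof (intro equalityI subsetI)
  let ?P = "level_polyhedron S J" and ?L = "level S (\<lambda>_. 1 :: real) J"
  fix \<mu> :: "int ^ 'n" assume "\<mu> \<in> ivec ` Collect (linked S J)"
  then obtain T where T: "linked S J T" "\<mu> = ivec T" by auto
  obtain i where "i \<in> T" using linked_nonempty[OF T(1)] by blast
  then have "\<mu> $ i = 1" unfolding T(2) ivec_def by simp
  then have "1 \<in> range (($) \<mu>)" by (metis rangeI)
  then have gcd: "Gcd (range (($) \<mu>)) = 1" by (rule Gcd_1)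
  let ?F = "?P \<inter> {x. (\<Sum>i\<in>T. x $ i) = ?L T}"
  have "?F facet_of ?P"
    using T(1) by (subst facet_of_level_polyhedron) (use S in auto)
  moreover have "\<forall>y\<in>?F. \<forall>x\<in>?P. int_pairing \<mu> y \<le> int_pairing \<mu> x"
    using T(1) unfolding T(2) int_pairing_ivec level_polyhedron_def by simp
  ultimately show "\<mu> \<in> facet_normals ?P" using gcd unfolding facet_normals_def by blast
next
  let ?P = "level_polyhedron S J" and ?L = "level S (\<lambda>_. 1 :: real) J"
  fix \<mu> :: "int ^ 'n" assume "\<mu> \<in> facet_normals ?P"
  then obtain F where gcd: "Gcd (range (($) \<mu>)) = 1" and F: "F facet_of ?P"
    and min: "\<forall>y\<in>F. \<forall>x\<in>?P. int_pairing \<mu> y \<le> int_pairing \<mu> x"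
    unfolding facet_normals_def mem_Collect_eq by (elim conjE exE)
  have "\<exists>T. linked S J T \<and> F = ?P \<inter> {x. (\<Sum>i\<in>T. x $ i) = ?L T}"
    using F by (subst (asm) facet_of_level_polyhedron) (use S in auto)
  then obtain T where T: "linked S J T" and F_eq: "F = ?P \<inter> {x. (\<Sum>i\<in>T. x $ i) = ?L T}"
    by (elim exE conjE)
  obtain p :: "real ^ 'n" where p: "(\<Sum>i\<in>T. p $ i) = ?L T"
    "\<And>T'. T' \<noteq> {} \<Longrightarrow> T' \<noteq> T \<Longrightarrow> ?L T' + 1 / CARD('n) \<le> (\<Sum>i\<in>T'. p $ i)"
    using touching_point[OF S T] by blast
  define d where "d = 1 / real CARD('n)"
  have d: "0 < d" by (simp add: d_def)
  have pair: "int_pairing \<mu> (p + v) = int_pairing \<mu> p + (\<Sum>i\<in>UNIV. real_of_int (\<mu> $ i) * v $ i)" for v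
    by (simp add: int_pairing_def sum.distrib distrib_left)
  have pF: "p + v \<in> ?P" if v: "0 \<le> (\<Sum>i\<in>T. v $ i)" "\<And>T'. - d \<le> (\<Sum>i\<in>T'. v $ i)" for v
    unfolding level_polyhedron_def
  proof clarify
    fix T' assume T': "linked S J T'"
    then have "T' \<noteq> {}" by (simp add: linked_def)
    moreover have "(\<Sum>i\<in>T'. (p + v) $ i) = (\<Sum>i\<in>T'. p $ i) + (\<Sum>i\<in>T'. v $ i)"
      by (simp add: sum.distrib)
    ultimately show "?L T' \<le> (\<Sum>i\<in>T'. (p + v) $ i)"
      using p(1) v(1) v(2)[of T'] p(2)[of T'] unfolding d_def by (cases "T' = T"; force)
  qed
  have "p \<in> F" using pF[of 0] d p(1) by (simp add: F_eq)
  have pos: "0 \<le> (\<Sum>i\<in>UNIV. real_of_int (\<mu> $ i) * v $ i)"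
    if "0 \<le> (\<Sum>i\<in>T. v $ i)" "\<And>T'. - d \<le> (\<Sum>i\<in>T'. v $ i)" for v
    using min[rule_format, OF \<open>p \<in> F\<close> pF[OF that]] unfolding pair by simp
  have sum_ax: "(\<Sum>i\<in>T'. (c *\<^sub>R axis a 1 :: real ^ 'n) $ i) = (if a \<in> T' then c else 0)" for T' a c
    by (simp add: axis_def if_distrib sum.If_cases cong: if_cong)
  have mu_ax: "(\<Sum>i\<in>UNIV. real_of_int (\<mu> $ i) * (c *\<^sub>R axis a 1) $ i) = real_of_int (\<mu> $ a) * c" for a c
    by (simp add: axis_def if_distrib sum.If_cases cong: if_cong)
  have nonneg: "0 \<le> \<mu> $ a" for a
  proof -
    have "0 \<le> (\<Sum>i\<in>UNIV. real_of_int (\<mu> $ i) * (1 *\<^sub>R axis a 1) $ i)"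
      by (intro pos; unfold sum_ax) (use d in auto)
    then show ?thesis unfolding mu_ax by simp
  qed
  have out: "\<mu> $ a = 0" if "a \<notin> T" for a
  proof -
    have "0 \<le> (\<Sum>i\<in>UNIV. real_of_int (\<mu> $ i) * ((- d) *\<^sub>R axis a 1) $ i)"
      by (intro pos; unfold sum_ax) (use d that in auto)
    then have "real_of_int (\<mu> $ a) * d \<le> 0" unfolding mu_ax by simp
    then show ?thesis using nonneg[of a] d by (simp add: mult_le_0_iff)
  qed
  have le: "\<mu> $ a \<le> \<mu> $ b" if "a \<in> T" "b \<in> T" for a b
  proof -
    let ?v = "(- d) *\<^sub>R axis a 1 + d *\<^sub>R axis b 1 :: real ^ 'n"
    have "(\<Sum>i\<in>T'. ?v $ i) = (if a \<in> T' then - d else 0) + (if b \<in> T' then d else 0)" for T'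
      unfolding vector_add_component sum.distrib sum_ax ..
    then have "0 \<le> (\<Sum>i\<in>UNIV. real_of_int (\<mu> $ i) * ?v $ i)"
      by (intro pos) (use d that in auto)
    then have "real_of_int (\<mu> $ a) * d \<le> real_of_int (\<mu> $ b) * d"
      unfolding vector_add_component distrib_left sum.distrib mu_ax by simp
    then show ?thesis using d by simp
  qed
  obtain i0 where i0: "i0 \<in> T" using linked_nonempty[OF T] by blast
  have "\<mu> $ i0 dvd \<mu> $ a" for a
    using out[of a] le[OF i0, of a] le[OF _ i0, of a] by (cases "a \<in> T") auto
  then have "\<mu> $ i0 dvd Gcd (range (($) \<mu>))" by (intro Gcd_greatest) auto
  then have "\<mu> $ i0 = 1" using gcd nonneg[of i0] by simp
  then have "\<mu> = ivec T"
    using out le i0 by (auto simp: vec_eq_iff ivec_def intro: antisym) (metis antisym)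
  then show "\<mu> \<in> ivec ` Collect (linked S J)" using T by blast
qed

text \<open>A level that is too large would cut off the touching point of \<open>T\<close>; one that
  is too small is so by at least 1, being an integer, and would admit the point of
  \<open>violating_point\<close>.\<close>

lemma facet_levels_level_polyhedron:
  fixes S :: "'r::finite \<Rightarrow> 'n::finite set"
  assumes S: "\<And>j. j \<in> J \<Longrightarrow> S j \<noteq> {}"
  shows "facet_levels (level_polyhedron S J) \<nu> \<longleftrightarrow>
    (\<forall>T. linked S J T \<longrightarrow> \<nu> (ivec T) = int (level S (\<lambda>_. 1) J T))"
proof -
  let ?P = "level_polyhedron S J" and ?L = "level S (\<lambda>_. 1 :: real) J"
  have L: "?L T = real_of_int (int (level S (\<lambda>_. 1) J T))" for T
    by (simp add: level_def)
  have iff: "facet_levels ?P \<nu> \<longleftrightarrow>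
      ?P = {\<sigma>. \<forall>T. linked S J T \<longrightarrow> real_of_int (\<nu> (ivec T)) \<le> (\<Sum>i\<in>T. \<sigma> $ i)}"
  proof -
    have "facet_normals ?P = ivec ` Collect (linked S J)"
      using S by (rule facet_normals_level_polyhedron)
    then have "(\<Inter>\<mu>\<in>facet_normals ?P. {\<sigma>. real_of_int (\<nu> \<mu>) \<le> int_pairing \<mu> \<sigma>}) =
        {\<sigma>. \<forall>T. linked S J T \<longrightarrow> real_of_int (\<nu> (ivec T)) \<le> (\<Sum>i\<in>T. \<sigma> $ i)}"
      by (auto simp: int_pairing_ivec)
    then show ?thesis unfolding facet_levels_def by simp
  qed
  show ?thesis
  proof
    assume "\<forall>T. linked S J T \<longrightarrow> \<nu> (ivec T) = int (level S (\<lambda>_. 1) J T)"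
    then show "facet_levels ?P \<nu>"
      unfolding iff unfolding level_polyhedron_def by (auto simp: L)
  next
    assume "facet_levels ?P \<nu>"
    then have P: "\<sigma> \<in> ?P \<longleftrightarrow> (\<forall>T. linked S J T \<longrightarrow> real_of_int (\<nu> (ivec T)) \<le> (\<Sum>i\<in>T. \<sigma> $ i))" for \<sigma>
      unfolding iff by blast
    have le: "\<nu> (ivec T) \<le> int (level S (\<lambda>_. 1) J T)" if T: "linked S J T" for T
    proof -
      obtain p :: "real ^ 'n" where p: "(\<Sum>i\<in>T. p $ i) = ?L T"
        "\<And>T'. T' \<noteq> {} \<Longrightarrow> T' \<noteq> T \<Longrightarrow> ?L T' + 1 / CARD('n) \<le> (\<Sum>i\<in>T'. p $ i)"
        using touching_point[OF S T] by blast
      have "?L T' \<le> (\<Sum>i\<in>T'. p $ i)" if "linked S J T'" for T'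
      proof (cases "T' = T")
        case False
        then have "?L T' + 1 / real CARD('n) \<le> (\<Sum>i\<in>T'. p $ i)"
          using linked_nonempty[OF that] by (intro p)
        moreover have "0 \<le> 1 / real CARD('n)" by simp
        ultimately show ?thesis by linarith
      qed (simp add: p)
      then have "p \<in> ?P" unfolding level_polyhedron_def by blast
      then have "real_of_int (\<nu> (ivec T)) \<le> ?L T" using P T p(1) by metis
      then show ?thesis unfolding L by linarith
    qed
    show "\<forall>T. linked S J T \<longrightarrow> \<nu> (ivec T) = int (level S (\<lambda>_. 1) J T)"
    proof (intro allI impI)
      fix T assume T: "linked S J T"
      show "\<nu> (ivec T) = int (level S (\<lambda>_. 1) J T)"
      proof (rule ccontr)
        assume "\<nu> (ivec T) \<noteq> int (level S (\<lambda>_. 1) J T)"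
        then have lt: "real_of_int (\<nu> (ivec T)) \<le> ?L T - 1" using le[OF T] unfolding L by linarith
        obtain q :: "real ^ 'n" where q: "(\<Sum>i\<in>T. q $ i) < ?L T"
          "?L T - 1 \<le> (\<Sum>i\<in>T. q $ i)"
          "\<And>T'. linked S J T' \<Longrightarrow> T' \<noteq> T \<Longrightarrow> ?L T' \<le> (\<Sum>i\<in>T'. q $ i)"
          using violating_point[OF S T] by blast
        have "real_of_int (\<nu> (ivec T')) \<le> (\<Sum>i\<in>T'. q $ i)" if "linked S J T'" for T'
        proof (cases "T' = T")
          case True
          then show ?thesis using lt q(2) by simp
        next
          case False
          have "real_of_int (\<nu> (ivec T')) \<le> ?L T'" using le[OF that] unfolding L by linarith
          then show ?thesis using q(3)[OF that False] by linarith
        qed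
        then have "q \<in> ?P" using P by blast
        then show False using q(1) T unfolding level_polyhedron_def by (auto simp: not_le[symmetric])
      qed
    qed
  qed
qed


lemma facet_normals_column_poly:
  assumes "A \<in> Sigma_mat"
  shows "facet_normals (newton_polyhedron (column_poly A J)) = ivec ` Collect (linked (column_support A) J)"
  unfolding newton_polyhedron_column_poly[OF assms]
  using column_support_nonempty[OF assms] by (rule facet_normals_level_polyhedron)

lemma facet_levels_column_poly:
  assumes "A \<in> Sigma_mat"
  shows "facet_levels (newton_polyhedron (column_poly A J)) \<nu> \<longleftrightarrow>
    (\<forall>T. linked (column_support A) J T \<longrightarrow> \<nu> (ivec T) = int (level (column_support A) (\<lambda>_. 1) J T))"
  unfolding newton_polyhedron_column_poly[OF assms]
  using column_support_nonempty[OF assms] by (rule facet_levels_level_polyhedron)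

section \<open>Laplace integrals and their domains of convergence\<close>

text \<open>The integration variables are \<open>\<epsilon>\<^sub>i = exp (x $ i)\<close>, so that \<open>\<epsilon>\<close> to the power \<open>s\<close> is
  \<open>exp (cpair s x)\<close> and the form of column \<open>j\<close> is \<open>col_form A j x\<close>.\<close>

definition cpair :: "complex ^ 'n \<Rightarrow> real ^ 'n \<Rightarrow> complex" where
  "cpair s x = (\<Sum>i\<in>UNIV. s $ i * complex_of_real (x $ i))"

definition re_vec :: "complex ^ 'n \<Rightarrow> real ^ 'n" where
  "re_vec s = (\<chi> i. Re (s $ i))"

lemma re_vec_nth [simp]: "re_vec s $ i = Re (s $ i)"
  by (simp add: re_vec_def)

lemma cpair_add: "cpair (s + t) x = cpair s x + cpair t x"
  by (simp add: cpair_def sum.distrib distrib_right)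

lemma cpair_scale: "cpair (c *s s) x = c * cpair s x"
  by (simp add: cpair_def sum_distrib_left mult.assoc)

lemma cpair_add_right: "cpair s (x + y) = cpair s x + cpair s y"
  by (simp add: cpair_def sum.distrib distrib_left)

lemma Re_cpair: "Re (cpair s x) = re_vec s \<bullet> x"
  by (simp add: cpair_def inner_vec_def)

lemma norm_exp_cpair [simp]: "norm (exp (cpair s x)) = exp (re_vec s \<bullet> x)"
  by (simp add: Re_cpair)

lemma norm_cpair_le: "norm (cpair v x) \<le> norm v * (\<Sum>i\<in>UNIV. \<bar>x $ i\<bar>)"
  unfolding cpair_def sum_distrib_left
  by (rule order_trans[OF norm_sum sum_mono]) (auto simp: norm_mult intro!: mult_right_mono Finite_Cartesian_Product.norm_nth_le)

lemma continuous_on_cpair [continuous_intros]: "continuous_on X (cpair s)"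
  unfolding cpair_def by (intro continuous_intros)

lemma borel_measurable_cpair [measurable]: "cpair s \<in> borel_measurable borel"
  by (intro borel_measurable_continuous_onI continuous_on_cpair)

lemma continuous_on_re_vec: "continuous_on X re_vec"
  unfolding re_vec_def by (intro continuous_intros)

lemma open_vimage_re_vec: "open D \<Longrightarrow> open {s. re_vec s \<in> D}"
  using open_vimage[OF _ continuous_on_re_vec, unfolded vimage_def] .

lemma norm_exp_minus_linear_le:
  fixes z :: complex
  shows "norm (exp z - 1 - z) \<le> exp (norm z) * (norm z)\<^sup>2"
proof -
  have "norm (exp z - (\<Sum>i\<le>1. z ^ i / fact i)) \<le> exp \<bar>Re z\<bar> * norm z ^ Suc 1 / fact 1"
    by (rule Taylor_exp)
  also have "\<dots> \<le> exp (norm z) * (norm z)\<^sup>2"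
    using abs_Re_le_cmod[of z] by (auto simp: power2_eq_square intro!: mult_right_mono)
  finally show ?thesis by (simp add: algebra_simps)
qed

text \<open>The sum of the absolute values is the linear form with the signs of \<open>x\<close>. So
  the weight is dominated by finitely many exponentials of linear forms, whose parameters can be
  kept inside an open domain.\<close>

lemma exp_abs_le_sum_signs:
  fixes \<sigma> x :: "real ^ 'n::finite"
  shows "exp (\<sigma> \<bullet> x + c * (\<Sum>i\<in>UNIV. \<bar>x $ i\<bar>)) \<le>
    (\<Sum>B\<in>UNIV. exp ((\<sigma> + c *\<^sub>R (\<chi> i. if i \<in> B then 1 else - 1)) \<bullet> x))"
proof -
  define B where "B = {i. 0 \<le> x $ i}"
  have "(\<chi> i. if i \<in> B then 1 else - 1) \<bullet> x = (\<Sum>i\<in>UNIV. \<bar>x $ i\<bar>)"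
    unfolding inner_vec_def by (intro sum.cong) (auto simp: B_def)
  then have "exp (\<sigma> \<bullet> x + c * (\<Sum>i\<in>UNIV. \<bar>x $ i\<bar>)) =
      exp ((\<sigma> + c *\<^sub>R (\<chi> i. if i \<in> B then 1 else - 1)) \<bullet> x)"
    by (simp add: inner_add_left)
  also have "\<dots> \<le> (\<Sum>B\<in>UNIV. exp ((\<sigma> + c *\<^sub>R (\<chi> i. if i \<in> B then 1 else - 1)) \<bullet> x))"
    by (rule member_le_sum[of B]) auto
  finally show ?thesis .
qed

text \<open>Differentiation under the integral with an explicit quadratic remainder. Moving the
  parameter a little in all sign directions gives the integrable function \<open>G\<close>, which
  absorbs the polynomial factors of the derivative and of the Taylor remainder.\<close>

lemma laplace_holomorphic:
  fixes w :: "real ^ 'n::finite \<Rightarrow> complex"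
  assumes w [measurable]: "w \<in> borel_measurable borel" and D: "open D"
    and int: "\<And>\<sigma>. \<sigma> \<in> D \<Longrightarrow> integrable lborel (\<lambda>x. exp (\<sigma> \<bullet> x) * norm (w x))"
  shows "holomorphic_Cn (\<lambda>s. \<integral>x. exp (cpair s x) * w x \<partial>lborel) {s. re_vec s \<in> D}"
  unfolding holomorphic_Cn_def
proof (intro conjI ballI)
  show "open {s :: complex ^ 'n. re_vec s \<in> D}" using D by (rule open_vimage_re_vec)
  let ?F = "\<lambda>s. \<integral>x. exp (cpair s x) * w x \<partial>lborel"
  fix s :: "complex ^ 'n" assume "s \<in> {s. re_vec s \<in> D}"
  then have sD: "re_vec s \<in> D" by simp
  define \<sigma> where "\<sigma> = re_vec s"
  obtain e where e: "e > 0" "ball \<sigma> e \<subseteq> D" using D sD by (auto simp: open_contains_ball \<sigma>_def)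
  define n where "n = real CARD('n)"
  have n: "1 \<le> n" by (simp add: n_def Suc_leI)
  \<comment> \<open>As \<open>2 * \<eta> * n = e / 2\<close>, the points
    \<open>\<sigma> + (2 * \<eta>) *\<^sub>R sg B\<close> stay in the ball. Of the doubled
    \<open>\<eta>\<close> one half pays for \<open>exp (norm z)\<close>, the other for the square of
    \<open>N x\<close>.\<close>
  define \<eta> where "\<eta> = e / (4 * n)"
  have \<eta>: "\<eta> > 0" using e n by (simp add: \<eta>_def)
  define sg :: "'n set \<Rightarrow> real ^ 'n" where "sg = (\<lambda>B. \<chi> i. if i \<in> B then 1 else - 1)"
  define N where "N = (\<lambda>x :: real ^ 'n. \<Sum>i\<in>UNIV. \<bar>x $ i\<bar>)"
  have N0: "0 \<le> N x" for x by (simp add: N_def sum_nonneg)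
  have sgD: "\<sigma> + (2 * \<eta>) *\<^sub>R sg B \<in> D" for B
  proof -
    have "norm (sg B) \<le> (\<Sum>i\<in>UNIV. \<bar>sg B $ i\<bar>)" by (rule norm_le_l1_cart)
    also have "\<dots> = (\<Sum>i\<in>(UNIV :: 'n set). 1)" by (intro sum.cong) (auto simp: sg_def)
    also have "\<dots> = n" by (simp add: n_def)
    finally have "2 * \<eta> * norm (sg B) \<le> 2 * \<eta> * n" using \<eta> by simp
    also have "\<dots> < e" using e n by (simp add: \<eta>_def)
    finally have "\<sigma> + (2 * \<eta>) *\<^sub>R sg B \<in> ball \<sigma> e" using \<eta> by (simp add: dist_norm)
    then show ?thesis using e by blast
  qed
  define G where "G = (\<lambda>x. \<Sum>B\<in>UNIV. exp ((\<sigma> + (2 * \<eta>) *\<^sub>R sg B) \<bullet> x) * norm (w x))"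
  have G: "integrable lborel G" unfolding G_def by (intro Bochner_Integration.integrable_sum int sgD)
  have G_ge: "exp (\<sigma> \<bullet> x) * exp (2 * \<eta> * N x) * norm (w x) \<le> G x" for x
  proof -
    have "exp (\<sigma> \<bullet> x) * exp (2 * \<eta> * N x) \<le> (\<Sum>B\<in>UNIV. exp ((\<sigma> + (2 * \<eta>) *\<^sub>R sg B) \<bullet> x))"
      using exp_abs_le_sum_signs[of \<sigma> x "2 * \<eta>"] by (simp add: N_def sg_def exp_add)
    then show ?thesis unfolding G_def sum_distrib_right[symmetric] by (rule mult_right_mono) simp
  qed
  have G0: "0 \<le> G x" for x unfolding G_def by (intro sum_nonneg) simp
  have bound_int: "integrable lborel f"
    if [measurable]: "f \<in> borel_measurable borel" and f: "\<And>x. norm (f x) \<le> C * G x"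
    for f :: "real ^ 'n \<Rightarrow> complex" and C
  proof (rule Bochner_Integration.integrable_bound[where f = "\<lambda>x. C * G x"])
    show "integrable lborel (\<lambda>x. C * G x)" using G by simp
    show "AE x in lborel. norm (f x) \<le> norm (C * G x)"
      using f by (auto intro: order_trans[OF _ abs_ge_self])
  qed simp
  have intD: "integrable lborel (\<lambda>x. exp (cpair t x) * w x)" if "re_vec t \<in> D" for t
  proof (rule Bochner_Integration.integrable_bound[OF int[OF that]])
    show "(\<lambda>x. exp (cpair t x) * w x) \<in> borel_measurable lborel" by measurable
    show "AE x in lborel. norm (exp (cpair t x) * w x) \<le> norm (exp (re_vec t \<bullet> x) * norm (w x))"
      by (simp add: norm_mult Re_cpair)
  qed
  define d where "d = (\<lambda>v x. cpair v x * (exp (cpair s x) * w x))"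
  have [measurable]: "d v \<in> borel_measurable borel" for v unfolding d_def by measurable
  have intd: "integrable lborel (d v)" for v
  proof (rule bound_int)
    show "norm (d v x) \<le> norm v / (2 * \<eta>) * G x" for x
    proof -
      have "norm (d v x) \<le> norm v * N x * (exp (\<sigma> \<bullet> x) * norm (w x))"
        unfolding d_def norm_mult norm_exp_cpair \<sigma>_def N_def by (intro mult_right_mono norm_cpair_le) simp
      also have "N x \<le> exp (2 * \<eta> * N x) / (2 * \<eta>)"
      proof -
        have "1 + 2 * \<eta> * N x \<le> exp (2 * \<eta> * N x)" by (rule exp_ge_add_one_self)
        moreover have "N x * (2 * \<eta>) = 2 * \<eta> * N x" by simp
        ultimately have "N x * (2 * \<eta>) \<le> exp (2 * \<eta> * N x)" by linarith
        then show ?thesis using \<eta> by (simp add: pos_le_divide_eq)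
      qed
      then have "norm v * N x * (exp (\<sigma> \<bullet> x) * norm (w x)) \<le>
          norm v * (exp (2 * \<eta> * N x) / (2 * \<eta>)) * (exp (\<sigma> \<bullet> x) * norm (w x))"
        by (intro mult_right_mono mult_left_mono) auto
      also have "\<dots> = norm v / (2 * \<eta>) * (exp (\<sigma> \<bullet> x) * exp (2 * \<eta> * N x) * norm (w x))"
        by (simp add: field_simps)
      also have "\<dots> \<le> norm v / (2 * \<eta>) * G x" using \<eta> by (intro mult_left_mono G_ge) auto
      finally show ?thesis .
    qed
  qed simp
  define D' where "D' = (\<lambda>v. \<integral>x. d v x \<partial>lborel)"
  have D'_add: "D' (v + v') = D' v + D' v'" for v v'
  proof -
    have "d (v + v') = (\<lambda>x. d v x + d v' x)" by (auto simp: d_def cpair_add distrib_right)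
    then show ?thesis unfolding D'_def by (simp add: intd)
  qed
  have D'_scale: "D' (c *s v) = c * D' v" for c v
    unfolding D'_def by (subst integral_mult_right_zero[symmetric]) (simp add: d_def cpair_scale algebra_simps)
  have clin: "Vector_Spaces.linear (*s) (*) D'"
    by unfold_locales (auto simp: D'_add D'_scale algebra_simps)
  have scaleR: "r *\<^sub>R v = complex_of_real r *s v" for r and v :: "complex ^ 'n"
    by (simp only: vec_eq_iff vector_scaleR_component vector_smult_component) (simp add: scaleR_conv_of_real)
  have "linear D'" by (rule linearI) (simp_all add: D'_add D'_scale scaleR scaleR_conv_of_real)
  then have blin: "bounded_linear D'" by (simp add: linear_conv_bounded_linear)
  define C where "C = 2 / \<eta>\<^sup>2 * (\<integral>x. G x \<partial>lborel)"
  have est: "norm (?F (s + v) - ?F s - D' v) \<le> C * (norm v)\<^sup>2" if v: "norm v < \<eta>" for v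
  proof -
    have "re_vec (s + v) \<in> ball \<sigma> e"
    proof -
      have "norm (re_vec v) \<le> (\<Sum>i\<in>UNIV. \<bar>re_vec v $ i\<bar>)" by (rule norm_le_l1_cart)
      also have "\<dots> \<le> (\<Sum>i\<in>(UNIV :: 'n set). \<eta>)"
      proof (rule sum_mono)
        fix i
        have "\<bar>re_vec v $ i\<bar> \<le> norm (v $ i)" by (simp add: abs_Re_le_cmod)
        also have "\<dots> \<le> norm v" by (rule Finite_Cartesian_Product.norm_nth_le)
        finally show "\<bar>re_vec v $ i\<bar> \<le> \<eta>" using v by linarith
      qed
      also have "\<dots> = n * \<eta>" by (simp add: n_def)
      also have "\<dots> < e" using e n by (simp add: \<eta>_def)
      finally have "norm (re_vec v) < e" .
      moreover have "re_vec (s + v) = \<sigma> + re_vec v" by (simp add: vec_eq_iff \<sigma>_def)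
      ultimately show ?thesis by (simp add: dist_norm)
    qed
    then have svD: "re_vec (s + v) \<in> D" using e by blast
    have "?F (s + v) - ?F s - D' v = (\<integral>x. exp (cpair (s + v) x) * w x - exp (cpair s x) * w x - d v x \<partial>lborel)"
      unfolding D'_def by (simp add: intD[OF svD] intD[OF sD] intd)
    also have "norm \<dots> \<le> (\<integral>x. 2 / \<eta>\<^sup>2 * (norm v)\<^sup>2 * G x \<partial>lborel)"
    proof (rule order_trans[OF integral_norm_bound integral_mono])
      show "integrable lborel (\<lambda>x. norm (exp (cpair (s + v) x) * w x - exp (cpair s x) * w x - d v x))"
        by (intro integrable_norm Bochner_Integration.integrable_diff intD svD sD intd)
      show "integrable lborel (\<lambda>x. 2 / \<eta>\<^sup>2 * (norm v)\<^sup>2 * G x)" using G by simp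
      fix x
      define z where "z = cpair v x"
      have z: "norm z \<le> norm v * N x" unfolding z_def N_def by (rule norm_cpair_le)
      have z': "norm z \<le> \<eta> * N x" using z v N0[of x] by (meson less_imp_le mult_right_mono order_trans)
      have "norm (exp z - 1 - z) \<le> exp (norm z) * (norm z)\<^sup>2" by (rule norm_exp_minus_linear_le)
      also have "\<dots> \<le> exp (\<eta> * N x) * (norm v * N x)\<^sup>2"
        using z z' by (intro mult_mono power_mono) auto
      also have "\<dots> = (norm v)\<^sup>2 * (exp (\<eta> * N x) * (N x)\<^sup>2)" by (simp add: power_mult_distrib)
      also have "\<dots> \<le> (norm v)\<^sup>2 * (exp (\<eta> * N x) * (2 / \<eta>\<^sup>2 * exp (\<eta> * N x)))"
      proof (intro mult_left_mono)
        have "1 + \<eta> * N x + (\<eta> * N x)\<^sup>2 / 2 \<le> exp (\<eta> * N x)"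
          using exp_lower_Taylor_quadratic[of "\<eta> * N x"] N0 \<eta> by simp
        moreover have "0 \<le> \<eta> * N x" using N0 \<eta> by simp
        ultimately have "(\<eta> * N x)\<^sup>2 / 2 \<le> exp (\<eta> * N x)" by linarith
        then have "(N x)\<^sup>2 * \<eta>\<^sup>2 \<le> 2 * exp (\<eta> * N x)" by (simp add: power_mult_distrib mult.commute)
        then have "(N x)\<^sup>2 \<le> 2 * exp (\<eta> * N x) / \<eta>\<^sup>2" using \<eta> by (simp add: pos_le_divide_eq)
        then show "(N x)\<^sup>2 \<le> 2 / \<eta>\<^sup>2 * exp (\<eta> * N x)" by simp
      qed auto
      also have "\<dots> = 2 / \<eta>\<^sup>2 * (norm v)\<^sup>2 * exp (2 * \<eta> * N x)"
        unfolding mult_2 distrib_right exp_add by (simp only: ac_simps)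
      finally have zz: "norm (exp z - 1 - z) \<le> 2 / \<eta>\<^sup>2 * (norm v)\<^sup>2 * exp (2 * \<eta> * N x)" .
      have "exp (cpair (s + v) x) * w x - exp (cpair s x) * w x - d v x = (exp z - 1 - z) * (exp (cpair s x) * w x)"
        by (simp add: cpair_add exp_add d_def z_def algebra_simps)
      then have "norm (exp (cpair (s + v) x) * w x - exp (cpair s x) * w x - d v x) =
          norm (exp z - 1 - z) * (exp (\<sigma> \<bullet> x) * norm (w x))"
        by (simp add: norm_mult \<sigma>_def Re_cpair)
      also have "\<dots> \<le> 2 / \<eta>\<^sup>2 * (norm v)\<^sup>2 * exp (2 * \<eta> * N x) * (exp (\<sigma> \<bullet> x) * norm (w x))"
        by (intro mult_right_mono zz) simp
      also have "\<dots> = 2 / \<eta>\<^sup>2 * (norm v)\<^sup>2 * (exp (\<sigma> \<bullet> x) * exp (2 * \<eta> * N x) * norm (w x))"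
        by (simp add: algebra_simps)
      also have "\<dots> \<le> 2 / \<eta>\<^sup>2 * (norm v)\<^sup>2 * G x" by (intro mult_left_mono G_ge) simp
      finally show "norm (exp (cpair (s + v) x) * w x - exp (cpair s x) * w x - d v x) \<le> 2 / \<eta>\<^sup>2 * (norm v)\<^sup>2 * G x" .
    qed
    also have "\<dots> = C * (norm v)\<^sup>2" by (simp add: C_def)
    finally show ?thesis .
  qed
  have "(?F has_derivative D') (at s)"
    unfolding has_derivative_at
  proof (intro conjI blin)
    show "(\<lambda>h. norm (?F (s + h) - ?F s - D' h) / norm h) \<midarrow>0\<rightarrow> 0"
    proof (rule tendsto_sandwich)
      show "\<forall>\<^sub>F h in at 0. 0 \<le> norm (?F (s + h) - ?F s - D' h) / norm h" by simp
      have "\<forall>\<^sub>F h :: complex ^ 'n in at 0. norm h < \<eta>"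
        using \<eta> by (auto simp: eventually_at dist_norm)
      then show "\<forall>\<^sub>F h in at 0. norm (?F (s + h) - ?F s - D' h) / norm h \<le> C * norm h"
        by (rule eventually_mono) (use est in \<open>auto simp: divide_le_eq power2_eq_square mult.assoc\<close>)
      show "(\<lambda>h :: complex ^ 'n. C * norm h) \<midarrow>0\<rightarrow> 0" by (intro tendsto_eq_intros) auto
    qed simp
  qed
  then show "\<exists>D. (?F has_derivative D) (at s) \<and> Vector_Spaces.linear (*s) (*) D" using clin by blast
qed


section \<open>Exponential majorants and absolute convergence\<close>

lemma nn_integral_exp_abs:
  assumes "0 < (c::real)"
  shows "(\<integral>\<^sup>+t. ennreal (exp (- c * \<bar>t\<bar>)) \<partial>lborel) < \<infinity>"
proof -
  define g where "g = (\<lambda>t :: real. if t \<in> {0..} then exp (- c * t) else 0)"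
  have [measurable]: "g \<in> borel_measurable borel" unfolding g_def by measurable
  have "(g has_integral (exp (- c * 0) / c)) UNIV"
    unfolding g_def has_integral_restrict_UNIV by (rule has_integral_exp_minus_to_infinity[OF assms])
  then have half: "(\<integral>\<^sup>+t. ennreal (g t) \<partial>lborel) = ennreal (exp (- c * 0) / c)"
    by (intro nn_integral_has_integral_lborel) (auto simp: g_def)
  have "(\<integral>\<^sup>+t. ennreal (exp (- c * \<bar>t\<bar>)) \<partial>lborel) \<le> (\<integral>\<^sup>+t. ennreal (g t) + ennreal (g (- t)) \<partial>lborel)"
    by (intro nn_integral_mono) (auto simp: g_def)
  also have "\<dots> = (\<integral>\<^sup>+t. ennreal (g t) \<partial>lborel) + (\<integral>\<^sup>+t. ennreal (g (- t)) \<partial>lborel)"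
    by (intro nn_integral_add) auto
  also have "(\<integral>\<^sup>+t. ennreal (g (- t)) \<partial>lborel) = (\<integral>\<^sup>+t. ennreal (g t) \<partial>lborel)"
    using nn_integral_real_affine[of "\<lambda>t. ennreal (g t)" "- 1" 0] by simp
  finally have "(\<integral>\<^sup>+t. ennreal (exp (- c * \<bar>t\<bar>)) \<partial>lborel) \<le> ennreal (1 / c) + ennreal (1 / c)"
    unfolding half by simp
  also have "\<dots> = ennreal (1 / c + 1 / c)" using assms by (intro ennreal_plus[symmetric]) auto
  also have "\<dots> < \<infinity>" by simp
  finally show ?thesis .
qed

lemma Basis_vec_real: "(Basis :: (real ^ 'n) set) = range (\<lambda>i. axis i 1)"
  by (auto simp: Basis_vec_def)

lemma inj_axis_one: "inj (\<lambda>i. axis i (1::real) :: real ^ 'n)"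
  by (auto intro!: injI simp: axis_eq_axis)

lemma integrable_exp_l1:
  assumes "0 < (c::real)"
  shows "integrable lborel (\<lambda>x :: real ^ 'n::finite. exp (- c * (\<Sum>i\<in>UNIV. \<bar>x $ i\<bar>)))"
proof (rule integrableI_bounded)
  have "(\<integral>\<^sup>+(x :: real ^ 'n). ennreal (norm (exp (- c * (\<Sum>i\<in>UNIV. \<bar>x $ i\<bar>)))) \<partial>lborel) =
      (\<integral>\<^sup>+(x :: real ^ 'n). (\<Prod>b\<in>Basis. ennreal (exp (- c * \<bar>x \<bullet> b\<bar>))) \<partial>lborel)"
  proof (intro nn_integral_cong)
    fix x :: "real ^ 'n"
    have "(\<Prod>b\<in>Basis. ennreal (exp (- c * \<bar>x \<bullet> b\<bar>))) = ennreal (\<Prod>b\<in>Basis. exp (- c * \<bar>x \<bullet> b\<bar>))"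
      by (simp add: prod_ennreal)
    also have "(\<Prod>b\<in>Basis. exp (- c * \<bar>x \<bullet> b\<bar>)) = exp (- c * (\<Sum>i\<in>UNIV. \<bar>x $ i\<bar>))"
      unfolding Basis_vec_real using inj_axis_one
      by (subst prod.reindex) (auto simp: inner_axis exp_sum[symmetric] sum_distrib_left sum_negf)
    finally show "ennreal (norm (exp (- c * (\<Sum>i\<in>UNIV. \<bar>x $ i\<bar>)))) = (\<Prod>b\<in>Basis. ennreal (exp (- c * \<bar>x \<bullet> b\<bar>)))"
      by simp
  qed
  also have "\<dots> = (\<Prod>b\<in>(Basis :: (real ^ 'n) set). \<integral>\<^sup>+t. ennreal (exp (- c * \<bar>t\<bar>)) \<partial>lborel)"
    by (rule nn_integral_lborel_prod) auto
  also have "\<dots> < \<infinity>" using nn_integral_exp_abs[OF assms] by (simp add: power_less_top_ennreal)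
  finally show "(\<integral>\<^sup>+(x :: real ^ 'n). ennreal (norm (exp (- c * (\<Sum>i\<in>UNIV. \<bar>x $ i\<bar>)))) \<partial>lborel) < \<infinity>" .
qed measurable

definition col_form :: "real ^ 'r ^ 'n \<Rightarrow> 'r \<Rightarrow> real ^ 'n \<Rightarrow> real" where
  "col_form A j x = (\<Sum>i\<in>UNIV. A $ i $ j * exp (x $ i))"

lemma continuous_on_col_form [continuous_intros]: "continuous_on X (col_form A j)"
  unfolding col_form_def by (intro continuous_intros)

lemma borel_measurable_col_form [measurable]: "col_form A j \<in> borel_measurable borel"
  by (intro borel_measurable_continuous_onI continuous_on_col_form)

lemma col_form_pos: "A \<in> Sigma_mat \<Longrightarrow> 0 < col_form A j x"
proof -
  assume A: "A \<in> Sigma_mat"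
  then have "\<exists>i. 0 < A $ i $ j" unfolding Sigma_mat_def by blast
  then obtain i where "0 < A $ i $ j" ..
  then show ?thesis
    unfolding col_form_def using A by (intro sum_pos2[of _ i]) (auto simp: Sigma_mat_def)
qed

text \<open>\<open>k j\<close> is the power of the form of column \<open>j\<close> in the
  denominator. For \<open>k = 1\<close> these are the inequalities of
  \<open>level_polyhedron\<close> with \<open>J = UNIV\<close>, made strict.\<close>

definition conv_domain :: "real ^ 'r ^ 'n \<Rightarrow> ('r \<Rightarrow> nat) \<Rightarrow> (real ^ 'n) set" where
  "conv_domain A k = {\<sigma>. \<forall>T. linked (column_support A) UNIV T \<longrightarrow>
     real (level (column_support A) k UNIV T) < (\<Sum>i\<in>T. \<sigma> $ i)}"

lemma open_conv_domain: "open (conv_domain A k)"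
proof -
  have "conv_domain A k = (\<Inter>T\<in>Collect (linked (column_support A) UNIV).
      {\<sigma>. real (level (column_support A) k UNIV T) < (\<Sum>i\<in>T. \<sigma> $ i)})"
    by (auto simp: conv_domain_def)
  then show ?thesis by (auto intro!: open_INT open_Collect_less continuous_intros)
qed

lemma real_level: "real (level S k J T) = level S (\<lambda>j. real (k j)) J T"
  by (simp add: level_def)

text \<open>As \<open>exp t\<close> is at least \<open>t\<^sup>2 / 2\<close>, completing the square
  gives the bound \<open>e\<^sup>2 / (2 * c)\<close>.\<close>

lemma linear_minus_exp_bounded:
  fixes c e :: real
  assumes "0 < c" obtains K where "\<And>t. 0 \<le> t \<Longrightarrow> e * t - c * exp t \<le> K"
proof -
  have "e * t - c * exp t \<le> e\<^sup>2 / (2 * c)" if "0 \<le> t" for t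
  proof -
    have "1 + t + t\<^sup>2 / 2 \<le> exp t" using that by (rule exp_lower_Taylor_quadratic)
    then have "t\<^sup>2 / 2 \<le> exp t" using that by linarith
    then have "c * (t\<^sup>2 / 2) \<le> c * exp t" using assms by (intro mult_left_mono) auto
    moreover have "e * t - c * (t\<^sup>2 / 2) \<le> e\<^sup>2 / (2 * c)"
    proof -
      have "e\<^sup>2 / (2 * c) - (e * t - c * (t\<^sup>2 / 2)) = (e - c * t)\<^sup>2 / (2 * c)"
        using assms by (simp add: field_simps power2_eq_square)
      also have "\<dots> \<ge> 0" using assms by simp
      finally show ?thesis by simp
    qed
    ultimately show ?thesis by linarith
  qed
  then show ?thesis by (rule that)
qed

lemma min_positive_entry: "\<exists>c>0. \<forall>i j. 0 < A $ i $ j \<longrightarrow> c \<le> A $ i $ j"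
  for A :: "real ^ 'r ^ 'n::finite"
proof -
  define E where "E = insert 1 {A $ i $ j | i j. 0 < A $ i $ j}"
  have "finite {A $ i $ j | i j. 0 < A $ i $ j}"
    by (rule finite_subset[of _ "(\<lambda>(i, j). A $ i $ j) ` UNIV"]) auto
  then have fE: "finite E" by (simp add: E_def)
  have "0 < Min E" using fE by (subst Min_gr_iff) (auto simp: E_def)
  moreover have "Min E \<le> A $ i $ j" if "0 < A $ i $ j" for i j
    using that fE by (intro Min_le) (auto simp: E_def)
  ultimately show ?thesis by blast
qed

text \<open>Near the boundary of the orthant the bound is \<open>linked_cover\<close> applied to the negative parts of
  the \<open>x $ i\<close>; towards infinity the factors \<open>exp (- col_form A j x / 2)\<close> win.\<close>

lemma conv_domain_bound:
  fixes A :: "real ^ 'r ^ 'n::finite"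
  assumes A: "A \<in> Sigma_mat" and \<sigma>: "\<sigma> \<in> conv_domain A k"
  shows "\<exists>C. \<exists>\<delta>>0. \<forall>x. exp (\<sigma> \<bullet> x) * (\<Prod>j\<in>UNIV. exp (- col_form A j x / 2) / col_form A j x ^ k j)
      \<le> C * exp (- \<delta> * (\<Sum>i\<in>UNIV. \<bar>x $ i\<bar>))"
proof -
  let ?S = "column_support A" and ?lev = "\<lambda>T. level (column_support A) (\<lambda>j. real (k j)) UNIV T"
  obtain c where c: "0 < c" and cA: "\<And>i j. 0 < A $ i $ j \<Longrightarrow> c \<le> A $ i $ j"
    using min_positive_entry by blast
  have A0: "0 \<le> A $ i $ j" for i j using A by (auto simp: Sigma_mat_def)
  \<comment> \<open>\<open>\<delta>\<close> is at most the slack of each linked \<open>T\<close>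
    divided by its size. So all coordinates may be lowered by \<open>\<delta>\<close> without
    violating an inequality, and this margin becomes the decay rate.\<close>
  define \<delta> where "\<delta> = Min (insert 1 ((\<lambda>T. ((\<Sum>i\<in>T. \<sigma> $ i) - ?lev T) / real (card T)) ` Collect (linked ?S UNIV)))"
  have cardT: "0 < real (card T)" if "linked ?S UNIV T" for T
    using linked_nonempty[OF that] by (simp add: card_gt_0_iff)
  have \<delta>: "0 < \<delta>" unfolding \<delta>_def
    using \<sigma> cardT by (subst Min_gr_iff) (auto simp: conv_domain_def real_level)
  have \<delta>T: "?lev T \<le> (\<Sum>i\<in>T. \<sigma> $ i - \<delta>)" if "linked ?S UNIV T" for T
  proof -
    have "\<delta> \<le> ((\<Sum>i\<in>T. \<sigma> $ i) - ?lev T) / real (card T)"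
      unfolding \<delta>_def using that by (intro Min_le) auto
    then have "\<delta> * real (card T) \<le> (\<Sum>i\<in>T. \<sigma> $ i) - ?lev T"
      using cardT[OF that] by (simp add: pos_le_divide_eq)
    then show ?thesis by (simp add: sum_subtractf mult.commute)
  qed
  have L_ge: "c * exp (x $ i) \<le> col_form A j x" if "i \<in> ?S j" for i j x
  proof -
    have "c * exp (x $ i) \<le> A $ i $ j * exp (x $ i)"
      using that cA by (intro mult_right_mono) (auto simp: column_support_def)
    also have "\<dots> \<le> col_form A j x"
      unfolding col_form_def using A0 by (intro member_le_sum) auto
    finally show ?thesis .
  qed
  have L_pos: "0 < col_form A j x" for j x by (rule col_form_pos[OF A])
  have L_sum: "c * (\<Sum>i\<in>UNIV. exp (x $ i)) \<le> (\<Sum>j\<in>UNIV. col_form A j x)" for x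
  proof -
    have "c * exp (x $ i) \<le> (\<Sum>j\<in>UNIV. A $ i $ j * exp (x $ i))" for i
    proof -
      have "\<exists>j. 0 < A $ i $ j" using A unfolding Sigma_mat_def by blast
      then obtain j where j: "0 < A $ i $ j" ..
      have "c * exp (x $ i) \<le> A $ i $ j * exp (x $ i)" using cA[OF j] by (intro mult_right_mono) auto
      also have "\<dots> \<le> (\<Sum>j\<in>UNIV. A $ i $ j * exp (x $ i))" using A0 by (intro member_le_sum) auto
      finally show ?thesis .
    qed
    then have "c * (\<Sum>i\<in>UNIV. exp (x $ i)) \<le> (\<Sum>i\<in>UNIV. \<Sum>j\<in>UNIV. A $ i $ j * exp (x $ i))"
      unfolding sum_distrib_left by (intro sum_mono)
    also have "\<dots> = (\<Sum>j\<in>UNIV. col_form A j x)" unfolding col_form_def by (rule sum.swap)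
    finally show ?thesis .
  qed
  \<comment> \<open>For nonnegative coordinates: \<open>c / 2\<close> is what \<open>L_sum\<close>
    yields for half the sum of the forms, and the added \<open>\<delta>\<close> pays for the
    decay.\<close>
  have "\<forall>i. \<exists>K. \<forall>t\<ge>0. (\<sigma> $ i + \<delta>) * t - c / 2 * exp t \<le> K"
    using linear_minus_exp_bounded[of "c / 2"] c by (metis half_gt_zero)
  then obtain K where K: "\<And>i t. 0 \<le> t \<Longrightarrow> (\<sigma> $ i + \<delta>) * t - c / 2 * exp t \<le> K i" by metis
  define K' where "K' = (\<Sum>i\<in>UNIV. \<bar>K i\<bar>)"
  define C where "C = (1 / c) ^ (\<Sum>j\<in>UNIV. k j) * exp K'"
  have "exp (\<sigma> \<bullet> x) * (\<Prod>j\<in>UNIV. exp (- col_form A j x / 2) / col_form A j x ^ k j)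
      \<le> C * exp (- \<delta> * (\<Sum>i\<in>UNIV. \<bar>x $ i\<bar>))" for x
  proof -
    \<comment> \<open>A form is at least \<open>c\<close> times its largest exponential, hence is
      controlled by the smallest \<open>u i\<close> on its edge; this produces the minima in
      \<open>linked_cover\<close>.\<close>
    define u where "u = (\<lambda>i. max 0 (- x $ i))"
    have u0: "0 \<le> u i" for i by (simp add: u_def)
    define m where "m = (\<lambda>j. Min (u ` ?S j))"
    have inv: "1 / col_form A j x \<le> 1 / c * exp (m j)" for j
    proof -
      have "m j \<in> u ` ?S j" unfolding m_def
        using column_support_nonempty[OF A] by (intro Min_in) auto
      then obtain i where i: "i \<in> ?S j" "m j = u i" by blast
      have "c * exp (- m j) \<le> c * exp (x $ i)" using c by (simp add: i(2) u_def)
      also have "\<dots> \<le> col_form A j x" by (rule L_ge[OF i(1)])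
      finally have "1 / col_form A j x \<le> 1 / (c * exp (- m j))" using c by (intro divide_left_mono) (auto intro!: mult_pos_pos L_pos)
      then show ?thesis by (simp add: exp_minus field_simps)
    qed
    have P: "(\<Prod>j\<in>UNIV. exp (- col_form A j x / 2) / col_form A j x ^ k j) =
        (\<Prod>j\<in>UNIV. exp (- col_form A j x / 2)) * (\<Prod>j\<in>UNIV. (1 / col_form A j x) ^ k j)"
      by (simp add: prod.distrib[symmetric] power_divide)
    have "(\<Prod>j\<in>UNIV. exp (- col_form A j x / 2)) = exp (- (\<Sum>j\<in>UNIV. col_form A j x) / 2)"
      by (simp add: exp_sum[symmetric] sum_negf sum_divide_distrib)
    also have "\<dots> \<le> exp (- (c / 2) * (\<Sum>i\<in>UNIV. exp (x $ i)))"
      using L_sum[of x] by simp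
    finally have P1: "(\<Prod>j\<in>UNIV. exp (- col_form A j x / 2)) \<le> exp (- (c / 2) * (\<Sum>i\<in>UNIV. exp (x $ i)))" .
    have "(\<Prod>j\<in>UNIV. (1 / col_form A j x) ^ k j) \<le> (\<Prod>j\<in>UNIV. (1 / c * exp (m j)) ^ k j)"
    proof (intro prod_mono conjI)
      fix j
      have "0 \<le> 1 / col_form A j x" using L_pos[where j = j and x = x] by simp
      then show "0 \<le> (1 / col_form A j x) ^ k j" "(1 / col_form A j x) ^ k j \<le> (1 / c * exp (m j)) ^ k j"
        using inv[of j] by (blast intro: zero_le_power power_mono)+
    qed
    also have "(\<Prod>j\<in>UNIV. (1 / c * exp (m j)) ^ k j) = (\<Prod>j\<in>UNIV. (1 / c) ^ k j) * (\<Prod>j\<in>UNIV. exp (real (k j) * m j))"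
      unfolding power_mult_distrib prod.distrib exp_of_nat_mult ..
    also have "\<dots> = (1 / c) ^ (\<Sum>j\<in>UNIV. k j) * exp (\<Sum>j\<in>UNIV. real (k j) * m j)"
      unfolding power_sum exp_sum[OF finite] ..
    finally have P2: "(\<Prod>j\<in>UNIV. (1 / col_form A j x) ^ k j) \<le>
        (1 / c) ^ (\<Sum>j\<in>UNIV. k j) * exp (\<Sum>j\<in>UNIV. real (k j) * m j)" .
    have "(\<Sum>j\<in>UNIV. real (k j) * m j) \<le> (\<Sum>i\<in>UNIV. (\<sigma> $ i - \<delta>) * u i)"
      unfolding m_def by (rule linked_cover[OF finite column_support_nonempty[OF A] \<delta>T u0])
    then have "(1 / c) ^ (\<Sum>j\<in>UNIV. k j) * exp (\<Sum>j\<in>UNIV. real (k j) * m j) \<le>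
        (1 / c) ^ (\<Sum>j\<in>UNIV. k j) * exp (\<Sum>i\<in>UNIV. (\<sigma> $ i - \<delta>) * u i)"
      using c by (intro mult_left_mono) auto
    with P2 have P3: "(\<Prod>j\<in>UNIV. (1 / col_form A j x) ^ k j) \<le>
        (1 / c) ^ (\<Sum>j\<in>UNIV. k j) * exp (\<Sum>i\<in>UNIV. (\<sigma> $ i - \<delta>) * u i)" by (rule order_trans)
    have "(\<Prod>j\<in>UNIV. exp (- col_form A j x / 2) / col_form A j x ^ k j) \<le>
        exp (- (c / 2) * (\<Sum>i\<in>UNIV. exp (x $ i))) * ((1 / c) ^ (\<Sum>j\<in>UNIV. k j) * exp (\<Sum>i\<in>UNIV. (\<sigma> $ i - \<delta>) * u i))"
      unfolding P
    proof (rule mult_mono[OF P1 P3])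
      have "0 \<le> 1 / col_form A j x" for j using L_pos[where j = j and x = x] by simp
      then show "0 \<le> (\<Prod>j\<in>UNIV. (1 / col_form A j x) ^ k j)" by (intro prod_nonneg zero_le_power)
    qed simp
    then have "exp (\<sigma> \<bullet> x) * (\<Prod>j\<in>UNIV. exp (- col_form A j x / 2) / col_form A j x ^ k j) \<le>
        exp (\<sigma> \<bullet> x) * (exp (- (c / 2) * (\<Sum>i\<in>UNIV. exp (x $ i))) * ((1 / c) ^ (\<Sum>j\<in>UNIV. k j) * exp (\<Sum>i\<in>UNIV. (\<sigma> $ i - \<delta>) * u i)))"
      by (rule mult_left_mono) simp
    also have "\<dots> = (1 / c) ^ (\<Sum>j\<in>UNIV. k j) *
        exp (\<sigma> \<bullet> x + (- (c / 2) * (\<Sum>i\<in>UNIV. exp (x $ i))) + (\<Sum>i\<in>UNIV. (\<sigma> $ i - \<delta>) * u i))"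
      unfolding exp_add by (simp only: ac_simps)
    also have "\<sigma> \<bullet> x + (- (c / 2) * (\<Sum>i\<in>UNIV. exp (x $ i))) + (\<Sum>i\<in>UNIV. (\<sigma> $ i - \<delta>) * u i) =
        (\<Sum>i\<in>UNIV. \<sigma> $ i * x $ i - c / 2 * exp (x $ i) + (\<sigma> $ i - \<delta>) * u i)"
      by (simp add: inner_vec_def sum.distrib sum_subtractf sum_distrib_left sum_negf)
    also have "(1 / c) ^ (\<Sum>j\<in>UNIV. k j) * exp (\<Sum>i\<in>UNIV. \<sigma> $ i * x $ i - c / 2 * exp (x $ i) + (\<sigma> $ i - \<delta>) * u i)
        \<le> (1 / c) ^ (\<Sum>j\<in>UNIV. k j) * exp (\<Sum>i\<in>UNIV. \<bar>K i\<bar> - \<delta> * \<bar>x $ i\<bar>)"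
    proof -
      have "\<sigma> $ i * x $ i - c / 2 * exp (x $ i) + (\<sigma> $ i - \<delta>) * u i \<le> \<bar>K i\<bar> - \<delta> * \<bar>x $ i\<bar>" for i
      proof (cases "0 \<le> x $ i")
        case True
        then show ?thesis using K[OF True, of i] by (simp add: u_def algebra_simps)
      next
        \<comment> \<open>Here \<open>u i = - x $ i\<close>, so the terms with
          \<open>\<sigma>\<close> cancel and \<open>\<delta> * x $ i\<close> is left.\<close>
        case False
        moreover have "0 < c / 2 * exp (x $ i)" using c by simp
        ultimately show ?thesis by (simp add: u_def algebra_simps)
      qed
      then show ?thesis using c by (intro mult_left_mono) (auto intro: sum_mono)
    qed
    also have "\<dots> = C * exp (- \<delta> * (\<Sum>i\<in>UNIV. \<bar>x $ i\<bar>))"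
      by (simp add: C_def K'_def sum_subtractf sum_distrib_left[symmetric] exp_diff exp_minus divide_inverse)
    finally show ?thesis .
  qed
  with \<delta> show ?thesis by blast
qed

lemma integrable_conv_domain:
  fixes A :: "real ^ 'r ^ 'n::finite"
  assumes A: "A \<in> Sigma_mat" and \<sigma>: "\<sigma> \<in> conv_domain A k"
  shows "integrable lborel (\<lambda>x. exp (\<sigma> \<bullet> x) * (\<Prod>j\<in>UNIV. exp (- col_form A j x / 2) / col_form A j x ^ k j))"
proof -
  obtain C \<delta> where \<delta>: "0 < \<delta>" and
    C: "\<And>x. exp (\<sigma> \<bullet> x) * (\<Prod>j\<in>UNIV. exp (- col_form A j x / 2) / col_form A j x ^ k j)
      \<le> C * exp (- \<delta> * (\<Sum>i\<in>UNIV. \<bar>x $ i\<bar>))"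
    using conv_domain_bound[OF assms] by blast
  show ?thesis
  proof (rule Bochner_Integration.integrable_bound)
    show "integrable lborel (\<lambda>x :: real ^ 'n. C * exp (- \<delta> * (\<Sum>i\<in>UNIV. \<bar>x $ i\<bar>)))"
      using integrable_exp_l1[OF \<delta>] by (rule integrable_mult_right)
    show "(\<lambda>x. exp (\<sigma> \<bullet> x) * (\<Prod>j\<in>UNIV. exp (- col_form A j x / 2) / col_form A j x ^ k j)) \<in> borel_measurable lborel"
      by measurable
    have "0 \<le> exp (\<sigma> \<bullet> x) * (\<Prod>j\<in>UNIV. exp (- col_form A j x / 2) / col_form A j x ^ k j)" for x
      using col_form_pos[OF A] by (intro mult_nonneg_nonneg prod_nonneg) (auto simp: less_imp_le)
    then show "AE x in lborel. norm (exp (\<sigma> \<bullet> x) * (\<Prod>j\<in>UNIV. exp (- col_form A j x / 2) / col_form A j x ^ k j))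
        \<le> norm (C * exp (- \<delta> * (\<Sum>i\<in>UNIV. \<bar>x $ i\<bar>)))"
      using C by (intro AE_I2) (auto intro: order_trans[OF _ abs_ge_self])
  qed
qed

section \<open>Derivatives of the Todd function\<close>

definition todd :: "complex \<Rightarrow> complex" where
  "todd z = (if z = 0 then 1 else z / (exp z - 1))"

definition todd_deriv :: "nat \<Rightarrow> real \<Rightarrow> complex" where
  "todd_deriv q y = (deriv ^^ q) todd (complex_of_real y)"

lemma open_strip: "open {z. \<bar>Im z\<bar> < 2 * pi}"
  by (intro open_Collect_less continuous_intros)

text \<open>\<open>E\<close> is the divided difference of \<open>exp\<close> at 0, holomorphic
  across its removable singularity. It has no zeros because the nonzero periods of
  \<open>exp\<close> lie outside the strip.\<close>

lemma todd_holomorphic: "todd holomorphic_on {z. \<bar>Im z\<bar> < 2 * pi}"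
proof -
  let ?S = "{z. \<bar>Im z\<bar> < 2 * pi}"
  define E where "E = (\<lambda>z :: complex. if z = 0 then deriv exp 0 else (exp z - exp 0) / (z - 0))"
  have "E holomorphic_on ?S"
    unfolding E_def by (intro pole_lemma_open holomorphic_intros open_strip)
  moreover have "E z \<noteq> 0" if "z \<in> ?S" for z
  proof (cases "z = 0")
    case True
    then show ?thesis using DERIV_imp_deriv[OF DERIV_exp[of "0 :: complex"]] by (simp add: E_def)
  next
    case False
    have "exp z \<noteq> 1"
    proof
      assume "exp z = 1"
      then obtain n :: int where n: "Re z = 0" "Im z = of_int (2 * n) * pi" by (auto simp: exp_eq_1)
      then have "n \<noteq> 0" using False by (auto simp: complex_eq_iff)
      then have "1 \<le> \<bar>real_of_int n\<bar>" by linarith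
      then have "2 * pi \<le> \<bar>Im z\<bar>" unfolding n(2) by (simp add: abs_mult)
      then show False using that by simp
    qed
    then show ?thesis using False by (simp add: E_def)
  qed
  ultimately have "(\<lambda>z. inverse (E z)) holomorphic_on ?S" by (rule holomorphic_on_inverse)
  moreover have "inverse (E z) = todd z" for z
    using DERIV_imp_deriv[OF DERIV_exp[of "0 :: complex"]] by (simp add: E_def todd_def)
  ultimately show ?thesis by simp
qed

text \<open>Giving away half of the exponential decay absorbs the linear factor in the numerator.
  The margin 1 around the nonnegative half-line leaves room for Cauchy's inequality on unit
  discs.\<close>

lemma todd_bound: "\<exists>C\<ge>0. \<forall>z. \<bar>Im z\<bar> \<le> 1 \<longrightarrow> - 1 \<le> Re z \<longrightarrow> norm (todd z) \<le> C * exp (- Re z / 2)"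
proof -
  let ?K = "cbox (Complex (- 1) (- 1)) (Complex 2 1)"
  have pi: "1 < 2 * pi" using pi_gt3 by linarith
  have "?K \<subseteq> {z. \<bar>Im z\<bar> < 2 * pi}" using pi by (auto simp: in_cbox_complex_iff)
  then have "continuous_on ?K todd"
    using todd_holomorphic by (meson holomorphic_on_imp_continuous_on holomorphic_on_subset)
  then have "compact (todd ` ?K)" by (intro compact_continuous_image compact_cbox)
  then obtain B where B: "0 < B" "\<And>z. z \<in> ?K \<Longrightarrow> norm (todd z) \<le> B"
    using compact_imp_bounded bounded_pos by (metis imageI)
  have "norm (todd z) \<le> (B * exp 1 + 4) * exp (- Re z / 2)" if z: "\<bar>Im z\<bar> \<le> 1" "- 1 \<le> Re z" for z
  \<comment> \<open>Beyond 2 one has \<open>2 \<le> exp (Re z)\<close>, so subtracting 1 at most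
    halves the denominator; what remains is a compact box.\<close>
  proof (cases "Re z \<le> 2")
    case True
    then have "norm (todd z) \<le> B * 1" using B(2)[of z] z True by (auto simp: in_cbox_complex_iff abs_le_iff)
    also have "\<dots> \<le> B * (exp 1 * exp (- Re z / 2))"
      using B True by (intro mult_left_mono) (auto simp: exp_add[symmetric])
    also have "\<dots> \<le> (B * exp 1 + 4) * exp (- Re z / 2)" by (simp add: distrib_right)
    finally show ?thesis .
  next
    case False
    then have z0: "z \<noteq> 0" by auto
    have e2: "2 \<le> exp (Re z)" using False exp_ge_add_one_self[of "Re z"] by linarith
    have "exp (Re z) - 1 \<le> norm (exp z - 1)"
      using norm_triangle_ineq2[of "exp z" 1] by simp
    then have den: "exp (Re z) / 2 \<le> norm (exp z - 1)" using e2 by linarith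
    have "norm z \<le> \<bar>Re z\<bar> + \<bar>Im z\<bar>" by (rule cmod_le)
    also have "\<dots> \<le> 2 * (1 + Re z / 2)" using z False by simp
    also have "\<dots> \<le> 2 * exp (Re z / 2)" by (intro mult_left_mono exp_ge_add_one_self) simp
    finally have num: "norm z \<le> 2 * exp (Re z / 2)" .
    have "norm (todd z) = norm z / norm (exp z - 1)" using z0 by (simp add: todd_def norm_divide)
    also have "\<dots> \<le> 2 * exp (Re z / 2) / (exp (Re z) / 2)" using num den by (intro frac_le) auto
    also have "\<dots> = 4 * exp (- Re z / 2)"
    proof -
      have "exp (Re z / 2) = exp (Re z) * exp (- Re z / 2)" by (simp add: exp_add[symmetric])
      then show ?thesis by simp
    qed
    also have "\<dots> \<le> (B * exp 1 + 4) * exp (- Re z / 2)" using B by (intro mult_right_mono) auto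
    finally show ?thesis .
  qed
  moreover have "0 \<le> B * exp 1 + 4" using B by simp
  ultimately show ?thesis by blast
qed

text \<open>Cauchy's inequality on the unit circle around \<open>y\<close>; the loss of 1 in the
  real part is the factor \<open>exp (1 / 2)\<close>.\<close>

lemma todd_deriv_bound: "\<exists>C\<ge>0. \<forall>y\<ge>0. norm (todd_deriv q y) \<le> C * exp (- y / 2)"
proof -
  obtain C where C: "0 \<le> C" "\<And>z. \<bar>Im z\<bar> \<le> 1 \<Longrightarrow> - 1 \<le> Re z \<Longrightarrow> norm (todd z) \<le> C * exp (- Re z / 2)"
    using todd_bound by blast
  have "norm (todd_deriv q y) \<le> fact q * C * exp (1 / 2) * exp (- y / 2)" if "0 \<le> y" for y
  proof -
    let ?y = "complex_of_real y"
    have near: "\<bar>Im x\<bar> \<le> 1 \<and> y - 1 \<le> Re x" if "norm (?y - x) \<le> 1" for x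
      using that abs_Re_le_cmod[of "?y - x"] abs_Im_le_cmod[of "?y - x"] by auto
    have sub: "cball ?y 1 \<subseteq> {z. \<bar>Im z\<bar> < 2 * pi}"
      using near pi_gt3 by (auto simp: dist_norm) (smt (verit) near)
    have "norm ((deriv ^^ q) todd ?y) \<le> fact q * (C * exp (- (y - 1) / 2)) / 1 ^ q"
    proof (rule Cauchy_inequality)
      show "todd holomorphic_on ball ?y 1"
        using todd_holomorphic sub ball_subset_cball by (meson holomorphic_on_subset subset_trans)
      show "continuous_on (cball ?y 1) todd"
        using todd_holomorphic sub by (meson holomorphic_on_imp_continuous_on holomorphic_on_subset)
      fix x assume "norm (?y - x) = 1"
      then have x: "\<bar>Im x\<bar> \<le> 1" "y - 1 \<le> Re x" using near by auto
      then have "norm (todd x) \<le> C * exp (- Re x / 2)" using that by (intro C(2)) auto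
      also have "\<dots> \<le> C * exp (- (y - 1) / 2)" using x C(1) by (intro mult_left_mono) auto
      finally show "norm (todd x) \<le> C * exp (- (y - 1) / 2)" .
    qed simp
    also have "exp (- (y - 1) / 2) = exp (1 / 2) * exp (- y / 2)"
      by (simp add: exp_add[symmetric] field_simps)
    finally show ?thesis by (simp add: todd_deriv_def mult.assoc)
  qed
  moreover have "0 \<le> fact q * C * exp (1 / 2)" using C by simp
  ultimately show ?thesis by blast
qed

lemma has_vector_derivative_todd_deriv:
  "(todd_deriv q has_vector_derivative todd_deriv (Suc q) y) (at y)"
proof -
  have "(deriv ^^ q) todd holomorphic_on {z. \<bar>Im z\<bar> < 2 * pi}"
    by (intro holomorphic_higher_deriv todd_holomorphic open_strip)
  then have "((deriv ^^ q) todd has_field_derivative deriv ((deriv ^^ q) todd) (complex_of_real y)) (at (complex_of_real y))"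
    by (rule holomorphic_derivI) (auto simp: open_strip)
  from has_vector_derivative_real_field[OF this]
  show ?thesis unfolding todd_deriv_def by (simp add: todd_deriv_def)
qed

lemma continuous_on_todd_deriv: "continuous_on X (todd_deriv q)"
  by (meson continuous_at_imp_continuous_on has_vector_derivative_continuous has_vector_derivative_todd_deriv)

section \<open>Translation invariance and integrals of directional derivatives\<close>

lemma lborel_integral_translate:
  fixes f :: "'a::euclidean_space \<Rightarrow> 'b::{banach, second_countable_topology}"
  assumes [measurable]: "f \<in> borel_measurable borel"
  shows "(\<integral>x. f (x + c) \<partial>lborel) = (\<integral>x. f x \<partial>lborel)"
    and "integrable lborel f \<Longrightarrow> integrable lborel (\<lambda>x. f (x + c))"
proof -
  have "(\<integral>x. f x \<partial>lborel) = (\<integral>x. f x \<partial>distr lborel borel ((+) c))" by (simp add: lborel_distr_plus)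
  also have "\<dots> = (\<integral>x. f (c + x) \<partial>lborel)" by (intro integral_distr) auto
  finally show "(\<integral>x. f (x + c) \<partial>lborel) = (\<integral>x. f x \<partial>lborel)" by (simp add: add.commute)
  assume "integrable lborel f"
  then have "integrable (distr lborel borel ((+) c)) f" by (simp add: lborel_distr_plus)
  then have "integrable lborel (\<lambda>x. f (c + x))" by (subst (asm) integrable_distr_eq) auto
  then show "integrable lborel (\<lambda>x. f (x + c))" by (simp add: add.commute)
qed

text \<open>By Fubini and translation invariance the integral of \<open>F'\<close> equals that of \<open>F (x + v) - F x\<close>.\<close>

lemma integral_directional_derivative_eq_0:
  fixes F F' :: "'a::euclidean_space \<Rightarrow> complex"
  assumes der: "\<And>x t. ((\<lambda>t. F (x + t *\<^sub>R v)) has_vector_derivative F' (x + t *\<^sub>R v)) (at t)"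
    and cont: "continuous_on UNIV F'" and F: "integrable lborel F" and F': "integrable lborel F'"
  shows "(\<integral>x. F' x \<partial>lborel) = 0"
proof -
  have [measurable]: "F' \<in> borel_measurable borel" using cont by (rule borel_measurable_continuous_onI)
  have [measurable]: "F \<in> borel_measurable borel" using F by simp
  define H where "H = (\<lambda>(t::real, x). indicator {0..1} t *\<^sub>R F' (x + t *\<^sub>R v))"
  have H [measurable]: "H \<in> borel_measurable (lborel \<Otimes>\<^sub>M lborel)"
    unfolding H_def by measurable
  have shift: "integrable lborel (\<lambda>x. F' (x + t *\<^sub>R v))" for t
    using F' by (intro lborel_integral_translate(2)) auto
  have inner_x: "(\<integral>x. H (t, x) \<partial>lborel) = indicator {0..1} t *\<^sub>R (\<integral>x. F' x \<partial>lborel)" for t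
    unfolding H_def using lborel_integral_translate(1)[of F' "t *\<^sub>R v"] by simp
  have inner_n: "(\<integral>x. norm (H (t, x)) \<partial>lborel) = indicator {0..1} t *\<^sub>R (\<integral>x. norm (F' x) \<partial>lborel)" for t
    unfolding H_def using lborel_integral_translate(1)[of "\<lambda>x. norm (F' x)" "t *\<^sub>R v"] by simp
  have inner_t: "(\<integral>t. H (t, x) \<partial>lborel) = F (x + v) - F x" for x
  proof -
    have "(\<integral>t. indicator {0..1::real} t *\<^sub>R F' (x + t *\<^sub>R v) \<partial>lborel) = F (x + 1 *\<^sub>R v) - F (x + 0 *\<^sub>R v)"
    proof (rule integral_FTC_atLeastAtMost)
      show "continuous_on {0..1} (\<lambda>t. F' (x + t *\<^sub>R v))"
        by (rule continuous_on_compose2[OF cont]) (auto intro!: continuous_intros)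
    qed (auto intro: has_vector_derivative_at_within der)
    then show ?thesis by (simp add: H_def)
  qed
  have intH: "integrable (lborel \<Otimes>\<^sub>M lborel) H"
  proof (rule lborel_pair.Fubini_integrable[OF H])
    show "integrable lborel (\<lambda>t. \<integral>x. norm (H (t, x)) \<partial>lborel)"
      unfolding inner_n by (intro integrable_scaleR_left) auto
    show "AE t in lborel. integrable lborel (\<lambda>x. H (t, x))"
      using shift by (simp add: H_def)
  qed
  have "(\<integral>x. (\<integral>t. H (t, x) \<partial>lborel) \<partial>lborel) = (\<integral>t. (\<integral>x. H (t, x) \<partial>lborel) \<partial>lborel)"
    using lborel_pair.Fubini_integral[of "\<lambda>t x. H (t, x)"] intH by simp
  then have "(\<integral>x. F (x + v) - F x \<partial>lborel) = (\<integral>t. indicator {0..1::real} t *\<^sub>R (\<integral>x. F' x \<partial>lborel) \<partial>lborel)"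
    unfolding inner_t inner_x .
  also have "(\<integral>x. F (x + v) - F x \<partial>lborel) = 0"
    using lborel_integral_translate[of F v] F by simp
  finally show ?thesis by simp
qed

section \<open>The recurrence for the Shintani integrals\<close>

text \<open>Up to linear combinations this family is closed under differentiation, which raises
  either \<open>q\<close> or \<open>k\<close>. For \<open>k = 1\<close> and \<open>q = 0\<close> it
  is \<open>1 / (exp y - 1)\<close>.\<close>

definition todd_kernel :: "nat \<Rightarrow> nat \<Rightarrow> real \<Rightarrow> complex" where
  "todd_kernel k q y = todd_deriv q y / complex_of_real y ^ k"

definition kern :: "real ^ 'r ^ 'n \<Rightarrow> ('r \<Rightarrow> nat) \<Rightarrow> ('r \<Rightarrow> nat) \<Rightarrow> real ^ 'n \<Rightarrow> complex" where
  "kern A k q x = (\<Prod>j\<in>UNIV. todd_kernel (k j) (q j) (col_form A j x))"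

text \<open>In the logarithmic variables the measure with density 1/\<epsilon> in each coordinate
  becomes Lebesgue measure, so this is a Mellin transform over the orthant written as an integral
  over the whole space.\<close>

definition shintani_integral ::
    "real ^ 'r ^ 'n \<Rightarrow> ('r \<Rightarrow> nat) \<Rightarrow> ('r \<Rightarrow> nat) \<Rightarrow> complex ^ 'n \<Rightarrow> complex" where
  "shintani_integral A k q s = (\<integral>x. exp (cpair s x) * kern A k q x \<partial>lborel)"

lemma borel_measurable_todd_kernel [measurable]: "todd_kernel k q \<in> borel_measurable borel"
proof -
  have [measurable]: "todd_deriv q \<in> borel_measurable borel"
    by (intro borel_measurable_continuous_onI continuous_on_todd_deriv)
  show ?thesis unfolding todd_kernel_def by measurable
qed

lemma borel_measurable_kern [measurable]: "kern A k q \<in> borel_measurable borel"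
  unfolding kern_def by measurable

lemma has_vector_derivative_todd_kernel:
  assumes "y \<noteq> 0"
  shows "(todd_kernel k q has_vector_derivative
    (todd_kernel k (Suc q) y - of_nat k * todd_kernel (Suc k) q y)) (at y)"
proof -
  have "((\<lambda>y. inverse (y ^ k)) has_real_derivative - (real k / y ^ Suc k)) (at y)"
  proof -
    have "((\<lambda>y. inverse (y ^ k)) has_real_derivative - (real k * y ^ (k - Suc 0) * inverse ((y ^ k) ^ Suc (Suc 0)))) (at y)"
      using assms by (intro DERIV_inverse_fun DERIV_pow) auto
    also have "real k * y ^ (k - Suc 0) * inverse ((y ^ k) ^ Suc (Suc 0)) = real k / y ^ Suc k"
      using assms by (cases k) (auto simp: field_simps)
    finally show ?thesis .
  qed
  then have "((\<lambda>y. complex_of_real (inverse (y ^ k))) has_vector_derivative complex_of_real (- (real k / y ^ Suc k))) (at y)"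
    by (rule has_vector_derivative_of_real)
  from has_vector_derivative_mult[OF has_vector_derivative_todd_deriv[of q y] this]
  show ?thesis
    unfolding todd_kernel_def[abs_def] by (simp add: field_simps)
qed

lemma continuous_on_kern:
  assumes "A \<in> Sigma_mat"
  shows "continuous_on X (kern A k q)"
proof -
  have "continuous_on {0<..} (todd_kernel (k j) (q j))" for j
    by (intro continuous_at_imp_continuous_on ballI has_vector_derivative_continuous[OF has_vector_derivative_todd_kernel]) auto
  then have "continuous_on X (\<lambda>x. todd_kernel (k j) (q j) (col_form A j x))" for j
    by (rule continuous_on_compose2) (auto intro!: continuous_intros col_form_pos[OF assms])
  then show ?thesis unfolding kern_def[abs_def] by (intro continuous_on_prod)
qed

lemma kern_bound:
  fixes A :: "real ^ 'r ^ 'n"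
  assumes A: "A \<in> Sigma_mat"
  shows "\<exists>C. \<forall>x. norm (kern A k q x) \<le> C * (\<Prod>j\<in>UNIV. exp (- col_form A j x / 2) / col_form A j x ^ k j)"
proof -
  have "\<forall>j. \<exists>C. \<forall>y\<ge>0. norm (todd_deriv (q j) y) \<le> C * exp (- y / 2)"
    using todd_deriv_bound by blast
  from choice[OF this] obtain C where C: "\<And>j y. 0 \<le> y \<Longrightarrow> norm (todd_deriv (q j) y) \<le> C j * exp (- y / 2)" by blast
  have "norm (kern A k q x) \<le> (\<Prod>j\<in>UNIV. C j) * (\<Prod>j\<in>UNIV. exp (- col_form A j x / 2) / col_form A j x ^ k j)" for x
  proof -
    have "norm (kern A k q x) = (\<Prod>j\<in>UNIV. norm (todd_kernel (k j) (q j) (col_form A j x)))"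
      by (simp add: kern_def prod_norm)
    also have "\<dots> \<le> (\<Prod>j\<in>UNIV. C j * (exp (- col_form A j x / 2) / col_form A j x ^ k j))"
    proof (intro prod_mono conjI norm_ge_zero)
      fix j
      have L: "0 < col_form A j x" by (rule col_form_pos[OF A])
      have "norm (todd_kernel (k j) (q j) (col_form A j x)) = norm (todd_deriv (q j) (col_form A j x)) / col_form A j x ^ k j"
        using L by (simp add: todd_kernel_def norm_divide norm_power)
      also have "\<dots> \<le> C j * exp (- col_form A j x / 2) / col_form A j x ^ k j"
        using L by (intro divide_right_mono C) auto
      finally show "norm (todd_kernel (k j) (q j) (col_form A j x)) \<le> C j * (exp (- col_form A j x / 2) / col_form A j x ^ k j)"
        by simp
    qed
    finally show ?thesis unfolding prod.distrib .
  qed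
  then show ?thesis by blast
qed

lemma integrable_kern_norm:
  fixes A :: "real ^ 'r ^ 'n"
  assumes A: "A \<in> Sigma_mat" and \<sigma>: "\<sigma> \<in> conv_domain A k"
  shows "integrable lborel (\<lambda>x. exp (\<sigma> \<bullet> x) * norm (kern A k q x))"
proof -
  obtain C where C: "\<And>x. norm (kern A k q x) \<le> C * (\<Prod>j\<in>UNIV. exp (- col_form A j x / 2) / col_form A j x ^ k j)"
    using kern_bound[OF A] by blast
  let ?g = "\<lambda>x. exp (\<sigma> \<bullet> x) * (\<Prod>j\<in>UNIV. exp (- col_form A j x / 2) / col_form A j x ^ k j)"
  show ?thesis
  proof (rule Bochner_Integration.integrable_bound)
    show "integrable lborel (\<lambda>x. C * ?g x)" using integrable_conv_domain[OF A \<sigma>] by (rule integrable_mult_right)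
    show "AE x in lborel. norm (exp (\<sigma> \<bullet> x) * norm (kern A k q x)) \<le> norm (C * ?g x)"
    proof (intro AE_I2)
      fix x
      have "norm (exp (\<sigma> \<bullet> x) * norm (kern A k q x)) = exp (\<sigma> \<bullet> x) * norm (kern A k q x)" by (simp add: abs_mult)
      also have "\<dots> \<le> exp (\<sigma> \<bullet> x) * (C * (\<Prod>j\<in>UNIV. exp (- col_form A j x / 2) / col_form A j x ^ k j))"
        by (intro mult_left_mono C) simp
      also have "\<dots> = C * ?g x" by (simp only: ac_simps)
      also have "\<dots> \<le> norm (C * ?g x)" by simp
      finally show "norm (exp (\<sigma> \<bullet> x) * norm (kern A k q x)) \<le> norm (C * ?g x)" .
    qed
  qed measurable
qed

lemma integrable_kern:
  assumes "A \<in> Sigma_mat" and "re_vec s \<in> conv_domain A k"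
  shows "integrable lborel (\<lambda>x. exp (cpair s x) * kern A k q x)"
proof (rule Bochner_Integration.integrable_bound[OF integrable_kern_norm[OF assms]])
  show "AE x in lborel. norm (exp (cpair s x) * kern A k q x) \<le> norm (exp (re_vec s \<bullet> x) * norm (kern A k q x))"
    by (simp add: norm_mult Re_cpair)
qed measurable

lemma shintani_integral_holomorphic:
  assumes "A \<in> Sigma_mat"
  shows "holomorphic_Cn (shintani_integral A k q) {s. re_vec s \<in> conv_domain A k}"
  unfolding shintani_integral_def[abs_def]
  by (rule laplace_holomorphic) (auto intro: open_conv_domain integrable_kern_norm[OF assms])

lemma level_fun_upd_Suc:
  "level S (k(j := Suc (k j))) UNIV T = level S k UNIV T + (if S j \<subseteq> T then 1 else 0)"
  for S :: "'r::finite \<Rightarrow> 'n set"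
proof -
  have "(\<Sum>i\<in>UNIV. if S i \<subseteq> T then (k(j := Suc (k j))) i else 0) =
      (\<Sum>i\<in>UNIV. (if S i \<subseteq> T then k i else 0) + (if i = j then (if S j \<subseteq> T then 1 else 0) else 0))"
    by (intro sum.cong) auto
  then show ?thesis by (simp add: level_alt sum.distrib)
qed

lemma sum_axis: "(\<Sum>i'\<in>T. (axis i (1 :: 'a::comm_semiring_1)) $ i') = (if i \<in> T then 1 else 0)" for T :: "'n::finite set"
  by (simp add: axis_def)

lemma conv_domain_add_axis:
  assumes "\<sigma> \<in> conv_domain A k"
  shows "\<sigma> + axis i 1 \<in> conv_domain A k"
  using assms unfolding conv_domain_def
  by (auto simp: sum.distrib sum_axis intro: less_trans)

text \<open>A set whose level rises contains \<open>column_support A j\<close>, hence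
  \<open>i\<close>, so its sum rises by 1 as well.\<close>

lemma conv_domain_add_axis_Suc:
  assumes "\<sigma> \<in> conv_domain A k" "i \<in> column_support A j"
  shows "\<sigma> + axis i 1 \<in> conv_domain A (k(j := Suc (k j)))"
  using assms unfolding conv_domain_def level_fun_upd_Suc
  by (auto simp: sum.distrib sum_axis intro: less_trans)

lemma re_vec_add_axis: "re_vec (s + axis i 1) = re_vec s + axis i 1"
  by (simp add: vec_eq_iff axis_def)

lemma exp_cpair_add_axis: "exp (cpair (s + axis i 1) x) = exp (cpair s x) * complex_of_real (exp (x $ i))"
proof -
  have "cpair (axis i 1) x = (\<Sum>i'\<in>UNIV. if i' = i then complex_of_real (x $ i') else 0)"
    unfolding cpair_def by (intro sum.cong) (auto simp: axis_def)
  then show ?thesis by (simp add: cpair_add exp_add exp_of_real)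
qed

lemma kern_Suc_right:
  "kern A k (q(j := Suc (q j))) x = todd_kernel (k j) (Suc (q j)) (col_form A j x) *
    (\<Prod>i\<in>UNIV - {j}. todd_kernel (k i) (q i) (col_form A i x))"
  unfolding kern_def by (subst prod.remove[of _ j]) (auto intro!: prod.cong)

lemma kern_Suc_left:
  "kern A (k(j := Suc (k j))) q x = todd_kernel (Suc (k j)) (q j) (col_form A j x) *
    (\<Prod>i\<in>UNIV - {j}. todd_kernel (k i) (q i) (col_form A i x))"
  unfolding kern_def by (subst prod.remove[of _ j]) (auto intro!: prod.cong)

lemma kern_split:
  "kern A k q x = todd_kernel (k j) (q j) (col_form A j x) *
    (\<Prod>i\<in>UNIV - {j}. todd_kernel (k i) (q i) (col_form A i x))"
  unfolding kern_def by (subst prod.remove[of _ j]) auto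

lemma col_form_mult_kern_Suc:
  assumes "A \<in> Sigma_mat"
  shows "complex_of_real (col_form A j x) * kern A (k(j := Suc (k j))) q x = kern A k q x"
  using col_form_pos[OF assms, of j x] unfolding kern_Suc_left kern_split[of A k q x j]
  by (simp add: todd_kernel_def)

text \<open>The derivative of \<open>col_form A j\<close> along \<open>ivec T\<close>. Restricting
  the sum to the support ensures that each of its indices qualifies for
  \<open>conv_domain_add_axis_Suc\<close>.\<close>

definition part_form :: "real ^ 'r ^ 'n \<Rightarrow> 'n set \<Rightarrow> 'r \<Rightarrow> real ^ 'n \<Rightarrow> real" where
  "part_form A T j x = (\<Sum>i\<in>T \<inter> column_support A j. A $ i $ j * exp (x $ i))"

lemma column_support_zero: "A \<in> Sigma_mat \<Longrightarrow> i \<notin> column_support A j \<Longrightarrow> A $ i $ j = 0"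
  by (auto simp: column_support_def Sigma_mat_def not_less intro: antisym)

lemma part_form_eq_col_form:
  assumes "A \<in> Sigma_mat" "column_support A j \<subseteq> T"
  shows "part_form A T j x = col_form A j x"
  unfolding part_form_def col_form_def
  using assms(2) column_support_zero[OF assms(1)] by (intro sum.mono_neutral_left) auto

lemma has_derivative_col_form_line:
  assumes A: "A \<in> Sigma_mat"
  shows "((\<lambda>t. col_form A j (x + t *\<^sub>R ivec T)) has_vector_derivative part_form A T j (x + t *\<^sub>R ivec T)) (at t)"
proof -
  have "((\<lambda>t. \<Sum>i\<in>UNIV. A $ i $ j * exp (x $ i + t * ivec T $ i)) has_real_derivative
      (\<Sum>i\<in>UNIV. A $ i $ j * (exp (x $ i + t * ivec T $ i) * ivec T $ i))) (at t)"
    by (intro DERIV_sum) (auto intro!: derivative_eq_intros)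
  also have "(\<Sum>i\<in>UNIV. A $ i $ j * (exp (x $ i + t * ivec T $ i) * ivec T $ i)) = part_form A T j (x + t *\<^sub>R ivec T)"
    unfolding part_form_def using column_support_zero[OF A]
    by (intro sum.mono_neutral_cong_right) (auto simp: ivec_def)
  finally show ?thesis by (simp add: col_form_def has_real_derivative_iff_has_vector_derivative)
qed

lemma has_vector_derivative_prod_finite:
  fixes f :: "'i \<Rightarrow> real \<Rightarrow> complex"
  assumes "\<And>i. i \<in> I \<Longrightarrow> (f i has_vector_derivative f' i) (at t)"
  shows "((\<lambda>t. \<Prod>i\<in>I. f i t) has_vector_derivative (\<Sum>i\<in>I. f' i * (\<Prod>j\<in>I - {i}. f j t))) (at t)"
proof -
  have "((\<lambda>t. \<Prod>i\<in>I. f i t) has_derivative (\<lambda>y. \<Sum>i\<in>I. (y *\<^sub>R f' i) * (\<Prod>j\<in>I - {i}. f j t))) (at t)"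
    using assms unfolding has_vector_derivative_def by (rule has_derivative_prod)
  then show ?thesis
    unfolding has_vector_derivative_def by (simp add: scaleR_sum_right)
qed

lemma has_vector_derivative_kern_line:
  fixes A :: "real ^ 'r ^ 'n" and x :: "real ^ 'n" and T :: "'n set"
  assumes A: "A \<in> Sigma_mat"
  defines "z \<equiv> \<lambda>t. x + t *\<^sub>R ivec T"
  shows "((\<lambda>t. kern A k q (z t)) has_vector_derivative
    (\<Sum>j\<in>UNIV. complex_of_real (part_form A T j (z t)) *
      (kern A k (q(j := Suc (q j))) (z t) - of_nat (k j) * kern A (k(j := Suc (k j))) q (z t)))) (at t)"
proof -
  have "((\<lambda>t. todd_kernel (k j) (q j) (col_form A j (z t))) has_vector_derivative
      part_form A T j (z t) *\<^sub>R (todd_kernel (k j) (Suc (q j)) (col_form A j (z t)) -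
        of_nat (k j) * todd_kernel (Suc (k j)) (q j) (col_form A j (z t)))) (at t)" for j
    unfolding z_def
    using vector_diff_chain_at[OF has_derivative_col_form_line[OF A]
        has_vector_derivative_todd_kernel[OF less_imp_neq[OF col_form_pos[OF A], symmetric]]]
    by (simp add: o_def)
  then have "((\<lambda>t. \<Prod>j\<in>UNIV. todd_kernel (k j) (q j) (col_form A j (z t))) has_vector_derivative
      (\<Sum>j\<in>UNIV. part_form A T j (z t) *\<^sub>R (todd_kernel (k j) (Suc (q j)) (col_form A j (z t)) -
        of_nat (k j) * todd_kernel (Suc (k j)) (q j) (col_form A j (z t))) *
        (\<Prod>i\<in>UNIV - {j}. todd_kernel (k i) (q i) (col_form A i (z t))))) (at t)"
    by (intro has_vector_derivative_prod_finite)
  then show ?thesis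
    unfolding kern_def[symmetric] kern_Suc_left kern_Suc_right
    by (simp add: scaleR_conv_of_real algebra_simps)
qed

lemma cpair_ivec: "cpair s (ivec T) = (\<Sum>i\<in>T. s $ i)"
proof -
  have "cpair s (ivec T) = (\<Sum>i\<in>UNIV. if i \<in> T then s $ i else 0)"
    unfolding cpair_def ivec_def by (intro sum.cong) auto
  then show ?thesis by (simp add: sum.If_cases)
qed

lemma has_vector_derivative_exp_cpair_line:
  "((\<lambda>t. exp (cpair s (x + t *\<^sub>R ivec T))) has_vector_derivative
    exp (cpair s (x + t *\<^sub>R ivec T)) * (\<Sum>i\<in>T. s $ i)) (at t)"
proof -
  have eq: "cpair s (x + t *\<^sub>R ivec T) = cpair s x + complex_of_real t * (\<Sum>i\<in>T. s $ i)" for t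
    unfolding cpair_add_right cpair_ivec[symmetric]
    by (simp add: cpair_def sum_distrib_left algebra_simps)
  have "((\<lambda>w. exp (cpair s x + w * (\<Sum>i\<in>T. s $ i))) has_field_derivative
      exp (cpair s x + complex_of_real t * (\<Sum>i\<in>T. s $ i)) * (\<Sum>i\<in>T. s $ i)) (at (complex_of_real t))"
    by (auto intro!: derivative_eq_intros)
  from has_vector_derivative_real_field[OF this] show ?thesis unfolding eq .
qed


text \<open>Integrate the derivative of the integrand along the indicator vector of \<open>T\<close>. An edge inside \<open>T\<close>
  scales homogeneously and only shifts the factor on the left; every other term carries an extra
  \<open>\<epsilon>\<^sub>i\<close> with \<open>i \<in> T\<close>, which moves the barrier for \<open>T\<close> by one and the others not backwards.\<close>

lemma shintani_integral_recurrence: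
  fixes A :: "real ^ 'r ^ 'n" and s :: "complex ^ 'n"
  assumes A: "A \<in> Sigma_mat" and s: "re_vec s \<in> conv_domain A k"
  shows "((\<Sum>i\<in>T. s $ i) - of_nat (level (column_support A) k UNIV T)) * shintani_integral A k q s =
    (\<Sum>j | \<not> column_support A j \<subseteq> T. \<Sum>i\<in>T \<inter> column_support A j. of_nat (k j) * of_real (A $ i $ j) *
      shintani_integral A (k(j := Suc (k j))) q (s + axis i 1)) -
    (\<Sum>j\<in>UNIV. \<Sum>i\<in>T \<inter> column_support A j. of_real (A $ i $ j) *
      shintani_integral A k (q(j := Suc (q j))) (s + axis i 1))"
proof -
  let ?S = "column_support A"
  define E where "E = (\<lambda>y. exp (cpair s y))"
  define a where "a = (\<lambda>i y. exp (cpair (s + axis i 1) y))"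
  define K where "K = kern A k q"
  define K1 where "K1 = (\<lambda>j. kern A k (q(j := Suc (q j))))"
  define K2 where "K2 = (\<lambda>j. kern A (k(j := Suc (k j))) q)"
  define F where "F = (\<lambda>y. E y * K y)"
  define F' where "F' = (\<lambda>y. E y * ((\<Sum>i\<in>T. s $ i) * K y +
    (\<Sum>j\<in>UNIV. complex_of_real (part_form A T j y) * (K1 j y - of_nat (k j) * K2 j y))))"
  define R1 where "R1 = (\<lambda>y. \<Sum>j\<in>UNIV. \<Sum>i\<in>T \<inter> ?S j. of_real (A $ i $ j) * (a i y * K1 j y))"
  define R2 where "R2 = (\<lambda>y. \<Sum>j | \<not> ?S j \<subseteq> T. \<Sum>i\<in>T \<inter> ?S j. of_nat (k j) * of_real (A $ i $ j) * (a i y * K2 j y))"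
  define lev where "lev = complex_of_nat (level ?S k UNIV T)"
  have lev: "lev = (\<Sum>j | ?S j \<subseteq> T. of_nat (k j))" by (simp add: lev_def level_def)
  have pf: "E y * complex_of_real (part_form A T j y) = (\<Sum>i\<in>T \<inter> ?S j. of_real (A $ i $ j) * a i y)" for j y
    unfolding part_form_def a_def exp_cpair_add_axis E_def of_real_sum sum_distrib_left
    by (intro sum.cong) auto
  have pf1: "E y * complex_of_real (part_form A T j y) * K1 j y = (\<Sum>i\<in>T \<inter> ?S j. of_real (A $ i $ j) * (a i y * K1 j y))" for j y
    unfolding pf sum_distrib_right by (simp add: mult.assoc)
  \<comment> \<open>For an edge inside \<open>T\<close> the derivative is the whole form; it cancels
    one power in the denominator and gives back \<open>F\<close>. These terms add up to
    \<open>lev * F y\<close>.\<close>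
  have pf2: "E y * complex_of_real (part_form A T j y) * (of_nat (k j) * K2 j y) =
      (if ?S j \<subseteq> T then of_nat (k j) * F y else (\<Sum>i\<in>T \<inter> ?S j. of_nat (k j) * of_real (A $ i $ j) * (a i y * K2 j y)))" for j y
  proof (cases "?S j \<subseteq> T")
    case True
    have "complex_of_real (part_form A T j y) * K2 j y = K y"
      unfolding part_form_eq_col_form[OF A True] K2_def K_def by (rule col_form_mult_kern_Suc[OF A])
    then have "E y * of_nat (k j) * (complex_of_real (part_form A T j y) * K2 j y) = E y * of_nat (k j) * K y" by simp
    then show ?thesis using True by (simp add: F_def ac_simps)
  next
    case False
    then show ?thesis unfolding pf sum_distrib_right by (simp add: ac_simps)
  qed
  have F'_eq: "F' y = ((\<Sum>i\<in>T. s $ i) - lev) * F y + R1 y - R2 y" for y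
  proof -
    have "F' y = (\<Sum>i\<in>T. s $ i) * F y + (\<Sum>j\<in>UNIV. E y * complex_of_real (part_form A T j y) * K1 j y)
        - (\<Sum>j\<in>UNIV. E y * complex_of_real (part_form A T j y) * (of_nat (k j) * K2 j y))"
      unfolding F'_def F_def by (simp add: algebra_simps sum_distrib_left sum_subtractf)
    also have "(\<Sum>j\<in>UNIV. E y * complex_of_real (part_form A T j y) * K1 j y) = R1 y"
      unfolding pf1 R1_def ..
    also have "(\<Sum>j\<in>UNIV. E y * complex_of_real (part_form A T j y) * (of_nat (k j) * K2 j y)) = lev * F y + R2 y"
      unfolding pf2 R2_def lev by (simp add: sum.If_cases sum_distrib_right Compl_eq)
    finally show ?thesis by (simp add: algebra_simps)
  qed
  have int_a1: "integrable lborel (\<lambda>y. a i y * K1 j y)" for i j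
    unfolding a_def K1_def by (intro integrable_kern A) (auto simp: re_vec_add_axis intro: conv_domain_add_axis s)
  have int_a2: "integrable lborel (\<lambda>y. a i y * K2 j y)" if "i \<in> ?S j" for i j
    unfolding a_def K2_def by (intro integrable_kern A) (auto simp: re_vec_add_axis intro: conv_domain_add_axis_Suc s that)
  have intF: "integrable lborel F" unfolding F_def E_def K_def by (rule integrable_kern[OF A s])
  have intR1: "integrable lborel R1" unfolding R1_def
    by (intro Bochner_Integration.integrable_sum integrable_mult_right int_a1)
  have intR2: "integrable lborel R2" unfolding R2_def
    by (intro Bochner_Integration.integrable_sum integrable_mult_right int_a2) auto
  have "(\<integral>y. F' y \<partial>lborel) = 0"
  proof (rule integral_directional_derivative_eq_0)
    fix x t
    have "((\<lambda>t. F (x + t *\<^sub>R ivec T)) has_vector_derivative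
        (E (x + t *\<^sub>R ivec T) * (\<Sum>j\<in>UNIV. complex_of_real (part_form A T j (x + t *\<^sub>R ivec T)) *
          (K1 j (x + t *\<^sub>R ivec T) - of_nat (k j) * K2 j (x + t *\<^sub>R ivec T))) +
        E (x + t *\<^sub>R ivec T) * (\<Sum>i\<in>T. s $ i) * K (x + t *\<^sub>R ivec T))) (at t)"
      unfolding F_def E_def K_def K1_def K2_def
      by (intro has_vector_derivative_mult has_vector_derivative_exp_cpair_line has_vector_derivative_kern_line A)
    then show "((\<lambda>t. F (x + t *\<^sub>R ivec T)) has_vector_derivative F' (x + t *\<^sub>R ivec T)) (at t)"
      unfolding F'_def by (simp only: algebra_simps)
  next
    show "continuous_on UNIV F'"
      unfolding F'_def E_def K_def K1_def K2_def part_form_def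
      by (intro continuous_intros continuous_on_kern[OF A] continuous_on_cpair)
    show "integrable lborel F'"
      unfolding F'_eq[abs_def] by (intro Bochner_Integration.integrable_diff Bochner_Integration.integrable_add integrable_mult_right intF intR1 intR2)
  qed (rule intF)
  also have "(\<integral>y. F' y \<partial>lborel) = ((\<Sum>i\<in>T. s $ i) - lev) * (\<integral>y. F y \<partial>lborel) + (\<integral>y. R1 y \<partial>lborel) - (\<integral>y. R2 y \<partial>lborel)"
    unfolding F'_eq by (simp add: intF intR1 intR2)
  finally have "((\<Sum>i\<in>T. s $ i) - lev) * (\<integral>y. F y \<partial>lborel) = (\<integral>y. R2 y \<partial>lborel) - (\<integral>y. R1 y \<partial>lborel)"
    by (simp add: algebra_simps)
  moreover have "(\<integral>y. R1 y \<partial>lborel) = (\<Sum>j\<in>UNIV. \<Sum>i\<in>T \<inter> ?S j. of_real (A $ i $ j) *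
      shintani_integral A k (q(j := Suc (q j))) (s + axis i 1))"
    unfolding R1_def
    by (subst Bochner_Integration.integral_sum, intro Bochner_Integration.integrable_sum integrable_mult_right int_a1,
        intro sum.cong refl, subst Bochner_Integration.integral_sum, intro integrable_mult_right int_a1)
       (simp add: shintani_integral_def a_def K1_def)
  moreover have "(\<integral>y. R2 y \<partial>lborel) = (\<Sum>j | \<not> ?S j \<subseteq> T. \<Sum>i\<in>T \<inter> ?S j. of_nat (k j) * of_real (A $ i $ j) *
      shintani_integral A (k(j := Suc (k j))) q (s + axis i 1))"
    unfolding R2_def
    by (subst Bochner_Integration.integral_sum, intro Bochner_Integration.integrable_sum integrable_mult_right int_a2, simp,
        intro sum.cong refl, subst Bochner_Integration.integral_sum, intro integrable_mult_right int_a2, simp)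
       (simp add: shintani_integral_def a_def K2_def)
  ultimately show ?thesis
    unfolding lev_def F_def E_def K_def shintani_integral_def[of A k q s] by simp
qed

section \<open>Continuation to larger tubes\<close>

definition cdifferentiable_at :: "(complex ^ 'n \<Rightarrow> complex) \<Rightarrow> complex ^ 'n \<Rightarrow> bool" where
  "cdifferentiable_at f s \<longleftrightarrow>
    (\<exists>D. (f has_derivative D) (at s) \<and> (\<forall>x y. D (x + y) = D x + D y) \<and> (\<forall>c x. D (c *s x) = c * D x))"

lemma complex_linear_iff:
  "Vector_Spaces.linear (*s) (*) D \<longleftrightarrow>
    (\<forall>x y. D (x + y) = D x + D y) \<and> (\<forall>c x. D (c *s x) = c * (D x :: complex))" for D :: "complex ^ 'n \<Rightarrow> complex"
proof
  assume "Vector_Spaces.linear (*s) (*) D"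
  then show "(\<forall>x y. D (x + y) = D x + D y) \<and> (\<forall>c x. D (c *s x) = c * (D x :: complex))"
    by (simp add: Vector_Spaces.linear_iff)
next
  assume "(\<forall>x y. D (x + y) = D x + D y) \<and> (\<forall>c x. D (c *s x) = c * (D x :: complex))"
  then show "Vector_Spaces.linear (*s) (*) D"
    by unfold_locales (auto simp: algebra_simps)
qed

lemma holomorphic_Cn_iff: "holomorphic_Cn f U \<longleftrightarrow> open U \<and> (\<forall>s\<in>U. cdifferentiable_at f s)"
  unfolding holomorphic_Cn_def cdifferentiable_at_def complex_linear_iff by blast

lemma cdifferentiable_const: "cdifferentiable_at (\<lambda>s. c) s"
  unfolding cdifferentiable_at_def by (intro exI[of _ "\<lambda>_. 0"]) auto

lemma cdifferentiable_nth: "cdifferentiable_at (\<lambda>s. s $ i) s"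
  unfolding cdifferentiable_at_def
  by (intro exI[of _ "\<lambda>s. s $ i"]) (auto intro: bounded_linear_imp_has_derivative bounded_linear_vec_nth)

lemma cdifferentiable_add:
  assumes "cdifferentiable_at f s" "cdifferentiable_at g s"
  shows "cdifferentiable_at (\<lambda>s. f s + g s) s"
proof -
  obtain D D' where D: "(f has_derivative D) (at s)" "\<forall>x y. D (x + y) = D x + D y" "\<forall>c x. D (c *s x) = c * D x"
    and D': "(g has_derivative D') (at s)" "\<forall>x y. D' (x + y) = D' x + D' y" "\<forall>c x. D' (c *s x) = c * D' x"
    using assms unfolding cdifferentiable_at_def by blast
  show ?thesis
    unfolding cdifferentiable_at_def using has_derivative_add[OF D(1) D'(1)] D D'
    by (intro exI[of _ "\<lambda>h. D h + D' h"]) (simp add: algebra_simps)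
qed

lemma cdifferentiable_mult:
  assumes "cdifferentiable_at f s" "cdifferentiable_at g s"
  shows "cdifferentiable_at (\<lambda>s. f s * g s) s"
proof -
  obtain D D' where D: "(f has_derivative D) (at s)" "\<forall>x y. D (x + y) = D x + D y" "\<forall>c x. D (c *s x) = c * D x"
    and D': "(g has_derivative D') (at s)" "\<forall>x y. D' (x + y) = D' x + D' y" "\<forall>c x. D' (c *s x) = c * D' x"
    using assms unfolding cdifferentiable_at_def by blast
  show ?thesis
    unfolding cdifferentiable_at_def using has_derivative_mult[OF D(1) D'(1)] D D'
    by (intro exI[of _ "\<lambda>h. f s * D' h + D h * g s"]) (simp add: distrib_left distrib_right mult.left_commute mult.assoc)
qed

lemma cdifferentiable_compose:
  assumes "cdifferentiable_at f s" "g field_differentiable at (f s)"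
  shows "cdifferentiable_at (\<lambda>s. g (f s)) s"
proof -
  obtain D where D: "(f has_derivative D) (at s)" "\<forall>x y. D (x + y) = D x + D y" "\<forall>c x. D (c *s x) = c * D x"
    using assms unfolding cdifferentiable_at_def by blast
  obtain d where "(g has_field_derivative d) (at (f s))" using assms(2) by (auto simp: field_differentiable_def)
  then have "(g has_derivative (*) d) (at (f s))" by (simp add: has_field_derivative_def)
  from has_derivative_compose[OF D(1) this] show ?thesis
    unfolding cdifferentiable_at_def using D
    by (intro exI[of _ "\<lambda>h. d * D h"]) (auto simp: algebra_simps)
qed

lemma cdifferentiable_translate:
  assumes "cdifferentiable_at f (s + c)"
  shows "cdifferentiable_at (\<lambda>s. f (s + c)) s"
proof -
  obtain D where D: "(f has_derivative D) (at (s + c))" "\<forall>x y. D (x + y) = D x + D y" "\<forall>c x. D (c *s x) = c * D x"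
    using assms unfolding cdifferentiable_at_def by blast
  have "((\<lambda>s. s + c) has_derivative (\<lambda>h. h)) (at s)" by (auto intro!: derivative_eq_intros)
  from has_derivative_compose[OF this D(1)] show ?thesis
    unfolding cdifferentiable_at_def using D by blast
qed

lemma cdifferentiable_sum:
  "(\<And>i. i \<in> I \<Longrightarrow> cdifferentiable_at (f i) s) \<Longrightarrow> cdifferentiable_at (\<lambda>s. \<Sum>i\<in>I. f i s) s"
  by (induction I rule: infinite_finite_induct) (auto intro: cdifferentiable_const cdifferentiable_add)

lemma cdifferentiable_prod:
  "(\<And>i. i \<in> I \<Longrightarrow> cdifferentiable_at (f i) s) \<Longrightarrow> cdifferentiable_at (\<lambda>s. \<Prod>i\<in>I. f i s) s"
  by (induction I rule: infinite_finite_induct) (auto intro: cdifferentiable_const cdifferentiable_mult)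

lemmas cdifferentiable_intros =
  cdifferentiable_const cdifferentiable_nth cdifferentiable_add cdifferentiable_mult cdifferentiable_sum cdifferentiable_prod

lemma cdifferentiable_transform:
  assumes "cdifferentiable_at f s" "open U" "s \<in> U" "\<And>z. z \<in> U \<Longrightarrow> f z = g z"
  shows "cdifferentiable_at g s"
  using assms has_derivative_transform_within_open unfolding cdifferentiable_at_def by metis

section \<open>Affine forms, tubes and extension from the first tube\<close>

definition pole_form :: "real ^ 'r ^ 'n \<Rightarrow> 'n set \<times> nat \<Rightarrow> complex ^ 'n \<Rightarrow> complex" where
  "pole_form A = (\<lambda>(T, l) s. (\<Sum>i\<in>T. s $ i) + (of_nat l - of_nat (level (column_support A) (\<lambda>_. 1) UNIV T)))"

lemma cdifferentiable_pole_form: "cdifferentiable_at (pole_form A p) s"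
  unfolding pole_form_def case_prod_unfold by (intro cdifferentiable_intros)

text \<open>\<open>N = 0\<close> is the tube on which the integral for the zeta function converges;
  each increment moves the barrier of every linked set back by 1.\<close>

definition tube :: "real ^ 'r ^ 'n \<Rightarrow> nat \<Rightarrow> (complex ^ 'n) set" where
  "tube A N = {s. \<forall>T. linked (column_support A) UNIV T \<longrightarrow>
     real (level (column_support A) (\<lambda>_. 1) UNIV T) < (\<Sum>i\<in>T. Re (s $ i)) + real N}"

lemma open_tube: "open (tube A N)"
proof -
  have "tube A N = (\<Inter>T\<in>Collect (linked (column_support A) UNIV).
      {s. real (level (column_support A) (\<lambda>_. 1) UNIV T) < (\<Sum>i\<in>T. Re (s $ i)) + real N})"
    by (auto simp: tube_def)
  then show ?thesis by (auto intro!: open_INT open_Collect_less continuous_intros)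
qed

lemma tube_mono: "M \<le> N \<Longrightarrow> tube A M \<subseteq> tube A N"
  unfolding tube_def by (force intro: less_le_trans)

lemma tube_exhausts: "\<exists>N. s \<in> tube A N"
proof -
  let ?f = "\<lambda>T. real (level (column_support A) (\<lambda>_. 1) UNIV T) - (\<Sum>i\<in>T. Re (s $ i))"
  obtain N where N: "(\<Sum>T\<in>UNIV. \<bar>?f T\<bar>) < real N" using reals_Archimedean2 by blast
  have "?f T < real N" for T
  proof -
    have "?f T \<le> \<bar>?f T\<bar>" by simp
    also have "\<dots> \<le> (\<Sum>T\<in>UNIV. \<bar>?f T\<bar>)" by (rule member_le_sum) auto
    finally show ?thesis using N by simp
  qed
  then have "s \<in> tube A N" unfolding tube_def by (auto simp: algebra_simps)
  then show ?thesis ..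
qed

text \<open>Only the values of \<open>h\<close> on \<open>tube A 0\<close> enter, so identities that
  are available only there, such as the recurrence, may be used to rewrite it.\<close>

definition extends_to :: "real ^ 'r ^ 'n \<Rightarrow> nat \<Rightarrow> (complex ^ 'n \<Rightarrow> complex) \<Rightarrow> bool" where
  "extends_to A N h \<longleftrightarrow> (\<exists>g. holomorphic_Cn g (tube A N) \<and> (\<forall>s\<in>tube A 0. g s = h s))"

lemma extends_to_cong:
  "extends_to A N h \<Longrightarrow> (\<And>s. s \<in> tube A 0 \<Longrightarrow> h s = h' s) \<Longrightarrow> extends_to A N h'"
  unfolding extends_to_def by (metis (no_types, lifting))

lemma extends_to_entire: "(\<And>s. cdifferentiable_at h s) \<Longrightarrow> extends_to A N h"
  unfolding extends_to_def holomorphic_Cn_iff using open_tube by blast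

lemma extends_to_mult:
  assumes "extends_to A N f" "extends_to A N g" shows "extends_to A N (\<lambda>s. f s * g s)"
proof -
  obtain f' g' where "holomorphic_Cn f' (tube A N)" "\<forall>s\<in>tube A 0. f' s = f s"
    "holomorphic_Cn g' (tube A N)" "\<forall>s\<in>tube A 0. g' s = g s"
    using assms unfolding extends_to_def by blast
  then show ?thesis unfolding extends_to_def holomorphic_Cn_iff
    by (intro exI[of _ "\<lambda>s. f' s * g' s"]) (auto intro: cdifferentiable_mult)
qed

lemma extends_to_add:
  assumes "extends_to A N f" "extends_to A N g" shows "extends_to A N (\<lambda>s. f s + g s)"
proof -
  obtain f' g' where "holomorphic_Cn f' (tube A N)" "\<forall>s\<in>tube A 0. f' s = f s"
    "holomorphic_Cn g' (tube A N)" "\<forall>s\<in>tube A 0. g' s = g s"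
    using assms unfolding extends_to_def by blast
  then show ?thesis unfolding extends_to_def holomorphic_Cn_iff
    by (intro exI[of _ "\<lambda>s. f' s + g' s"]) (auto intro: cdifferentiable_add)
qed

lemma extends_to_const: "extends_to A N (\<lambda>s. c)"
  by (intro extends_to_entire cdifferentiable_const)

lemma extends_to_sum:
  "(\<And>i. i \<in> I \<Longrightarrow> extends_to A N (f i)) \<Longrightarrow> extends_to A N (\<lambda>s. \<Sum>i\<in>I. f i s)"
  by (induction I rule: infinite_finite_induct) (auto intro: extends_to_const extends_to_add)

definition nat_vec :: "('n \<Rightarrow> nat) \<Rightarrow> complex ^ 'n" where
  "nat_vec a = (\<chi> i. of_nat (a i))"

lemma nat_vec_upd_Suc: "s + nat_vec a + axis i 1 = s + nat_vec (a(i := Suc (a i)))"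
  by (simp add: vec_eq_iff nat_vec_def axis_def)

lemma sum_upd_Suc: "sum (a(i := Suc (a i))) T = sum a T + (if i \<in> T then 1 else 0)" for T :: "'n::finite set"
proof -
  have "sum (a(i := Suc (a i))) T = (\<Sum>x\<in>T. a x + (if x = i then 1 else 0))"
    by (intro sum.cong) auto
  then show ?thesis by (simp add: sum.distrib)
qed

definition linked_set :: "real ^ 'r ^ 'n \<Rightarrow> 'n set set" where
  "linked_set A = Collect (linked (column_support A) UNIV)"

text \<open>After a shift by \<open>a\<close>, the condition for the powers \<open>k\<close> is the
  original one with the barrier of \<open>T\<close> moved back by \<open>d T\<close>. The balance is
  stated with sums because subtraction of naturals truncates.\<close>

lemma shifted_in_conv_domain:
  fixes A :: "real ^ 'r ^ 'n"
  assumes d: "\<And>T. T \<in> linked_set A \<Longrightarrow> level (column_support A) k UNIV T + d T =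
      level (column_support A) (\<lambda>_. 1) UNIV T + sum a T"
    and N: "\<And>T. T \<in> linked_set A \<Longrightarrow> N \<le> d T" and s: "s \<in> tube A N"
  shows "re_vec (s + nat_vec a) \<in> conv_domain A k"
  unfolding conv_domain_def
proof clarify
  fix T assume T: "linked (column_support A) UNIV T"
  have "real (level (column_support A) (\<lambda>_. 1) UNIV T) < (\<Sum>i\<in>T. Re (s $ i)) + real N"
    using s T by (simp add: tube_def)
  moreover have "real (level (column_support A) k UNIV T) + real (d T) =
      real (level (column_support A) (\<lambda>_. 1) UNIV T) + real (sum a T)"
    using d[of T] T unfolding linked_set_def of_nat_add[symmetric] by simp
  moreover have "real N \<le> real (d T)" using N[of T] T by (simp add: linked_set_def)
  moreover have "(\<Sum>i\<in>T. re_vec (s + nat_vec a) $ i) = (\<Sum>i\<in>T. Re (s $ i)) + real (sum a T)"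
    by (simp add: nat_vec_def sum.distrib)
  ultimately show "real (level (column_support A) k UNIV T) < (\<Sum>i\<in>T. re_vec (s + nat_vec a) $ i)" by linarith
qed

text \<open>The integral already converges where the pairing with \<open>T\<close> has real part above the level minus
  \<open>d T\<close>; the induction is on the total distance of the \<open>d T\<close> from \<open>N\<close>.\<close>

lemma continuation_shifted:
  fixes A :: "real ^ 'r ^ 'n"
  assumes A: "A \<in> Sigma_mat"
    and "\<And>T. T \<in> linked_set A \<Longrightarrow> level (column_support A) k UNIV T + d T =
      level (column_support A) (\<lambda>_. 1) UNIV T + sum a T"
  shows "extends_to A N (\<lambda>s. (\<Prod>T\<in>linked_set A. \<Prod>l\<in>{d T..<N}. pole_form A (T, l) s) *
    shintani_integral A k q (s + nat_vec a))"
  using assms(2)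
proof (induction "\<Sum>T\<in>linked_set A. N - d T" arbitrary: k q a d rule: less_induct)
  case less
  let ?S = "column_support A" and ?L = "linked_set A"
  note d = less.prems
  show ?case
  proof (cases "\<forall>T\<in>?L. N \<le> d T")
    case True
    have "cdifferentiable_at (\<lambda>s. shintani_integral A k q (s + nat_vec a)) s" if "s \<in> tube A N" for s
    proof (rule cdifferentiable_translate)
      have "re_vec (s + nat_vec a) \<in> conv_domain A k"
        by (rule shifted_in_conv_domain[OF d _ that]) (use True in auto)
      then show "cdifferentiable_at (shintani_integral A k q) (s + nat_vec a)"
        using shintani_integral_holomorphic[OF A, of k q] unfolding holomorphic_Cn_iff by blast
    qed
    then have "holomorphic_Cn (\<lambda>s. shintani_integral A k q (s + nat_vec a)) (tube A N)"
      unfolding holomorphic_Cn_iff using open_tube by blast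
    moreover have "(\<Prod>T\<in>?L. \<Prod>l\<in>{d T..<N}. pole_form A (T, l) s) = 1" for s
      using True by (intro prod.neutral) auto
    ultimately show ?thesis unfolding extends_to_def by auto
  next
    case False
    then obtain T where T: "T \<in> ?L" "d T < N" by force
    \<comment> \<open>The recurrence along \<open>T\<close> consumes the form with
      \<open>l = d T\<close>; the remaining product \<open>Q\<close> has to serve all of its
      terms.\<close>
    define d0 where "d0 = d(T := Suc (d T))"
    define Q where "Q = (\<lambda>s. \<Prod>T\<in>?L. \<Prod>l\<in>{d0 T..<N}. pole_form A (T, l) s)"
    have split: "(\<Prod>T\<in>?L. \<Prod>l\<in>{d T..<N}. pole_form A (T, l) s) = pole_form A (T, d T) s * Q s" for s
    proof -
      have "{d T..<N} = insert (d T) {d0 T..<N}" using T by (auto simp: d0_def)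
      moreover have "d T \<notin> {d0 T..<N}" by (simp add: d0_def)
      ultimately have "(\<Prod>l\<in>{d T..<N}. pole_form A (T, l) s) = pole_form A (T, d T) s * (\<Prod>l\<in>{d0 T..<N}. pole_form A (T, l) s)"
        by simp
      moreover have "(\<Prod>T\<in>?L - {T}. \<Prod>l\<in>{d T..<N}. pole_form A (T, l) s) = (\<Prod>T\<in>?L - {T}. \<Prod>l\<in>{d0 T..<N}. pole_form A (T, l) s)"
        by (intro prod.cong) (auto simp: d0_def)
      ultimately show ?thesis
        unfolding Q_def using T by (simp add: prod.remove[of ?L T])
    qed
    \<comment> \<open>A term may have advanced further than \<open>d0\<close>. Then its own product
      is a part of \<open>Q\<close>, and the surplus factors are entire.\<close>
    have IH: "extends_to A N (\<lambda>s. Q s * shintani_integral A k' q' (s + nat_vec a'))"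
      if d': "\<And>T. T \<in> ?L \<Longrightarrow> level ?S k' UNIV T + d' T = level ?S (\<lambda>_. 1) UNIV T + sum a' T"
        and le: "\<And>T'. d0 T' \<le> d' T'" for k' q' a' d'
    proof -
      have dd: "d T' \<le> d' T'" for T' using le[of T'] by (auto simp: d0_def split: if_splits)
      have "(\<Sum>T\<in>?L. N - d' T) < (\<Sum>T\<in>?L. N - d T)"
      proof (rule sum_strict_mono_ex1)
        show "\<forall>T\<in>?L. N - d' T \<le> N - d T" using dd by (auto intro: diff_le_mono2)
        have "N - d' T < N - d T" using T(2) le[of T] by (simp add: d0_def)
        then show "\<exists>T\<in>?L. N - d' T < N - d T" using T(1) by blast
      qed simp
      from less.hyps[OF this d']
      have e1: "extends_to A N (\<lambda>s. (\<Prod>T\<in>?L. \<Prod>l\<in>{d' T..<N}. pole_form A (T, l) s) * shintani_integral A k' q' (s + nat_vec a'))" .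
      have e2: "extends_to A N (\<lambda>s. \<Prod>T\<in>?L. \<Prod>l\<in>{d0 T..<N} - {d' T..<N}. pole_form A (T, l) s)"
        by (intro extends_to_entire cdifferentiable_prod cdifferentiable_pole_form)
      show ?thesis
      proof (rule extends_to_cong[OF extends_to_mult[OF e2 e1]])
        fix s
        have "(\<Prod>l\<in>{d0 T..<N}. pole_form A (T, l) s) =
            (\<Prod>l\<in>{d0 T..<N} - {d' T..<N}. pole_form A (T, l) s) * (\<Prod>l\<in>{d' T..<N}. pole_form A (T, l) s)" for T
          using le[of T] by (intro prod.subset_diff) auto
        then show "(\<Prod>T\<in>?L. \<Prod>l\<in>{d0 T..<N} - {d' T..<N}. pole_form A (T, l) s) *
          ((\<Prod>T\<in>?L. \<Prod>l\<in>{d' T..<N}. pole_form A (T, l) s) * shintani_integral A k' q' (s + nat_vec a')) =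
          Q s * shintani_integral A k' q' (s + nat_vec a')"
          unfolding Q_def by (simp add: prod.distrib mult.assoc)
      qed
    qed
    have ext1: "extends_to A N (\<lambda>s. Q s * shintani_integral A (k(j := Suc (k j))) q (s + nat_vec (a(i := Suc (a i)))))"
      if "i \<in> T" "i \<in> ?S j" "\<not> ?S j \<subseteq> T" for i j
    \<comment> \<open>If \<open>T'\<close> contains \<open>S j\<close>, the rise of the level and
      that of the shift cancel. Any other \<open>T'\<close> containing \<open>i\<close> gains 1, and
      \<open>T\<close> is one of these.\<close>
    proof (rule IH[where d' = "\<lambda>T'. d T' + (if i \<in> T' \<and> \<not> ?S j \<subseteq> T' then 1 else 0)"])
      show "level ?S (k(j := Suc (k j))) UNIV T' + (d T' + (if i \<in> T' \<and> \<not> ?S j \<subseteq> T' then 1 else 0)) =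
          level ?S (\<lambda>_. 1) UNIV T' + sum (a(i := Suc (a i))) T'" if "T' \<in> ?L" for T'
        using d[OF that] \<open>i \<in> ?S j\<close> unfolding level_fun_upd_Suc sum_upd_Suc by auto
    qed (use that in \<open>auto simp: d0_def\<close>)
    have ext2: "extends_to A N (\<lambda>s. Q s * shintani_integral A k (q(j := Suc (q j))) (s + nat_vec (a(i := Suc (a i)))))"
      if "i \<in> T" for i j
    proof (rule IH[where d' = "\<lambda>T'. d T' + (if i \<in> T' then 1 else 0)"])
      show "level ?S k UNIV T' + (d T' + (if i \<in> T' then 1 else 0)) =
          level ?S (\<lambda>_. 1) UNIV T' + sum (a(i := Suc (a i))) T'" if "T' \<in> ?L" for T'
        using d[OF that] unfolding sum_upd_Suc by auto
    qed (use that in \<open>auto simp: d0_def\<close>)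
    have "extends_to A N (\<lambda>s.
      (\<Sum>j | \<not> ?S j \<subseteq> T. \<Sum>i\<in>T \<inter> ?S j. of_nat (k j) * of_real (A $ i $ j) *
        (Q s * shintani_integral A (k(j := Suc (k j))) q (s + nat_vec (a(i := Suc (a i)))))) +
      (- 1) * (\<Sum>j\<in>UNIV. \<Sum>i\<in>T \<inter> ?S j. of_real (A $ i $ j) *
        (Q s * shintani_integral A k (q(j := Suc (q j))) (s + nat_vec (a(i := Suc (a i)))))))"
      by (intro extends_to_add extends_to_mult extends_to_sum extends_to_const ext1 ext2) auto
    then show ?thesis
    proof (rule extends_to_cong)
      fix s assume s: "s \<in> tube A 0"
      \<comment> \<open>On \<open>tube A 0\<close> the integral converges for every
        \<open>d\<close>, so the recurrence is available.\<close>
      have "re_vec (s + nat_vec a) \<in> conv_domain A k"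
        by (rule shifted_in_conv_domain[OF d _ s]) auto
      note rec = shintani_integral_recurrence[OF A this, of T q, unfolded nat_vec_upd_Suc]
      have "complex_of_nat (level ?S k UNIV T) + of_nat (d T) = of_nat (level ?S (\<lambda>_. 1) UNIV T) + of_nat (sum a T)"
        using d[OF T(1)] by (simp only: of_nat_add[symmetric])
      moreover have "(\<Sum>i\<in>T. (s + nat_vec a) $ i) = (\<Sum>i\<in>T. s $ i) + of_nat (sum a T)"
        by (simp add: nat_vec_def sum.distrib)
      ultimately have "pole_form A (T, d T) s = (\<Sum>i\<in>T. (s + nat_vec a) $ i) - of_nat (level ?S k UNIV T)"
        by (simp add: pole_form_def algebra_simps)
      then have "(\<Prod>T\<in>?L. \<Prod>l\<in>{d T..<N}. pole_form A (T, l) s) * shintani_integral A k q (s + nat_vec a) =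
          Q s * (((\<Sum>i\<in>T. (s + nat_vec a) $ i) - of_nat (level ?S k UNIV T)) * shintani_integral A k q (s + nat_vec a))"
        unfolding split by simp
      also have "\<dots> = (\<Sum>j | \<not> ?S j \<subseteq> T. \<Sum>i\<in>T \<inter> ?S j. of_nat (k j) * of_real (A $ i $ j) *
        (Q s * shintani_integral A (k(j := Suc (k j))) q (s + nat_vec (a(i := Suc (a i)))))) +
      (- 1) * (\<Sum>j\<in>UNIV. \<Sum>i\<in>T \<inter> ?S j. of_real (A $ i $ j) *
        (Q s * shintani_integral A k (q(j := Suc (q j))) (s + nat_vec (a(i := Suc (a i))))))"
        unfolding rec right_diff_distrib sum_distrib_left by (simp add: mult.left_commute mult.assoc sum_negf)
      finally show "(\<Sum>j | \<not> ?S j \<subseteq> T. \<Sum>i\<in>T \<inter> ?S j. of_nat (k j) * of_real (A $ i $ j) *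
        (Q s * shintani_integral A (k(j := Suc (k j))) q (s + nat_vec (a(i := Suc (a i)))))) +
      (- 1) * (\<Sum>j\<in>UNIV. \<Sum>i\<in>T \<inter> ?S j. of_real (A $ i $ j) *
        (Q s * shintani_integral A k (q(j := Suc (q j))) (s + nat_vec (a(i := Suc (a i)))))) =
        (\<Prod>T\<in>?L. \<Prod>l\<in>{d T..<N}. pole_form A (T, l) s) * shintani_integral A k q (s + nat_vec a)" by simp
    qed
  qed
qed


section \<open>Cancellation of poles by the Gamma factors\<close>

definition pole_index :: "real ^ 'r ^ 'n \<Rightarrow> nat \<Rightarrow> ('n set \<times> nat) set" where
  "pole_index A N = {(T, l). T \<in> linked_set A \<and> l < N \<and>
     ((\<exists>i. T = {i}) \<longrightarrow> l < level (column_support A) (\<lambda>_. 1) UNIV T)}"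

lemma pole_index_subset: "pole_index A N \<subseteq> linked_set A \<times> {0..<N}"
  by (auto simp: pole_index_def)

lemma finite_pole_index: "finite (pole_index A N)"
  by (rule finite_subset[OF pole_index_subset]) auto

text \<open>The zeros of \<open>1/\<Gamma>\<close> cancel the poles \<open>s\<^sub>i = \<nu> - l\<close> with \<open>l \<ge> \<nu>\<close> that come from a singleton.\<close>

lemma rGamma_cancels_poles:
  fixes A :: "real ^ 'r ^ 'n" and s :: "complex ^ 'n"
  defines "\<nu> \<equiv> \<lambda>i. level (column_support A) (\<lambda>_. 1) UNIV {i}"
  shows "(\<Prod>i\<in>UNIV. rGamma (s $ i + of_nat (N - \<nu> i))) * (\<Prod>T\<in>linked_set A. \<Prod>l\<in>{0..<N}. pole_form A (T, l) s) =
    (\<Prod>p\<in>pole_index A N. pole_form A p s) * (\<Prod>i\<in>UNIV. rGamma (s $ i))"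
proof -
  define D where "D = (SIGMA i:UNIV. {\<nu> i..<N})"
  have "(linked_set A \<times> {0..<N}) - pole_index A N = (\<lambda>(i, l). ({i}, l)) ` D"
    by (auto simp: pole_index_def D_def linked_set_def \<nu>_def not_less image_iff)
  moreover have "inj_on (\<lambda>(i, l). ({i}, l)) D" by (auto simp: inj_on_def)
  ultimately have "(\<Prod>p\<in>(linked_set A \<times> {0..<N}) - pole_index A N. pole_form A p s) = (\<Prod>(i, l)\<in>D. pole_form A ({i}, l) s)"
    by (simp add: prod.reindex case_prod_unfold)
  also have "\<dots> = (\<Prod>i\<in>UNIV. \<Prod>l\<in>{\<nu> i..<N}. pole_form A ({i}, l) s)"
    unfolding D_def by (subst prod.Sigma) auto
  \<comment> \<open>For \<open>T = {i}\<close> the forms with \<open>\<nu> i \<le> l\<close> are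
    \<open>s $ i\<close>, \<open>s $ i + 1\<close> and so on, the factors between
    \<open>rGamma (s $ i)\<close> and its shifted value. If \<open>N < \<nu> i\<close>, the product
    is empty and the truncated difference is 0.\<close>
  also have "\<dots> = (\<Prod>i\<in>UNIV. pochhammer (s $ i) (N - \<nu> i))"
  proof (intro prod.cong refl)
    fix i
    have "(\<Prod>l\<in>{\<nu> i..<N}. pole_form A ({i}, l) s) = (\<Prod>l\<in>{\<nu> i..<N}. s $ i + of_nat (l - \<nu> i))"
      by (intro prod.cong) (auto simp: pole_form_def \<nu>_def of_nat_diff)
    also have "\<dots> = (\<Prod>m\<in>{0..<N - \<nu> i}. s $ i + of_nat m)"
      by (rule prod.reindex_bij_witness[of _ "\<lambda>m. m + \<nu> i" "\<lambda>l. l - \<nu> i"]) auto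
    finally show "(\<Prod>l\<in>{\<nu> i..<N}. pole_form A ({i}, l) s) = pochhammer (s $ i) (N - \<nu> i)"
      by (simp add: pochhammer_prod)
  qed
  finally have D: "(\<Prod>p\<in>(linked_set A \<times> {0..<N}) - pole_index A N. pole_form A p s) =
      (\<Prod>i\<in>UNIV. pochhammer (s $ i) (N - \<nu> i))" .
  have "(\<Prod>T\<in>linked_set A. \<Prod>l\<in>{0..<N}. pole_form A (T, l) s) = (\<Prod>p\<in>linked_set A \<times> {0..<N}. pole_form A p s)"
    by (simp add: prod.cartesian_product case_prod_unfold)
  also have "\<dots> = (\<Prod>p\<in>(linked_set A \<times> {0..<N}) - pole_index A N. pole_form A p s) * (\<Prod>p\<in>pole_index A N. pole_form A p s)"
    by (rule prod.subset_diff[OF pole_index_subset]) simp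
  finally have "(\<Prod>T\<in>linked_set A. \<Prod>l\<in>{0..<N}. pole_form A (T, l) s) =
      (\<Prod>i\<in>UNIV. pochhammer (s $ i) (N - \<nu> i)) * (\<Prod>p\<in>pole_index A N. pole_form A p s)" unfolding D .
  moreover have "(\<Prod>i\<in>UNIV. rGamma (s $ i)) =
      (\<Prod>i\<in>UNIV. pochhammer (s $ i) (N - \<nu> i)) * (\<Prod>i\<in>UNIV. rGamma (s $ i + of_nat (N - \<nu> i)))"
    unfolding prod.distrib[symmetric] by (intro prod.cong refl pochhammer_rGamma)
  ultimately show ?thesis by (simp add: mult.commute mult.left_commute)
qed

text \<open>The unshifted case of \<open>continuation_shifted\<close>, multiplied by the shifted
  reciprocal Gamma factors, which are entire.\<close>

lemma continuation:
  fixes A :: "real ^ 'r ^ 'n"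
  assumes A: "A \<in> Sigma_mat"
  shows "extends_to A N (\<lambda>s. (\<Prod>p\<in>pole_index A N. pole_form A p s) *
    ((\<Prod>i\<in>UNIV. rGamma (s $ i)) * shintani_integral A (\<lambda>_. 1) (\<lambda>_. 0) s))"
proof -
  let ?\<nu> = "\<lambda>i. level (column_support A) (\<lambda>_. 1) UNIV {i}"
  have "extends_to A N (\<lambda>s. (\<Prod>T\<in>linked_set A. \<Prod>l\<in>{0..<N}. pole_form A (T, l) s) *
      shintani_integral A (\<lambda>_. 1) (\<lambda>_. 0) (s + nat_vec (\<lambda>_. 0)))"
    by (rule continuation_shifted[OF A, where d = "\<lambda>_. 0"]) simp
  then have e1: "extends_to A N (\<lambda>s. (\<Prod>T\<in>linked_set A. \<Prod>l\<in>{0..<N}. pole_form A (T, l) s) *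
      shintani_integral A (\<lambda>_. 1) (\<lambda>_. 0) s)"
    by (rule extends_to_cong) (simp add: nat_vec_def zero_vec_def[symmetric])
  have e2: "extends_to A N (\<lambda>s. \<Prod>i\<in>UNIV. rGamma (s $ i + of_nat (N - ?\<nu> i)))"
    by (intro extends_to_entire cdifferentiable_prod cdifferentiable_compose[where g = rGamma]
        cdifferentiable_add cdifferentiable_nth cdifferentiable_const field_differentiable_rGamma)
  show ?thesis
  proof (rule extends_to_cong[OF extends_to_mult[OF e2 e1]])
    fix s
    show "(\<Prod>i\<in>UNIV. rGamma (s $ i + of_nat (N - ?\<nu> i))) * ((\<Prod>T\<in>linked_set A. \<Prod>l\<in>{0..<N}. pole_form A (T, l) s) *
        shintani_integral A (\<lambda>_. 1) (\<lambda>_. 0) s) =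
      (\<Prod>p\<in>pole_index A N. pole_form A p s) * ((\<Prod>i\<in>UNIV. rGamma (s $ i)) * shintani_integral A (\<lambda>_. 1) (\<lambda>_. 0) s)"
      unfolding mult.assoc[symmetric] rGamma_cancels_poles ..
  qed
qed

section \<open>The Mellin representation of the zeta function\<close>

lemma integrable_exp_abs:
  assumes "0 < (c::real)"
  shows "integrable lborel (\<lambda>t::real. exp (- c * \<bar>t\<bar>))"
  using nn_integral_exp_abs[OF assms] by (intro integrableI_bounded) auto

lemma integrable_mellin_exp:
  fixes z :: complex and c :: real
  assumes z: "0 < Re z" and c: "0 < c"
  shows "integrable lborel (\<lambda>t. exp (z * complex_of_real t - complex_of_real (c * exp t)))"
proof -
  \<comment> \<open>The factor 2 leaves a spare \<open>- Re z * t\<close>, the decay for positive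
    \<open>t\<close>; for negative \<open>t\<close> the decay is that of
    \<open>exp (Re z * t)\<close> itself.\<close>
  obtain K where K: "\<And>t. 0 \<le> t \<Longrightarrow> 2 * Re z * t - c * exp t \<le> K"
    using linear_minus_exp_bounded[OF c] by blast
  show ?thesis
  proof (rule Bochner_Integration.integrable_bound)
    show "integrable lborel (\<lambda>t. exp \<bar>K\<bar> * exp (- Re z * \<bar>t\<bar>))"
      by (intro integrable_mult_right integrable_exp_abs z)
    have "Re z * t - c * exp t \<le> \<bar>K\<bar> + - Re z * \<bar>t\<bar>" for t
    proof (cases "0 \<le> t")
      case True
      then show ?thesis using K[OF True] abs_ge_self[of K] by (simp add: algebra_simps)
    next
      case False
      moreover have "0 < c * exp t" using c by simp
      ultimately show ?thesis by simp
    qed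
    then show "AE t in lborel. norm (exp (z * complex_of_real t - complex_of_real (c * exp t))) \<le>
        norm (exp \<bar>K\<bar> * exp (- Re z * \<bar>t\<bar>))"
      by (simp add: exp_add[symmetric])
  qed measurable
qed

text \<open>The substitution \<open>u = c * exp t\<close> in Euler's integral for
  \<open>Gamma z\<close>; the scaling by \<open>c\<close> produces the power.\<close>

lemma integral_mellin_exp:
  fixes z :: complex and c :: real
  assumes z: "0 < Re z" and c: "0 < c"
  shows "(\<integral>t. exp (z * complex_of_real t - complex_of_real (c * exp t)) \<partial>lborel) =
    Gamma z * complex_of_real c powr (- z)"
proof -
  define f where "f = (\<lambda>u. complex_of_real u powr (z - 1) / complex_of_real (exp u))"
  define g where "g = (\<lambda>t. c * exp t)"
  have g0: "0 < g t" for t using c by (simp add: g_def)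
  have gf: "g t *\<^sub>R f (g t) = complex_of_real c powr z * exp (z * complex_of_real t - complex_of_real (c * exp t))" for t
  proof -
    have "complex_of_real (g t) * complex_of_real (g t) powr (z - 1) = complex_of_real (g t) powr z"
      using g0[of t] by (simp add: powr_diff)
    also have "\<dots> = complex_of_real c powr z * complex_of_real (exp t) powr z"
      unfolding g_def using c by (simp add: powr_times_real)
    also have "complex_of_real (exp t) powr z = exp (z * complex_of_real t)"
      by (simp add: powr_def Ln_of_real)
    finally have "complex_of_real (g t) * complex_of_real (g t) powr (z - 1) = complex_of_real c powr z * exp (z * complex_of_real t)" .
    then show ?thesis
      unfolding f_def scaleR_conv_of_real exp_diff exp_of_real g_def by (simp only: times_divide_eq_right)
  qed
  have f_meas [measurable]: "f \<in> borel_measurable borel" unfolding f_def by measurable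
  have abs: "f absolutely_integrable_on {0<..}"
    unfolding f_def by (rule absolutely_integrable_Gamma_integral'[OF z])
  have set_int: "set_integrable lborel {0<..} f"
    using abs unfolding set_integrable_def by (subst (asm) integrable_completion) auto
  have "Gamma z = integral {0<..} f"
    unfolding f_def using Gamma_integral_complex'[OF z] by (rule integral_unique[symmetric])
  also have "\<dots> = (LINT u:{0<..}|lborel. f u)"
    by (rule set_borel_integral_eq_integral(2)[OF set_int, symmetric])
  also have "\<dots> = (LBINT u=ereal 0..\<infinity>. f u)"
    by (simp add: interval_lebesgue_integral_def einterval_def greaterThan_def)
  also have "\<dots> = (LBINT t=-\<infinity>..\<infinity>. g t *\<^sub>R f (g t))"
  proof (rule interval_integral_substitution_integrable)
    show "(g has_real_derivative g t) (at t)" for t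
      unfolding g_def by (auto intro!: derivative_eq_intros)
    show "isCont f (g t)" for t
      unfolding f_def using g0[of t]
      by (intro continuous_intros) (auto simp: complex_nonpos_Reals_iff)
    show "isCont g t" for t unfolding g_def by (intro continuous_intros)
    show "((ereal \<circ> g \<circ> real_of_ereal) \<longlongrightarrow> ereal 0) (at_right (- \<infinity>))"
      unfolding ereal_tendsto_simps g_def
      using tendsto_mult[OF tendsto_const[of c] exp_at_bot] by simp
    show "((ereal \<circ> g \<circ> real_of_ereal) \<longlongrightarrow> \<infinity>) (at_left \<infinity>)"
      unfolding ereal_tendsto_simps g_def
      by (rule filterlim_tendsto_pos_mult_at_top[OF tendsto_const c exp_at_top])
    show "set_integrable lborel (einterval (- \<infinity>) \<infinity>) (\<lambda>t. g t *\<^sub>R f (g t))"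
      unfolding gf using integrable_mellin_exp[OF z c] by (simp add: set_integrable_def einterval_def)
    show "set_integrable lborel (einterval (ereal 0) \<infinity>) f"
      using set_int by (simp add: einterval_def greaterThan_def)
  qed (auto simp: less_imp_le g0)
  also have "\<dots> = complex_of_real c powr z * (\<integral>t. exp (z * complex_of_real t - complex_of_real (c * exp t)) \<partial>lborel)"
    unfolding gf by (simp add: interval_lebesgue_integral_def einterval_def set_lebesgue_integral_def)
  finally show ?thesis
    using c by (simp add: powr_minus field_simps)
qed

lemma lborel_integral_prod_cart:
  fixes f :: "'n::finite \<Rightarrow> real \<Rightarrow> complex"
  assumes f: "\<And>i. integrable lborel (f i)"
  shows "(\<integral>x. (\<Prod>i\<in>UNIV. f i (x $ i)) \<partial>(lborel :: (real ^ 'n) measure)) = (\<Prod>i\<in>UNIV. \<integral>t. f i t \<partial>lborel)"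
proof -
  let ?a = "\<lambda>i. axis i 1 :: real ^ 'n"
  define F where "F = (\<lambda>b. f (inv ?a b))"
  have Fa: "F (?a i) = f i" for i unfolding F_def by (simp add: inv_f_f[OF inj_axis_one])
  have [measurable]: "f i \<in> borel_measurable borel" for i using f[of i] by simp
  have [measurable]: "F b \<in> borel_measurable borel" for b unfolding F_def by simp
  interpret product_sigma_finite "\<lambda>_ :: real ^ 'n. lborel :: real measure" ..
  have prodB: "(\<Prod>i\<in>UNIV. h (?a i)) = (\<Prod>b\<in>Basis. h b)" for h :: "real ^ 'n \<Rightarrow> complex"
    unfolding Basis_vec_real by (subst prod.reindex[OF inj_axis_one]) simp
  have "(\<integral>x. (\<Prod>i\<in>UNIV. f i (x $ i)) \<partial>(lborel :: (real ^ 'n) measure)) =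
      (\<integral>x. (\<Prod>b\<in>Basis. F b (x \<bullet> b)) \<partial>(lborel :: (real ^ 'n) measure))"
    unfolding prodB[symmetric] Fa by (simp add: inner_axis)
  also have "\<dots> = (\<integral>y. (\<Prod>b\<in>Basis. F b ((\<Sum>b\<in>Basis. y b *\<^sub>R b) \<bullet> b)) \<partial>(\<Pi>\<^sub>M b\<in>(Basis :: (real ^ 'n) set). lborel))"
    by (subst lborel_eq) (rule integral_distr, auto)
  also have "\<dots> = (\<integral>y. (\<Prod>b\<in>Basis. F b (y b)) \<partial>(\<Pi>\<^sub>M b\<in>(Basis :: (real ^ 'n) set). lborel))"
    by (intro Bochner_Integration.integral_cong prod.cong) (auto simp: inner_sum_left inner_Basis if_distrib cong: if_cong)
  also have "\<dots> = (\<Prod>b\<in>Basis. \<integral>t. F b t \<partial>lborel)"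
    by (intro product_integral_prod) (auto simp: F_def f)
  finally show ?thesis unfolding prodB[symmetric] Fa .
qed

definition pos_indices :: "('r \<Rightarrow> nat) set" where
  "pos_indices = {m. \<forall>j. 1 \<le> m j}"

text \<open>Stated over the counting measure so that Fubini can later exchange the sum over
  \<open>m\<close> with the integral over \<open>x\<close>.\<close>

lemma geometric_sum_pos:
  assumes "0 < (y::real)"
  shows "integrable (count_space {1..}) (\<lambda>n::nat. exp (- (real n * y)))"
    and "(\<integral>n. exp (- (real n * y)) \<partial>count_space {1..}) = 1 / (exp y - 1)"
proof -
  have r: "norm (exp (- y)) < 1" using assms by simp
  have eq: "exp (- (real (Suc n) * y)) = exp (- y) * exp (- y) ^ n" for n
    by (simp add: exp_of_nat_mult[symmetric] exp_add[symmetric] algebra_simps)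
  have img: "{1..} = range Suc" by (auto simp: image_iff Suc_le_eq gr0_conv_Suc)
  have "summable (\<lambda>n. norm (exp (- (real (Suc n) * y))))"
    unfolding eq using r by (simp add: summable_geometric summable_mult)
  then have sm: "Infinite_Set_Sum.abs_summable_on (\<lambda>n. exp (- (real (Suc n) * y))) (UNIV)"
    unfolding abs_summable_on_nat_iff' .
  then have "Infinite_Set_Sum.abs_summable_on (\<lambda>n. exp (- (real n * y))) (range Suc)"
    by (subst abs_summable_on_reindex_iff[symmetric]) auto
  then show "integrable (count_space {1..}) (\<lambda>n::nat. exp (- (real n * y)))"
    unfolding img abs_summable_on_def .
  have "infsetsum (\<lambda>n. exp (- (real n * y))) (range Suc) = infsetsum (\<lambda>n. exp (- (real (Suc n) * y))) UNIV"
    by (rule infsetsum_reindex) simp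
  also have "\<dots> = suminf (\<lambda>n. exp (- (real (Suc n) * y)))" by (rule infsetsum_nat'[OF sm])
  also have "\<dots> = exp (- y) * (1 / (1 - exp (- y)))"
    unfolding eq using r by (simp add: suminf_mult summable_geometric suminf_geometric)
  also have "\<dots> = 1 / (exp y - 1)"
    using assms by (simp add: exp_minus field_simps)
  finally show "(\<integral>n. exp (- (real n * y)) \<partial>count_space {1..}) = 1 / (exp y - 1)"
    unfolding img infsetsum_def .
qed

lemma product_geometric_sum_pos:
  fixes L :: "'r::finite \<Rightarrow> real"
  assumes L: "\<And>j. 0 < L j"
  shows "integrable (count_space pos_indices) (\<lambda>m. \<Prod>j\<in>UNIV. exp (- (real (m j) * L j)))"
    and "(\<integral>m. (\<Prod>j\<in>UNIV. exp (- (real (m j) * L j))) \<partial>count_space pos_indices) = (\<Prod>j\<in>UNIV. 1 / (exp (L j) - 1))"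
proof -
  have pos: "pos_indices = PiE UNIV (\<lambda>_ :: 'r. {1 :: nat..})" by (auto simp: pos_indices_def PiE_UNIV_domain)
  have s: "Infinite_Set_Sum.abs_summable_on (\<lambda>n. exp (- (real n * L j))) ({1..})" for j
    unfolding abs_summable_on_def by (rule geometric_sum_pos(1)[OF L])
  have "Infinite_Set_Sum.abs_summable_on (\<lambda>m. \<Prod>j\<in>UNIV. exp (- (real (m j) * L j))) (PiE UNIV (\<lambda>_ :: 'r. {1 :: nat..}))"
    by (intro abs_summable_on_prod_PiE[where f = "\<lambda>j n. exp (- (real n * L j))"] s) auto
  then show "integrable (count_space pos_indices) (\<lambda>m. \<Prod>j\<in>UNIV. exp (- (real (m j) * L j)))"
    unfolding pos abs_summable_on_def .
  have "infsetsum (\<lambda>m. \<Prod>j\<in>UNIV. exp (- (real (m j) * L j))) (PiE UNIV (\<lambda>_ :: 'r. {1 :: nat..})) =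
      (\<Prod>j\<in>UNIV. infsetsum (\<lambda>n. exp (- (real n * L j))) {1..})"
    by (intro infsetsum_prod_PiE[where f = "\<lambda>j n. exp (- (real n * L j))"] s) auto
  then show "(\<integral>m. (\<Prod>j\<in>UNIV. exp (- (real (m j) * L j))) \<partial>count_space pos_indices) = (\<Prod>j\<in>UNIV. 1 / (exp (L j) - 1))"
    unfolding pos infsetsum_def geometric_sum_pos(2)[OF L] .
qed


lemma todd_kernel_1_0: "0 < y \<Longrightarrow> todd_kernel 1 0 y = complex_of_real (1 / (exp y - 1))"
  by (simp add: todd_kernel_def todd_deriv_def todd_def exp_of_real)

text \<open>For fixed \<open>m\<close> the integral over \<open>x\<close> splits into Euler
  integrals and gives one term of the series times the Gamma values; for fixed \<open>x\<close> the
  sum over \<open>m\<close> is a product of geometric series and gives the kernel. Integrability of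
  the kernel justifies the exchange and yields the absolute convergence of the series.\<close>

lemma mellin_representation:
  fixes A :: "real ^ 'r ^ 'n" and s :: "complex ^ 'n"
  assumes A: "A \<in> Sigma_mat" and s: "s \<in> tube A 0"
  shows "s \<in> shintani_domain A"
    and "shintani_zeta A s = (\<Prod>i\<in>UNIV. rGamma (s $ i)) * shintani_integral A (\<lambda>_. 1) (\<lambda>_. 0) s"
proof -
  let ?M = "count_space (pos_indices :: ('r \<Rightarrow> nat) set)" and ?K = "kern A (\<lambda>_. 1) (\<lambda>_. 0)"
  \<comment> \<open>Singletons are linked, and their levels are nonnegative.\<close>
  have Re_pos: "0 < Re (s $ i)" for i
  proof -
    have "real (level (column_support A) (\<lambda>_. 1) UNIV {i}) < (\<Sum>i\<in>{i}. Re (s $ i)) + real 0"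
      using s linked_singleton[of "column_support A" UNIV i] unfolding tube_def by blast
    then show ?thesis by (auto intro: le_less_trans[OF of_nat_0_le_iff])
  qed
  have dom: "re_vec s \<in> conv_domain A (\<lambda>_. 1)"
    using s by (simp add: tube_def conv_domain_def)
  define row where "row = (\<lambda>i m. \<Sum>j\<in>UNIV. A $ i $ j * real (m j))"
  define P where "P = (\<lambda>x m. \<Prod>j\<in>UNIV. exp (- (real (m j) * col_form A j x)))"
  define W where "W = (\<lambda>x m. exp (cpair s x) * complex_of_real (P x m))"
  have P0: "0 \<le> P x m" for x m unfolding P_def by (intro prod_nonneg) simp
  have [measurable]: "(\<lambda>x. W x m) \<in> borel_measurable borel" for m
    unfolding W_def P_def by measurable
  have row_pos: "0 < row i m" if "m \<in> pos_indices" for i m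
  proof -
    have "\<exists>j. 0 < A $ i $ j" using A unfolding Sigma_mat_def by blast
    then obtain j where j: "0 < A $ i $ j" ..
    have m: "0 < m j" for j using that[unfolded pos_indices_def, simplified, rule_format, of j] by simp
    show ?thesis unfolding row_def
    proof (rule sum_pos2)
      show "0 < A $ i $ j * real (m j)" using j m by simp
      show "0 \<le> A $ i $ j * real (m j)" for j using A by (simp add: Sigma_mat_def)
    qed auto
  qed
  \<comment> \<open>Exchanging the double sum over columns and rows separates the coordinates of
    \<open>x\<close>.\<close>
  have W_prod: "W x m = (\<Prod>i\<in>UNIV. exp (s $ i * complex_of_real (x $ i) - complex_of_real (row i m * exp (x $ i))))" for x m
  proof -
    have "(\<Sum>j\<in>UNIV. real (m j) * col_form A j x) = (\<Sum>j\<in>UNIV. \<Sum>i\<in>UNIV. A $ i $ j * real (m j) * exp (x $ i))"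
      unfolding col_form_def sum_distrib_left by (intro sum.cong refl) (simp only: ac_simps)
    also have "\<dots> = (\<Sum>i\<in>UNIV. row i m * exp (x $ i))"
      unfolding row_def sum_distrib_right by (rule sum.swap)
    finally have "P x m = exp (- (\<Sum>i\<in>UNIV. row i m * exp (x $ i)))"
      unfolding P_def by (simp add: exp_sum[symmetric] sum_negf)
    then have "W x m = exp (cpair s x - complex_of_real (\<Sum>i\<in>UNIV. row i m * exp (x $ i)))"
      by (simp add: W_def exp_diff exp_minus exp_of_real divide_inverse del: of_real_sum)
    also have "cpair s x - complex_of_real (\<Sum>i\<in>UNIV. row i m * exp (x $ i)) =
        (\<Sum>i\<in>UNIV. s $ i * complex_of_real (x $ i) - complex_of_real (row i m * exp (x $ i)))"
      by (simp add: cpair_def sum_subtractf)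
    finally show ?thesis by (simp add: exp_sum)
  qed
  have int_x: "(\<integral>x. W x m \<partial>lborel) = (\<Prod>i\<in>UNIV. Gamma (s $ i)) * shintani_term A s m" if "m \<in> pos_indices" for m
  proof -
    have "(\<integral>x. W x m \<partial>lborel) = (\<Prod>i\<in>UNIV. \<integral>t. exp (s $ i * complex_of_real t - complex_of_real (row i m * exp t)) \<partial>lborel)"
      unfolding W_prod
      by (rule lborel_integral_prod_cart[where f = "\<lambda>i t. exp (s $ i * complex_of_real t - complex_of_real (row i m * exp t))"])
         (intro integrable_mellin_exp Re_pos row_pos that)
    also have "\<dots> = (\<Prod>i\<in>UNIV. Gamma (s $ i) * complex_of_real (row i m) powr (- (s $ i)))"
      by (intro prod.cong refl integral_mellin_exp Re_pos row_pos that)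
    finally show ?thesis by (simp add: prod.distrib shintani_term_def row_def)
  qed
  have L: "0 < col_form A j x" for j x by (rule col_form_pos[OF A])
  have kern_eq: "?K x = complex_of_real (\<Prod>j\<in>UNIV. 1 / (exp (col_form A j x) - 1))" for x
    unfolding kern_def of_real_prod by (intro prod.cong refl todd_kernel_1_0 L)
  have intP: "integrable ?M (P x)" and valP: "(\<integral>m. P x m \<partial>?M) = (\<Prod>j\<in>UNIV. 1 / (exp (col_form A j x) - 1))" for x
    unfolding P_def[abs_def] by (rule product_geometric_sum_pos[OF L])+
  have int_m: "integrable ?M (W x)" for x
    unfolding W_def by (intro integrable_mult_right integrable_of_real intP)
  have val_m: "(\<integral>m. W x m \<partial>?M) = exp (cpair s x) * ?K x" for x
    unfolding W_def kern_eq valP[symmetric] by simp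
  \<comment> \<open>The factors \<open>P x m\<close> are nonnegative, so the sum of the norms is the
    norm of the sum, and the integrability of the kernel carries over.\<close>
  have val_n: "(\<integral>m. norm (W x m) \<partial>?M) = norm (exp (cpair s x) * ?K x)" for x
  proof -
    have "(\<integral>m. norm (W x m) \<partial>?M) = exp (re_vec s \<bullet> x) * (\<integral>m. P x m \<partial>?M)"
      using P0 by (simp add: W_def norm_mult Re_cpair)
    moreover have "norm (?K x) = (\<integral>m. P x m \<partial>?M)"
      unfolding kern_eq valP[symmetric] norm_of_real using P0 by (intro abs_of_nonneg integral_nonneg_AE) auto
    ultimately show ?thesis by (simp add: norm_mult Re_cpair)
  qed
  have "countable (UNIV :: ('r \<Rightarrow> nat) set)" by (rule countableI_type)
  then have cnt: "countable (pos_indices :: ('r \<Rightarrow> nat) set)" by (rule countable_subset[OF subset_UNIV])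
  interpret C: sigma_finite_measure ?M by (rule sigma_finite_measure_count_space_countable[OF cnt])
  interpret PS: pair_sigma_finite "lborel :: (real ^ 'n) measure" ?M ..
  have "(\<lambda>(m, x). W x m) \<in> borel_measurable (?M \<Otimes>\<^sub>M (lborel :: (real ^ 'n) measure))"
    by (rule measurable_pair_measure_countable1[OF cnt]) simp
  from measurable_pair_swap[OF this]
  have meas: "(\<lambda>(x, m). W x m) \<in> borel_measurable ((lborel :: (real ^ 'n) measure) \<Otimes>\<^sub>M ?M)" by simp
  have int_prod: "integrable (lborel \<Otimes>\<^sub>M ?M) (\<lambda>(x, m). W x m)"
  proof (rule PS.Fubini_integrable[OF meas])
    show "integrable lborel (\<lambda>x. \<integral>m. norm (case (x, m) of (x, m) \<Rightarrow> W x m) \<partial>?M)"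
      unfolding prod.case val_n by (intro integrable_norm integrable_kern A dom)
    show "AE x in lborel. integrable ?M (\<lambda>m. case (x, m) of (x, m) \<Rightarrow> W x m)"
      by (simp add: int_m)
  qed
  define G where "G = (\<Prod>i\<in>UNIV. Gamma (s $ i))"
  have G: "G \<noteq> 0" "inverse G = (\<Prod>i\<in>UNIV. rGamma (s $ i))"
  proof -
    have "s $ i \<notin> \<int>\<^sub>\<le>\<^sub>0" for i using Re_pos[of i] by (auto elim!: nonpos_Ints_cases)
    then show "G \<noteq> 0" by (simp add: G_def Gamma_eq_zero_iff)
    show "inverse G = (\<Prod>i\<in>UNIV. rGamma (s $ i))"
      by (simp add: G_def prod_inversef[symmetric] rGamma_inverse_Gamma o_def)
  qed
  have "integrable ?M (\<lambda>m. \<integral>x. W x m \<partial>lborel)"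
    using PS.integrable_snd[of W] int_prod by simp
  then have "integrable ?M (\<lambda>m. G * shintani_term A s m)"
    by (subst (asm) Bochner_Integration.integrable_cong[OF refl]) (auto simp: int_x G_def)
  then have "integrable ?M (\<lambda>m. inverse G * (G * shintani_term A s m))" by (rule integrable_mult_right)
  then have int_term: "integrable ?M (shintani_term A s)" using G(1) by (simp add: mult.assoc[symmetric])
  then have abs: "Infinite_Set_Sum.abs_summable_on (shintani_term A s) pos_indices" by (simp add: abs_summable_on_def)
  then show "s \<in> shintani_domain A"
    unfolding shintani_domain_def pos_indices_def[symmetric] abs_summable_equivalent[symmetric] by simp
  have "shintani_zeta A s = (\<integral>m. shintani_term A s m \<partial>?M)"
    unfolding shintani_zeta_def pos_indices_def[symmetric] infsetsum_infsum[OF abs, symmetric] infsetsum_def ..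
  also have "\<dots> = inverse G * (\<integral>m. G * shintani_term A s m \<partial>?M)" using G(1) by simp
  also have "(\<integral>m. G * shintani_term A s m \<partial>?M) = (\<integral>m. (\<integral>x. W x m \<partial>lborel) \<partial>?M)"
    by (intro Bochner_Integration.integral_cong) (auto simp: int_x G_def)
  also have "\<dots> = (\<integral>x. (\<integral>m. W x m \<partial>?M) \<partial>lborel)"
    by (rule PS.Fubini_integral) (use int_prod in simp)
  also have "\<dots> = shintani_integral A (\<lambda>_. 1) (\<lambda>_. 0) s"
    unfolding val_m shintani_integral_def ..
  finally show "shintani_zeta A s = (\<Prod>i\<in>UNIV. rGamma (s $ i)) * shintani_integral A (\<lambda>_. 1) (\<lambda>_. 0) s"
    unfolding G(2) .
qed

section \<open>Gluing the continuations\<close>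

lemma holomorphic_line:
  assumes "\<And>t. t \<in> D \<Longrightarrow> cdifferentiable_at f (s + vec t)"
  shows "(\<lambda>t. f (s + vec t)) holomorphic_on D"
proof (rule holomorphic_onI)
  fix t assume "t \<in> D"
  then obtain D' where D': "(f has_derivative D') (at (s + vec t))" "\<forall>c x. D' (c *s x) = c * D' x"
    using assms unfolding cdifferentiable_at_def by blast
  have "bounded_linear (vec :: complex \<Rightarrow> complex ^ 'a)"
    unfolding linear_conv_bounded_linear[symmetric] by (rule linearI) (simp_all add: vec_eq_iff)
  then have "((\<lambda>t. s + vec t) has_derivative vec) (at t)"
    by (auto intro!: derivative_eq_intros bounded_linear_imp_has_derivative)
  from has_derivative_compose[OF this D'(1)] have der: "((\<lambda>t. f (s + vec t)) has_derivative (\<lambda>h. D' (vec h))) (at t)" .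
  have "vec h = h *s vec 1" for h :: complex by (simp add: vec_eq_iff)
  then have "D' (vec h) = D' (vec 1) * h" for h using D'(2) by (metis mult.commute)
  then have "((\<lambda>t. f (s + vec t)) has_field_derivative D' (vec 1)) (at t)"
    using der unfolding has_field_derivative_def by (simp add: fun_eq_iff)
  then show "(\<lambda>t. f (s + vec t)) field_differentiable at t within D"
    unfolding field_differentiable_def by (blast intro: has_field_derivative_at_within)
qed

text \<open>The pairing of (1, ..., 1) with \<open>T\<close> is \<open>card T\<close>, which is
  positive, so a line in this direction meets each tube in a right half-plane.\<close>

lemma tube_line:
  "s + vec t \<in> tube A N \<longleftrightarrow> (\<forall>T\<in>linked_set A.
    (real (level (column_support A) (\<lambda>_. 1) UNIV T) - real N - (\<Sum>i\<in>T. Re (s $ i))) / real (card T) < Re t)"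
proof -
  have "real (level (column_support A) (\<lambda>_. 1) UNIV T) < (\<Sum>i\<in>T. Re ((s + vec t) $ i)) + real N \<longleftrightarrow>
      (real (level (column_support A) (\<lambda>_. 1) UNIV T) - real N - (\<Sum>i\<in>T. Re (s $ i))) / real (card T) < Re t"
    if "T \<in> linked_set A" for T
  proof -
    have "0 < real (card T)" using that linked_nonempty by (auto simp: linked_set_def card_gt_0_iff)
    then show ?thesis by (auto simp: pos_divide_less_eq sum.distrib algebra_simps)
  qed
  then show ?thesis unfolding tube_def linked_set_def by auto
qed

lemma convex_tube_line: "convex {t. s + vec t \<in> tube A N}"
proof -
  have "{t. s + vec t \<in> tube A N} = (\<Inter>T\<in>linked_set A.
      {t. Re t > (real (level (column_support A) (\<lambda>_. 1) UNIV T) - real N - (\<Sum>i\<in>T. Re (s $ i))) / real (card T)})"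
    unfolding tube_line by auto
  then show ?thesis by (auto intro!: convex_INT convex_halfspace_Re_gt)
qed

lemma open_tube_line: "open {t. s + vec t \<in> tube A N}"
proof -
  have "{t. s + vec t \<in> tube A N} = (\<Inter>T\<in>linked_set A.
      {t. Re t > (real (level (column_support A) (\<lambda>_. 1) UNIV T) - real N - (\<Sum>i\<in>T. Re (s $ i))) / real (card T)})"
    unfolding tube_line by auto
  then show ?thesis by (auto intro!: open_INT open_halfspace_Re_gt)
qed

lemma tube_line_nonempty: "\<exists>t. 0 < Re t \<and> s + vec t \<in> tube A N"
proof -
  let ?f = "\<lambda>T. (real (level (column_support A) (\<lambda>_. 1) UNIV T) - real N - (\<Sum>i\<in>T. Re (s $ i))) / real (card T)"
  define r where "r = 1 + (\<Sum>T\<in>UNIV. \<bar>?f T\<bar>)"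
  have "?f T < r" for T
  proof -
    have "?f T \<le> \<bar>?f T\<bar>" by (rule abs_ge_self)
    also have "\<dots> \<le> (\<Sum>T\<in>UNIV. \<bar>?f T\<bar>)" by (rule member_le_sum) auto
    finally show ?thesis by (simp add: r_def)
  qed
  then have "s + vec (complex_of_real r) \<in> tube A N" unfolding tube_line by simp
  moreover have "0 < r" by (auto simp: r_def intro!: add_pos_nonneg sum_nonneg)
  ultimately show ?thesis by (intro exI[of _ "complex_of_real r"]) simp
qed

text \<open>The line through \<open>s\<close> in the direction (1, ..., 1) reaches
  \<open>tube A 0\<close>, and its part in \<open>tube A N\<close> is connected, so the identity
  theorem in one variable applies.\<close>

lemma tube_identity:
  assumes f: "\<And>s. s \<in> tube A N \<Longrightarrow> cdifferentiable_at f s"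
    and g: "\<And>s. s \<in> tube A N \<Longrightarrow> cdifferentiable_at g s"
    and eq: "\<And>s. s \<in> tube A 0 \<Longrightarrow> f s = g s" and s: "s \<in> tube A N"
  shows "f s = g s"
proof -
  have v0: "s + vec 0 = s" by (simp add: vec_eq_iff)
  have "f (s + vec 0) = g (s + vec 0)"
  proof (rule analytic_continuation_open[where s = "{t. s + vec t \<in> tube A 0}" and s' = "{t. s + vec t \<in> tube A N}"
        and f = "\<lambda>t. f (s + vec t)" and g = "\<lambda>t. g (s + vec t)"])
    show "{t. s + vec t \<in> tube A 0} \<noteq> {}" using tube_line_nonempty[of s A 0] by blast
    show "connected {t. s + vec t \<in> tube A N}" by (intro convex_connected convex_tube_line)
    show "{t. s + vec t \<in> tube A 0} \<subseteq> {t. s + vec t \<in> tube A N}" using tube_mono[of 0 N A] by auto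
    show "(\<lambda>t. f (s + vec t)) holomorphic_on {t. s + vec t \<in> tube A N}" by (intro holomorphic_line f) simp
    show "(\<lambda>t. g (s + vec t)) holomorphic_on {t. s + vec t \<in> tube A N}" by (intro holomorphic_line g) simp
    show "open {t. s + vec t \<in> tube A 0}" "open {t. s + vec t \<in> tube A N}" by (rule open_tube_line)+
    show "0 \<in> {t. s + vec t \<in> tube A N}" using s unfolding mem_Collect_eq v0 .
  qed (use eq in simp)
  then show ?thesis unfolding v0 .
qed

text \<open>Along the line \<open>s + vec t\<close> the series is, up to an exponential factor, a Dirichlet series
  with nonnegative frequencies. This reaches points of absolute convergence outside \<open>tube A 0\<close>.\<close>

lemma shintani_zeta_line:
  fixes A :: "real ^ 'r ^ 'n" and s :: "complex ^ 'n"
  assumes A: "A \<in> Sigma_mat" and s: "s \<in> shintani_domain A"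
  shows "continuous_on {t. 0 \<le> Re t} (\<lambda>t. shintani_zeta A (s + vec t))"
    and "(\<lambda>t. shintani_zeta A (s + vec t)) holomorphic_on {t. 0 < Re t}"
proof -
  obtain c where c: "0 < c" and cA: "\<And>i j. 0 < A $ i $ j \<Longrightarrow> c \<le> A $ i $ j"
    using min_positive_entry by blast
  let ?M = "pos_indices :: ('r \<Rightarrow> nat) set" and ?Y = "{t :: complex. 0 \<le> Re t}"
  define row where "row = (\<lambda>i m. \<Sum>j\<in>UNIV. A $ i $ j * real (m j))"
  have row_ge: "c \<le> row i m" if "m \<in> ?M" for i m
  proof -
    have "\<exists>j. 0 < A $ i $ j" using A unfolding Sigma_mat_def by blast
    then obtain j where j: "0 < A $ i $ j" ..
    have "1 \<le> real (m j)" using that by (simp add: pos_indices_def)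
    then have "c * 1 \<le> A $ i $ j * real (m j)" using cA[OF j] c by (intro mult_mono) auto
    also have "\<dots> \<le> row i m" unfolding row_def using A by (intro member_le_sum) (auto simp: Sigma_mat_def)
    finally show ?thesis by simp
  qed
  \<comment> \<open>Every \<open>row i m\<close> is at least \<open>c\<close>; subtracting
    \<open>ln c\<close> makes the frequencies nonnegative, and \<open>b\<close> makes up for it in
    the exponential factor.\<close>
  define lam where "lam = (\<lambda>m. (\<Sum>i\<in>UNIV. ln (row i m) - ln c))"
  define b where "b = real CARD('n) * ln c"
  have lam0: "0 \<le> lam m" if "m \<in> ?M" for m
    unfolding lam_def using row_ge[OF that] c by (intro sum_nonneg) (simp add: ln_mono)
  define f where "f = (\<lambda>m t. shintani_term A s m * exp (- (t * complex_of_real (lam m))))"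
  have line_term: "shintani_term A (s + vec t) m = exp (- (t * complex_of_real b)) * f m t" if "m \<in> ?M" for m t
  proof -
    have "complex_of_real (row i m) powr (- ((s + vec t) $ i)) =
        complex_of_real (row i m) powr (- (s $ i)) * exp (- (t * complex_of_real (ln (row i m))))" for i
    proof -
      have "0 < row i m" using row_ge[OF that] c by (rule less_le_trans[rotated])
      then have "complex_of_real (row i m) powr (- t) = exp (- (t * complex_of_real (ln (row i m))))"
        by (simp add: powr_def Ln_of_real)
      moreover have "- ((s + vec t) $ i) = - (s $ i) + (- t)" by simp
      ultimately show ?thesis by (simp only: powr_add)
    qed
    moreover have "shintani_term A s' m = (\<Prod>i\<in>UNIV. complex_of_real (row i m) powr (- (s' $ i)))" for s'
      by (simp only: shintani_term_def row_def)
    ultimately have "shintani_term A (s + vec t) m = shintani_term A s m * (\<Prod>i\<in>UNIV. exp (- (t * complex_of_real (ln (row i m)))))"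
      by (simp only: prod.distrib)
    also have "(\<Prod>i\<in>UNIV. exp (- (t * complex_of_real (ln (row i m))))) = exp (- (t * complex_of_real (\<Sum>i\<in>UNIV. ln (row i m))))"
      by (simp add: exp_sum[symmetric] sum_negf sum_distrib_left)
    also have "(\<Sum>i\<in>UNIV. ln (row i m)) = b + lam m" by (simp add: lam_def b_def sum_subtractf)
    finally show ?thesis by (simp add: f_def exp_add[symmetric] distrib_left)
  qed
  define g where "g = (\<lambda>t. \<Sum>\<^sub>\<infinity>m\<in>?M. f m t)"
  have zeta: "shintani_zeta A (s + vec t) = exp (- (t * complex_of_real b)) * g t" for t
    unfolding shintani_zeta_def pos_indices_def[symmetric] g_def infsum_cmult_right'[symmetric]
    by (intro infsum_cong line_term)
  \<comment> \<open>Nonnegative frequencies make the terms at \<open>t = 0\<close> a majorant on the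
    whole closed half-plane.\<close>
  have ul: "uniform_limit ?Y (\<lambda>X t. \<Sum>m\<in>X. f m t) g (finite_subsets_at_top ?M)"
    unfolding g_def
  proof (rule Weierstrass_m_test_general)
    show "(\<lambda>m. norm (shintani_term A s m)) summable_on ?M"
      using s by (simp add: shintani_domain_def pos_indices_def)
    fix m t assume m: "m \<in> ?M" and t: "t \<in> ?Y"
    have "0 \<le> Re t * lam m" using lam0[OF m] t by simp
    then show "norm (f m t) \<le> norm (shintani_term A s m)"
      by (simp add: f_def norm_mult mult_left_le)
  qed
  have cont_f: "continuous_on S (\<lambda>t. \<Sum>m\<in>X. f m t)" for S X
    unfolding f_def by (intro continuous_intros)
  have hol_f: "(\<lambda>t. \<Sum>m\<in>X. f m t) holomorphic_on S" for S X
    unfolding f_def by (intro holomorphic_intros)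
  have nt: "finite_subsets_at_top ?M \<noteq> bot" by (rule finite_subsets_at_top_neq_bot)
  have "continuous_on ?Y g"
    by (rule uniform_limit_theorem[OF always_eventually ul nt]) (simp add: cont_f)
  then show "continuous_on ?Y (\<lambda>t. shintani_zeta A (s + vec t))"
    unfolding zeta by (intro continuous_intros)
  have "g holomorphic_on {t. 0 < Re t}"
    unfolding holomorphic_on_open[OF open_halfspace_Re_gt]
  proof (intro ballI)
    fix z :: complex assume "z \<in> {t. 0 < Re t}"
    then have z: "0 < Re z" by simp
    have sub: "cball z (Re z) \<subseteq> ?Y"
    proof
      fix t assume "t \<in> cball z (Re z)"
      then have "\<bar>Re (z - t)\<bar> \<le> Re z" using abs_Re_le_cmod[of "z - t"] by (simp add: dist_norm)
      then show "t \<in> ?Y" by simp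
    qed
    have "g holomorphic_on ball z (Re z)"
      by (rule holomorphic_uniform_limit[OF always_eventually uniform_limit_on_subset[OF ul sub] nt])
         (auto simp: cont_f hol_f)
    then show "\<exists>f'. (g has_field_derivative f') (at z)"
      using z by (auto simp: holomorphic_on_open)
  qed
  then show "(\<lambda>t. shintani_zeta A (s + vec t)) holomorphic_on {t. 0 < Re t}"
    unfolding zeta by (intro holomorphic_intros)
qed


text \<open>On the line through \<open>s\<close> both sides agree far to the right, where it lies in
  \<open>tube A 0\<close>, and hence for \<open>Re t > 0\<close>. As \<open>s\<close> may be a
  boundary point of the domain of convergence, \<open>t = 0\<close> is reached by
  continuity.\<close>

lemma continuation_agrees_on_domain:
  fixes A :: "real ^ 'r ^ 'n" and s :: "complex ^ 'n"
  assumes A: "A \<in> Sigma_mat" and s: "s \<in> shintani_domain A" "s \<in> tube A N"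
    and F: "\<And>s. s \<in> tube A N \<Longrightarrow> cdifferentiable_at F s"
    and P: "\<And>s. cdifferentiable_at P s"
    and eq: "\<And>s. s \<in> tube A 0 \<Longrightarrow> F s = P s * shintani_zeta A s"
  shows "F s = P s * shintani_zeta A s"
proof -
  let ?D = "{t. 0 < Re t} :: complex set" and ?Y = "{t. 0 \<le> Re t} :: complex set"
  have v0: "s + vec 0 = s" by (simp add: vec_eq_iff)
  have tubeY: "s + vec t \<in> tube A N" if "t \<in> ?Y" for t
  proof -
    have "s + vec 0 \<in> tube A N" using s(2) unfolding v0 .
    then show ?thesis using that unfolding tube_line by (auto intro: less_le_trans)
  qed
  define h where "h = (\<lambda>t. F (s + vec t) - P (s + vec t) * shintani_zeta A (s + vec t))"
  have holF: "(\<lambda>t. F (s + vec t)) holomorphic_on {t. s + vec t \<in> tube A N}" by (intro holomorphic_line F) simp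
  have holP: "(\<lambda>t. P (s + vec t)) holomorphic_on X" for X by (intro holomorphic_line P)
  note zeta_cont = shintani_zeta_line(1)[OF A s(1)] and zeta_hol = shintani_zeta_line(2)[OF A s(1)]
  have subY: "?Y \<subseteq> {t. s + vec t \<in> tube A N}" using tubeY by blast
  have cont: "continuous_on ?Y h"
    unfolding h_def
    by (intro continuous_intros zeta_cont holomorphic_on_imp_continuous_on[OF holP]
        holomorphic_on_imp_continuous_on[OF holomorphic_on_subset[OF holF subY]])
  have "?D \<subseteq> ?Y" by auto
  then have "?D \<subseteq> {t. s + vec t \<in> tube A N}" using subY by (rule subset_trans)
  then have holh: "h holomorphic_on ?D"
    unfolding h_def by (intro holomorphic_intros zeta_hol holP holomorphic_on_subset[OF holF])
  have h0: "h t = 0" if "t \<in> ?D" for t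
  proof (rule analytic_continuation_open[where s = "?D \<inter> {t. s + vec t \<in> tube A 0}" and s' = ?D and f = h and g = "\<lambda>_. 0"])
    show "open (?D \<inter> {t. s + vec t \<in> tube A 0})" by (intro open_Int open_halfspace_Re_gt open_tube_line)
    show "?D \<inter> {t. s + vec t \<in> tube A 0} \<noteq> {}" using tube_line_nonempty[of s A 0] by blast
    show "connected ?D" by (intro convex_connected convex_halfspace_Re_gt)
    show "h t = 0" if "t \<in> ?D \<inter> {t. s + vec t \<in> tube A 0}" for t
      using eq that by (simp add: h_def)
  qed (use that holh in \<open>auto simp: open_halfspace_Re_gt\<close>)
  define x where "x = (\<lambda>n. complex_of_real (inverse (real (Suc n))))"
  have "x \<longlonglongrightarrow> complex_of_real 0" unfolding x_def by (intro tendsto_of_real LIMSEQ_inverse_real_of_nat)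
  then have "(\<lambda>n. h (x n)) \<longlonglongrightarrow> h 0"
    by (intro continuous_on_tendsto_compose[OF cont]) (auto simp: x_def)
  moreover have "h (x n) = 0" for n by (rule h0) (simp add: x_def)
  ultimately have "h 0 = 0" by (simp add: LIMSEQ_const_iff)
  then show ?thesis unfolding h_def v0 by simp
qed

section \<open>The hyperplanes of the statement and the final gluing\<close>

definition pole_pair :: "real ^ 'r ^ 'n \<Rightarrow> 'n set \<times> nat \<Rightarrow> (int ^ 'n) \<times> int" where
  "pole_pair A = (\<lambda>(T, l). (ivec T, int (level (column_support A) (\<lambda>_. 1) UNIV T) - int l))"

lemma inj_pole_pair: "inj_on (pole_pair A) X"
  by (auto simp: inj_on_def pole_pair_def dest: injD[OF inj_ivec])

lemma pole_form_pole_pair: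
  "pole_form A p s = (case pole_pair A p of (\<mu>, c) \<Rightarrow> int_pairing \<mu> s - of_int c)"
  by (cases p) (simp add: pole_form_def pole_pair_def int_pairing_ivec)

lemma pole_form_eq_0_iff: "pole_form A p s = 0 \<longleftrightarrow> s \<in> hyperplane_Cn (pole_pair A p)"
  unfolding pole_form_pole_pair hyperplane_Cn_def by (simp add: case_prod_unfold)

text \<open>The facets for \<open>J = UNIV\<close> account for all pairs; the bounds on
  \<open>l\<close> match because \<open>axis i 1\<close> is \<open>ivec {i}\<close>.\<close>

lemma pole_pair_in_shintani_hyperplanes:
  fixes A :: "real ^ 'r ^ 'n"
  assumes A: "A \<in> Sigma_mat"
    and \<nu>: "\<forall>J. facet_levels (newton_polyhedron (column_poly A J)) (\<nu> J)"
  shows "pole_pair A ` pole_index A N \<subseteq> shintani_hyperplanes A \<nu>"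
proof
  fix h assume "h \<in> pole_pair A ` pole_index A N"
  then obtain T l where h: "h = pole_pair A (T, l)" and Tl: "(T, l) \<in> pole_index A N" by auto
  have T: "linked (column_support A) UNIV T" using Tl by (simp add: pole_index_def linked_set_def)
  have normal: "ivec T \<in> facet_normals (newton_polyhedron (column_poly A UNIV))"
    unfolding facet_normals_column_poly[OF A] using T by blast
  have lev: "\<nu> UNIV (ivec T) = int (level (column_support A) (\<lambda>_. 1) UNIV T)"
    using \<nu>[rule_format, of UNIV] T unfolding facet_levels_column_poly[OF A] by blast
  have bound: "int l \<le> \<nu> UNIV (ivec T) - 1" if ax: "\<exists>i. ivec T = (axis i 1 :: int ^ 'n)"
  proof -
    obtain i where "ivec T = (axis i 1 :: int ^ 'n)" using ax ..
    moreover have "(axis i 1 :: int ^ 'n) = ivec {i}" by (simp add: vec_eq_iff ivec_def axis_def)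
    ultimately have "T = {i}" by (metis injD inj_ivec)
    then show ?thesis using Tl unfolding lev by (auto simp: pole_index_def)
  qed
  show "h \<in> shintani_hyperplanes A \<nu>"
    unfolding h shintani_hyperplanes_def pole_pair_def prod.case lev[symmetric] mem_Collect_eq
    by (intro exI[of _ UNIV] exI[of _ "ivec T"] exI[of _ l] conjI impI refl normal bound)
qed

text \<open>The family may be infinite, but only finitely many normals occur, and for each of them
  the union is the preimage of a set of integers, which is closed.\<close>

lemma closed_shintani_hyperplanes:
  fixes A :: "real ^ 'r ^ 'n"
  assumes A: "A \<in> Sigma_mat"
  shows "closed (\<Union>h\<in>shintani_hyperplanes A \<nu>. hyperplane_Cn h)"
proof -
  let ?H = "shintani_hyperplanes A \<nu>"
  have fst_H: "\<exists>T. fst h = ivec T" if "h \<in> ?H" for h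
    using that unfolding shintani_hyperplanes_def facet_normals_column_poly[OF A] by auto
  have "(\<Union>h\<in>?H. hyperplane_Cn h) = (\<Union>T. {s. int_pairing (ivec T) s \<in> of_int ` {c. (ivec T, c) \<in> ?H}})"
  proof (intro equalityI subsetI)
    fix s :: "complex ^ 'n" assume "s \<in> (\<Union>h\<in>?H. hyperplane_Cn h)"
    then obtain h where h: "h \<in> ?H" "s \<in> hyperplane_Cn h" by blast
    obtain T where T: "fst h = ivec T" using fst_H[OF h(1)] ..
    then have "(ivec T, snd h) \<in> ?H" using h(1) by (metis prod.collapse)
    then show "s \<in> (\<Union>T. {s. int_pairing (ivec T) s \<in> of_int ` {c. (ivec T, c) \<in> ?H}})"
      using h(2) T by (auto simp: hyperplane_Cn_def)
  next
    fix s :: "complex ^ 'n" assume "s \<in> (\<Union>T. {s. int_pairing (ivec T) s \<in> of_int ` {c. (ivec T, c) \<in> ?H}})"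
    then obtain T c where "(ivec T, c) \<in> ?H" "int_pairing (ivec T) s = of_int c" by auto
    then show "s \<in> (\<Union>h\<in>?H. hyperplane_Cn h)"
      by (intro UN_I[of "(ivec T, c)"]) (auto simp: hyperplane_Cn_def)
  qed
  moreover have "closed {s :: complex ^ 'n. int_pairing (ivec T) s \<in> of_int ` {c. (ivec T, c) \<in> ?H}}" for T
  proof -
    have "continuous_on UNIV (int_pairing (ivec T) :: complex ^ 'n \<Rightarrow> complex)"
      unfolding int_pairing_ivec[abs_def] by (intro continuous_intros)
    from closed_vimage[OF closed_of_int_image this] show ?thesis by (simp only: vimage_def)
  qed
  ultimately show ?thesis by (simp add: closed_UN)
qed

lemma interior_shintani_domain_nonempty:
  fixes A :: "real ^ 'r ^ 'n"
  assumes "A \<in> Sigma_mat"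
  shows "interior (shintani_domain A) \<noteq> {}"
proof -
  obtain t where "(0 :: complex ^ 'n) + vec t \<in> tube A 0" using tube_line_nonempty by blast
  moreover have "tube A 0 \<subseteq> interior (shintani_domain A)"
    using mellin_representation(1)[OF assms] by (intro interior_maximal open_tube) blast
  ultimately show ?thesis by blast
qed

lemma shintani_continuation:
  fixes A :: "real ^ 'r ^ 'n"
  assumes A: "A \<in> Sigma_mat"
    and \<nu>: "\<forall>J. facet_levels (newton_polyhedron (column_poly A J)) (\<nu> J)"
  shows "\<exists>Z. meromorphic_simple_poles Z (shintani_hyperplanes A \<nu>) \<and>
    (\<forall>s \<in> shintani_domain A. Z s = shintani_zeta A s)"
proof -
  define H where "H = (\<Union>h\<in>shintani_hyperplanes A \<nu>. hyperplane_Cn h)"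
  have clH: "closed H" unfolding H_def by (rule closed_shintani_hyperplanes[OF A])
  define P where "P = (\<lambda>N s. \<Prod>p\<in>pole_index A N. pole_form A p s)"
  have diffP: "cdifferentiable_at (P N) s" for N s
    unfolding P_def by (intro cdifferentiable_prod cdifferentiable_pole_form)
  have "\<forall>N. \<exists>F. holomorphic_Cn F (tube A N) \<and> (\<forall>s\<in>tube A 0. F s = P N s * shintani_zeta A s)"
    using continuation[OF A] unfolding extends_to_def P_def by (simp add: mellin_representation(2)[OF A])
  from choice[OF this] obtain F where F: "\<And>N. holomorphic_Cn (F N) (tube A N)"
    and F0: "\<And>N s. s \<in> tube A 0 \<Longrightarrow> F N s = P N s * shintani_zeta A s" by blast
  have diffF: "cdifferentiable_at (F N) s" if "s \<in> tube A N" for N s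
    using F[of N] that unfolding holomorphic_Cn_iff by blast
  have P_split: "P N s = P M s * (\<Prod>p\<in>pole_index A N - pole_index A M. pole_form A p s)" if "M \<le> N" for M N s
  proof -
    have "pole_index A M \<subseteq> pole_index A N" using that by (auto simp: pole_index_def)
    then show ?thesis unfolding P_def by (subst prod.subset_diff[OF _ finite_pole_index]) (auto simp: mult.commute)
  qed
  \<comment> \<open>The continuations are compatible: both sides agree on \<open>tube A 0\<close>,
    hence on \<open>tube A M\<close>.\<close>
  have F_split: "F N s = F M s * (\<Prod>p\<in>pole_index A N - pole_index A M. pole_form A p s)"
    if "M \<le> N" "s \<in> tube A M" for M N s
  proof (rule tube_identity[where N = M])
    fix s :: "complex ^ 'n"
    show "cdifferentiable_at (F N) s" if "s \<in> tube A M" using that tube_mono[OF \<open>M \<le> N\<close>] diffF by blast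
    show "cdifferentiable_at (\<lambda>s. F M s * (\<Prod>p\<in>pole_index A N - pole_index A M. pole_form A p s)) s" if "s \<in> tube A M"
      using that by (intro cdifferentiable_mult cdifferentiable_prod cdifferentiable_pole_form diffF)
    show "F N s = F M s * (\<Prod>p\<in>pole_index A N - pole_index A M. pole_form A p s)" if "s \<in> tube A 0"
      using that by (simp add: F0 P_split[OF \<open>M \<le> N\<close>])
  qed (rule that(2))
  have P_ne: "P N s \<noteq> 0" if "s \<notin> H" for N s
    using that pole_pair_in_shintani_hyperplanes[OF A \<nu>, of N] finite_pole_index[of A N]
    by (auto simp: P_def pole_form_eq_0_iff H_def)
  define N0 where "N0 = (\<lambda>s. LEAST N. s \<in> tube A N)"
  have N0: "s \<in> tube A (N0 s)" for s unfolding N0_def by (rule LeastI_ex[OF tube_exhausts])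
  have N0_le: "N0 s \<le> N" if "s \<in> tube A N" for s N unfolding N0_def using that by (rule Least_le)
  \<comment> \<open>Off \<open>H\<close> the quotient is taken at the least \<open>N\<close> whose
    tube contains \<open>s\<close>; by compatibility any larger \<open>N\<close> gives the same
    value. On \<open>H\<close> the value of the series is inserted so that \<open>Z\<close> also
    agrees with it at points of absolute convergence on a hyperplane.\<close>
  define Z where "Z = (\<lambda>s. if s \<in> H then shintani_zeta A s else F (N0 s) s / P (N0 s) s)"
  have Z: "Z s * P N s = F N s" if "s \<notin> H" "s \<in> tube A N" for s N
    using that P_ne[OF that(1), of "N0 s"] P_split[OF N0_le[OF that(2)]] F_split[OF N0_le[OF that(2)] N0]
    by (simp add: Z_def)
  have "holomorphic_Cn Z (- H)"
    unfolding holomorphic_Cn_iff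
  proof (intro conjI ballI)
    show "open (- H)" using clH by auto
    fix s assume "s \<in> - H"
    then have s: "s \<notin> H" by simp
    obtain N where N: "s \<in> tube A N" using tube_exhausts by blast
    have "cdifferentiable_at (\<lambda>s. F N s * inverse (P N s)) s"
      by (intro cdifferentiable_mult diffF N cdifferentiable_compose[where g = inverse] diffP
          field_differentiable_inverse field_differentiable_ident P_ne[OF s])
    then show "cdifferentiable_at Z s"
    proof (rule cdifferentiable_transform)
      show "open (tube A N - H)" by (intro open_Diff open_tube clH)
      show "s \<in> tube A N - H" using N s by simp
      fix z assume z: "z \<in> tube A N - H"
      then have "Z z * P N z = F N z" "P N z \<noteq> 0" using Z P_ne by auto
      then show "F N z * inverse (P N z) = Z z" by (metis divide_inverse nonzero_mult_div_cancel_right)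
    qed
  qed
  moreover have "\<exists>U K g. s\<^sub>0 \<in> U \<and> finite K \<and> K \<subseteq> shintani_hyperplanes A \<nu> \<and> holomorphic_Cn g U \<and>
      (\<forall>s\<in>U - H. Z s * (\<Prod>(\<mu>, c)\<in>K. int_pairing \<mu> s - of_int c) = g s)" for s\<^sub>0
  proof -
    obtain N where N: "s\<^sub>0 \<in> tube A N" using tube_exhausts by blast
    have "(\<Prod>(\<mu>, c)\<in>pole_pair A ` pole_index A N. int_pairing \<mu> s - of_int c) = P N s" for s
      unfolding P_def by (subst prod.reindex[OF inj_pole_pair]) (simp add: pole_form_pole_pair)
    then show ?thesis
      using N F[of N] Z pole_pair_in_shintani_hyperplanes[OF A \<nu>, of N] finite_pole_index[of A N]
      by (intro exI[of _ "tube A N"] exI[of _ "pole_pair A ` pole_index A N"] exI[of _ "F N"]) auto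
  qed
  ultimately have "meromorphic_simple_poles Z (shintani_hyperplanes A \<nu>)"
    unfolding meromorphic_simple_poles_def H_def by blast
  moreover have "Z s = shintani_zeta A s" if s: "s \<in> shintani_domain A" for s
  proof (cases "s \<in> H")
    case True
    then show ?thesis by (simp add: Z_def)
  next
    case False
    obtain N where N: "s \<in> tube A N" using tube_exhausts by blast
    have "F N s = P N s * shintani_zeta A s"
      by (rule continuation_agrees_on_domain[OF A s N]) (auto intro: diffF diffP F0)
    then show ?thesis using Z[OF False N] P_ne[OF False, of N] by simp
  qed
  ultimately show ?thesis by blast
qed

theorem theorem3p6:
  fixes A :: "real ^ 'r ^ 'n"
  assumes "A \<in> Sigma_mat"
  shows "(\<forall>J. \<exists>\<nu>. facet_levels (newton_polyhedron (column_poly A J)) \<nu>) \<and>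
         (\<forall>\<nu>. (\<forall>J. facet_levels (newton_polyhedron (column_poly A J)) (\<nu> J)) \<longrightarrow>
           interior (shintani_domain A) \<noteq> {} \<and>
           (\<exists>Z. meromorphic_simple_poles Z (shintani_hyperplanes A \<nu>) \<and>
                (\<forall>s \<in> shintani_domain A. Z s = shintani_zeta A s)))"
proof (intro conjI allI impI)
  fix J :: "'r set"
  let ?S = "column_support A"
  \<comment> \<open>The witness reads \<open>T\<close> off its indicator vector as the set of
    coordinates equal to 1.\<close>
  have "facet_levels (newton_polyhedron (column_poly A J))
      (\<lambda>\<mu> :: int ^ 'n. int (level ?S (\<lambda>_. 1) J {i. \<mu> $ i = 1}))"
    unfolding facet_levels_column_poly[OF assms] by (simp add: ivec_def)
  then show "\<exists>\<nu>. facet_levels (newton_polyhedron (column_poly A J)) \<nu>" by blast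
next
  show "interior (shintani_domain A) \<noteq> {}" by (rule interior_shintani_domain_nonempty[OF assms])
next
  fix \<nu> assume "\<forall>J. facet_levels (newton_polyhedron (column_poly A J)) (\<nu> J)"
  then show "\<exists>Z. meromorphic_simple_poles Z (shintani_hyperplanes A \<nu>) \<and>
      (\<forall>s\<in>shintani_domain A. Z s = shintani_zeta A s)"
    by (rule shintani_continuation[OF assms])
qed

end
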